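(* Let $m\ge 1$ and $n\ge m-1$ be integers. For any nonzero $x_1,\dots,x_m$ and any fixed choice of square roots $\sqrt{-x_i}$, put $\xi_i=\sqrt{-x_i}+(\sqrt{-x_i})^{-1}$. Then $$P_n(x_1,\dots,x_m)=\prod_{i=1}^{m}\frac{(-q;q)_{n+1-i}}{(q;q)_{n+1-i}}\left(\sqrt{-x_i}\right)^{n+1-m}\prod_{1\le i<j\le m}(x_j-x_i)\ \tilde{\mathbb P}_{(n+1-m)^m}(\xi_1,\dots,\xi_m).$$ When the number of variables is even, written as $2m$ (with $m\geq 1$, $n\ge 2m-1$), one equivalently has $$P_n(x_1,\dots,x_{2m})=\prod_{i=1}^{2m}\left(\sqrt{-x_i}\right)^{n+1-2m}\prod_{1\le i<j\le 2m}(x_j-x_i)\ \tilde K_m^n(\xi_1,\dots,\xi_{2m}).$$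
   Context: $q$ is a generic complex parameter: $q\neq 0$ and $q$ is not a root of unity. $(a;q)_k=(1-a)(1-aq)\cdots(1-aq^{k-1})$ and $(a_1,\dots,a_r;q)_k=(a_1;q)_k\cdots(a_r;q)_k$. For integers $n\ge 0$, $m\ge1$, $$P_n(x_1,\dots,x_m)=\frac{(-q;q)_n^m}{(q;q)_n^m}\sum_{k_1,\dots,k_m=0}^n\ \prod_{1\le i<j\le m}\frac{q^{k_j}-q^{k_i}}{q^{k_j}+q^{k_i}}\prod_{i=1}^m\frac{(-q,q^{-n};q)_{k_i}}{(q,-q^{-n};q)_{k_i}}\,x_i^{k_i}.$$ The monic polynomials $c_n$ (rescaled continuous $q$-ultraspherical polynomials) are $c_n(x)=\frac{(q;q)_n}{(-q;q)_n}C_n(x/2;-q|q)$, that is, $$c_n(z+z^{-1})=\frac{(q;q)_n}{(-q;q)_n}\sum_{k=0}^n\frac{(-q;q)_k(-q;q)_{n-k}}{(q;q)_k(q;q)_{n-k}}\,z^{n-2k},$$ and $\|c_k\|^2=\frac{(q;q)_k(q;q)_{k+1}}{(-q;q)_k(-q;q)_{k+1}}$. Each $c_n$ is even or odd according to the parity of $n$. For $N\ge 0$, $$\tilde{\mathbb P}_{N^m}(x_1,\dots,x_m)=\frac{\det_{1\le i,j\le m}\left(c_{N+2j-2}(x_i)\right)}{\prod_{1\le i<j\le m}(x_j^2-x_i^2)},$$ which is a polynomial in $x_1,\dots,x_m$ (and is so interpreted when some $x_i^2=x_j^2$), and for $n\ge 2m-1$, $$\tilde K_m^n(x_1,\dots,x_{2m})=\frac{1}{\prod_{i=1}^m\|c_{n+1-2i}\|^2}\,\frac{\det_{1\le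 i,j\le 2m}\left(c_{n-2m+2j-1}(x_i)\right)}{\prod_{1\le i<j\le 2m}(x_j^2-x_i^2)}.$$ *)

theory Defs
  imports
    Complex_Main
    "HOL-Library.FuncSet"
    "HOL-Computational_Algebra.Polynomial"
    "Jordan_Normal_Form.Determinant"
begin

text \<open>
  Tuples \<open>x\<^sub>1, \<dots>, x\<^sub>m\<close> are functions \<^typ>\<open>nat \<Rightarrow> complex\<close>
  of which only the values at the indices \<open>1, \<dots>, m\<close> are used.
\<close>

definition qpoch :: "complex \<Rightarrow> complex \<Rightarrow> nat \<Rightarrow> complex" where
  "qpoch a q k = (\<Prod>i<k. 1 - a * q ^ i)"

definition P :: "complex \<Rightarrow> nat \<Rightarrow> nat \<Rightarrow> (nat \<Rightarrow> complex) \<Rightarrow> complex" where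
  "P q n m x =
     qpoch (-q) q n ^ m / qpoch q q n ^ m *
     (\<Sum>k \<in> {1..m} \<rightarrow>\<^sub>E {0..n}.
        (\<Prod>j=1..m. \<Prod>i=1..<j. (q ^ k j - q ^ k i) / (q ^ k j + q ^ k i)) *
        (\<Prod>i=1..m.
           (qpoch (-q) q (k i) * qpoch (q powi (- int n)) q (k i)) /
           (qpoch q q (k i) * qpoch (- (q powi (- int n))) q (k i)) * x i ^ k i))"

text \<open>
  The rescaled continuous $q$-ultraspherical polynomial \<open>c\<^sub>n\<close>. The Laurent polynomial on the
  right-hand side is invariant under \<open>z \<mapsto> 1/z\<close>, hence it is a polynomial in
  \<open>z + 1/z\<close>, and that polynomial is unique.
\<close>

definition c :: "complex \<Rightarrow> nat \<Rightarrow> complex poly" where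
  "c q n = (THE p. \<forall>z. z \<noteq> 0 \<longrightarrow>
     poly p (z + inverse z) =
       qpoch q q n / qpoch (-q) q n *
       (\<Sum>k=0..n. (qpoch (-q) q k * qpoch (-q) q (n - k)) / (qpoch q q k * qpoch q q (n - k)) *
          z powi (int n - 2 * int k)))"

definition c_norm_sq :: "complex \<Rightarrow> nat \<Rightarrow> complex" where
  "c_norm_sq q k = (qpoch q q k * qpoch q q (k + 1)) / (qpoch (-q) q k * qpoch (-q) q (k + 1))"

definition polynomial_fun :: "nat \<Rightarrow> ((nat \<Rightarrow> complex) \<Rightarrow> complex) \<Rightarrow> bool" where
  "polynomial_fun m f \<longleftrightarrow>
     (\<exists>d a. \<forall>x. f x = (\<Sum>k \<in> {1..m} \<rightarrow>\<^sub>E {0..d}. a k * (\<Prod>i=1..m. x i ^ k i)))"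

text \<open>
  The quotient $\det_{1\le i,j\le m}(p_j(x_i)) / \prod_{1\le i<j\le m}(x_j^2-x_i^2)$, read as the
  polynomial in \<open>x\<^sub>1, \<dots>, x\<^sub>m\<close> that agrees with it wherever the denominator is nonzero. This
  polynomial is unique, and it exists whenever all \<open>p\<^sub>j\<close> are even or all \<open>p\<^sub>j\<close> are odd, as is
  the case below. Matrix entries are indexed from 0, whence the shifts by 1.
\<close>

definition det_quotient :: "nat \<Rightarrow> (nat \<Rightarrow> complex poly) \<Rightarrow> (nat \<Rightarrow> complex) \<Rightarrow> complex" where
  "det_quotient m p = (THE f. polynomial_fun m f \<and>
     (\<forall>x. (\<Prod>j=1..m. \<Prod>i=1..<j. (x j)\<^sup>2 - (x i)\<^sup>2) \<noteq> 0 \<longrightarrow>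
        f x = det (mat m m (\<lambda>(i, j). poly (p (j + 1)) (x (i + 1)))) /
              (\<Prod>j=1..m. \<Prod>i=1..<j. (x j)\<^sup>2 - (x i)\<^sup>2)))"

text \<open>\<open>P_tilde q N m\<close> is $\tilde{\mathbb P}_{N^m}$.\<close>

definition P_tilde :: "complex \<Rightarrow> nat \<Rightarrow> nat \<Rightarrow> (nat \<Rightarrow> complex) \<Rightarrow> complex" where
  "P_tilde q N m = det_quotient m (\<lambda>j. c q (N + 2 * j - 2))"

text \<open>
  \<open>K_tilde q n m\<close> is $\tilde K^n_m$, in \<open>2 m\<close> variables. It is meant for \<open>n \<ge> 2 m - 1\<close>; then
  none of the subtractions below is truncated.
\<close>

definition K_tilde :: "complex \<Rightarrow> nat \<Rightarrow> nat \<Rightarrow> (nat \<Rightarrow> complex) \<Rightarrow> complex" where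
  "K_tilde q n m x =
     1 / (\<Prod>i=1..m. c_norm_sq q (n + 1 - 2 * i)) *
     det_quotient (2 * m) (\<lambda>j. c q (n + 2 * j - 1 - 2 * m)) x"

end

theory Submission
  imports Defs
begin

text \<open>
  Put \<open>y\<^sub>i = -x\<^sub>i = s\<^sub>i\<^sup>2\<close> and \<open>\<alpha>\<^sub>k = (-q;q)\<^sub>k / (q;q)\<^sub>k\<close>. The weight of the summation index \<open>k\<^sub>i\<close>, multiplied
  by one factor \<open>\<alpha>\<^sub>n\<close>, is \<open>\<alpha>\<^sub>k \<alpha>\<^sub>n\<^sub>-\<^sub>k y\<^sub>i\<^sup>k\<close> (\<open>weight_eq\<close>), so \<open>P\<close> becomes a sum \<open>Phi\<close> of the product of the kernel
  \<open>(q\<^sup>l - q\<^sup>k) / (q\<^sup>l + q\<^sup>k)\<close> over all pairs against a product weight. On the other side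
  \<open>s\<^sup>r c\<^sub>r(s + 1/s)\<close> is a polynomial \<open>cy r\<close> in \<open>y = s\<^sup>2\<close>, and
  \<open>(s\<^sub>j + 1/s\<^sub>j)\<^sup>2 - (s\<^sub>i + 1/s\<^sub>i)\<^sup>2\<close> is \<open>x\<^sub>j - x\<^sub>i\<close> times \<open>1 - y\<^sub>i y\<^sub>j\<close>, up to a monomial. The theorem is
  therefore equivalent to the polynomial identity \<open>Phi_eq_det_cy\<close>: with \<open>N = n + 1 - m\<close>, the product of all
  \<open>1 - y\<^sub>i y\<^sub>j\<close> times \<open>Phi\<close> equals \<open>\<alpha>\<^sub>N \<dots> \<alpha>\<^sub>n\<close> times the determinant \<open>det_cy\<close> of the polynomials
  \<open>cy N, cy (N + 2), \<dots>\<close>, homogenised by powers of \<open>y\<close>.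

  For an even number of variables, Schur's Pfaffian identity, used only as an expansion along the last index
  (\<open>schur_kernel_expansion\<close>), expresses \<open>Phi\<close> through its two-variable case and its value with two variables
  fewer. The two-variable case (\<open>pair_sum_eq\<close>) is a Christoffel-Darboux formula: it has the shape
  \<open>(f(y) g(z) - f(z) g(y)) / (1 - y z)\<close>. The determinant \<open>two_block\<close> with rows
  \<open>f, g, X f, X g, X\<^sup>2 f, X\<^sup>2 g, \<dots>\<close>, where \<open>X = y + 1/y\<close>, satisfies the same recursion
  (\<open>det_two_block_expansion\<close>): with the entries \<open>f, g\<close> of the last row held fixed and a suitable power of
  the last variable \<open>y\<close> as a factor, it is a polynomial in \<open>y\<close> of degree at most \<open>m - 2\<close>, and at the \<open>m - 1\<close> points
  \<open>y = 1/y\<^sub>i\<close> two values of \<open>X\<close> collide and the determinant factors. By the three-term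
  recurrence the columns of \<open>two_block\<close> are combinations of the columns of \<open>det_cy\<close>, so the two
  determinants are proportional (\<open>two_block_proportional\<close>).

  Setting the last variable to \<open>0\<close> lowers \<open>n\<close> and \<open>m\<close> by one in both \<open>Phi\<close> and \<open>det_cy\<close>
  (\<open>Phi_last_zero\<close>, \<open>det_cy_last_zero\<close>). This gives the identity for odd \<open>m\<close> and, by induction
  from \<open>m = 1\<close>, the constant of proportionality.

  Where the argument needs distinct or nonzero quantities, the general case follows by moving the variables along a
  line on which only finitely many points are exceptional. In the same way the
  quotient \<open>det_quotient\<close> is seen to be unique; it exists by Newton interpolation.
\<close>

section \<open>Products over pairs of indices\<close>

definition pairprod :: "(nat \<Rightarrow> nat \<Rightarrow> 'a::comm_monoid_mult) \<Rightarrow> nat set \<Rightarrow> 'a" where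
  "pairprod u I = (\<Prod>j\<in>I. \<Prod>i\<in>{i\<in>I. i < j}. u i j)"

lemma pairprod_cong:
  assumes "\<And>i j. i \<in> I \<Longrightarrow> j \<in> I \<Longrightarrow> i < j \<Longrightarrow> u i j = v i j"
  shows "pairprod u I = pairprod v I"
  unfolding pairprod_def using assms by (intro prod.cong) auto

lemma pairprod_reindex:
  assumes "strict_mono_on I \<pi>"
  shows "pairprod u (\<pi> ` I) = pairprod (\<lambda>i j. u (\<pi> i) (\<pi> j)) I"
proof -
  have inj: "inj_on \<pi> I"
    using assms by (rule strict_mono_on_imp_inj_on)
  have less: "\<pi> i < \<pi> j \<longleftrightarrow> i < j" if "i \<in> I" "j \<in> I" for i j
    using strict_mono_on_less[OF assms that] .
  have "(\<Prod>i\<in>{i\<in>\<pi> ` I. i < \<pi> j}. u i (\<pi> j)) = (\<Prod>i\<in>{i\<in>I. i < j}. u (\<pi> i) (\<pi> j))" if "j \<in> I" for j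
  proof -
    have "{i\<in>\<pi> ` I. i < \<pi> j} = \<pi> ` {i\<in>I. i < j}"
      using less that by auto
    then show ?thesis
      using inj by (simp add: prod.reindex inj_on_def)
  qed
  then show ?thesis
    unfolding pairprod_def using inj by (simp add: prod.reindex)
qed

lemma pairprod_mult: "pairprod (\<lambda>i j. u i j * v i j) I = pairprod u I * pairprod v I"
  unfolding pairprod_def by (simp add: prod.distrib)

lemma pairprod_empty [simp]: "pairprod u {} = 1"
  by (simp add: pairprod_def)

lemma pairprod_remove:
  assumes "finite I" "i \<in> I"
  shows "pairprod u I = pairprod u (I - {i}) *
           ((\<Prod>l\<in>{l\<in>I. l < i}. u l i) * (\<Prod>l\<in>{l\<in>I. i < l}. u i l))"
proof -
  have split: "(\<Prod>l\<in>{l\<in>I. l < j}. u l j) =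
      (\<Prod>l\<in>{l\<in>I - {i}. l < j}. u l j) * (if i < j then u i j else 1)" for j
  proof (cases "i < j")
    case True
    then have "{l\<in>I. l < j} = insert i {l\<in>I - {i}. l < j}"
      using assms by auto
    then show ?thesis
      using True assms by (simp add: mult.commute)
  next
    case False
    then have "{l\<in>I. l < j} = {l\<in>I - {i}. l < j}"
      by auto
    then show ?thesis
      using False by simp
  qed
  have "pairprod u I = (\<Prod>j\<in>I - {i}. \<Prod>l\<in>{l\<in>I. l < j}. u l j) * (\<Prod>l\<in>{l\<in>I. l < i}. u l i)"
    unfolding pairprod_def using assms by (simp add: prod.remove mult.commute)
  also have "(\<Prod>j\<in>I - {i}. \<Prod>l\<in>{l\<in>I. l < j}. u l j) =
      pairprod u (I - {i}) * (\<Prod>j\<in>I - {i}. if i < j then u i j else 1)"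
    by (subst split) (simp add: pairprod_def prod.distrib)
  also have "(\<Prod>j\<in>I - {i}. if i < j then u i j else 1) = (\<Prod>l\<in>{l\<in>I. i < l}. u i l)"
    using assms by (intro prod.mono_neutral_cong_right) auto
  finally show ?thesis
    by (simp add: mult_ac)
qed

lemma prod_remove_split:
  fixes I :: "nat set" and f :: "nat \<Rightarrow> 'a::comm_monoid_mult"
  assumes "finite I"
  shows "(\<Prod>l\<in>I - {i}. f l) = (\<Prod>l\<in>{l\<in>I. l < i}. f l) * (\<Prod>l\<in>{l\<in>I. i < l}. f l)"
proof -
  have "I - {i} = {l\<in>I. l < i} \<union> {l\<in>I. i < l}"
    by auto
  moreover have "prod f ({l\<in>I. l < i} \<union> {l\<in>I. i < l}) = prod f {l\<in>I. l < i} * prod f {l\<in>I. i < l}"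
    by (rule prod.union_disjoint) (use assms in auto)
  ultimately show ?thesis
    by metis
qed

lemma pairprod_remove_sym:
  assumes "finite I" "i \<in> I" "\<And>l. u l i = u i l"
  shows "pairprod u I = pairprod u (I - {i}) * (\<Prod>l\<in>I - {i}. u i l)"
  unfolding prod_remove_split[OF assms(1)] pairprod_remove[OF assms(1,2), of u] assms(3) ..

lemma pairprod_remove_antisym:
  fixes u :: "nat \<Rightarrow> nat \<Rightarrow> complex"
  assumes "i < M" "\<And>l. u l i = - u i l"
  shows "pairprod u {..<M} = (-1) ^ i * pairprod u ({..<M} - {i}) * (\<Prod>l\<in>{..<M} - {i}. u i l)"
proof -
  have "{l\<in>{..<M}. l < i} = {..<i}"
    using assms(1) by auto
  then have "(\<Prod>l\<in>{l\<in>{..<M}. l < i}. u l i) = (-1) ^ i * (\<Prod>l\<in>{l\<in>{..<M}. l < i}. u i l)"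
    by (simp add: assms(2) prod_uminus)
  moreover have "pairprod u {..<M} = pairprod u ({..<M} - {i}) *
      ((\<Prod>l\<in>{l\<in>{..<M}. l < i}. u l i) * (\<Prod>l\<in>{l\<in>{..<M}. i < l}. u i l))"
    by (rule pairprod_remove) (use assms(1) in auto)
  moreover have "(\<Prod>l\<in>{..<M} - {i}. u i l) =
      (\<Prod>l\<in>{l\<in>{..<M}. l < i}. u i l) * (\<Prod>l\<in>{l\<in>{..<M}. i < l}. u i l)"
    by (rule prod_remove_split) simp
  ultimately show ?thesis
    by (simp only: mult_ac)
qed

lemma pairprod_lessThan_Suc:
  "pairprod u {..<Suc M} = pairprod u {..<M} * (\<Prod>l<M. u l M)"
proof -
  have *: "{..<Suc M} - {M} = {..<M}" "{l\<in>{..<Suc M}. l < M} = {..<M}" "{l\<in>{..<Suc M}. M < l} = {}"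
    by auto
  show ?thesis
    using pairprod_remove[of "{..<Suc M}" M u] unfolding * by simp
qed

lemma insert_index_image_lessThan:
  "i < Suc M \<Longrightarrow> insert_index i ` {..<M} = {..<Suc M} - {i}"
  using insert_index_image[of i M] by (simp add: lessThan_atLeast0)

lemma strict_mono_insert_index: "strict_mono_on I (insert_index i)"
  by (auto simp: strict_mono_on_def insert_index_def)

lemma prod_insert_index:
  assumes "i < Suc M"
  shows "(\<Prod>l\<in>{..<Suc M} - {i}. f l) = (\<Prod>l<M. f (insert_index i l))"
proof -
  have "(\<Prod>l\<in>insert_index i ` {..<M}. f l) = (\<Prod>l<M. f (insert_index i l))"
    by (subst prod.reindex[OF insert_index_inj_on]) simp
  then show ?thesis
    using insert_index_image_lessThan[OF assms] by simp
qed

lemma pairprod_geom: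
  fixes u :: "nat \<Rightarrow> complex"
  shows "pairprod (\<lambda>i j. u i * u j) {..<M} = (\<Prod>i<M. u i ^ (M - 1))"
proof (induction M)
  case 0
  then show ?case by simp
next
  case (Suc M)
  have "(\<Prod>i<M. u i ^ (M - 1)) * (\<Prod>i<M. u i) = (\<Prod>i<M. u i ^ M)"
    by (cases M) (simp_all add: prod.distrib[symmetric] power_commutes)
  then show ?case
    using Suc by (simp add: pairprod_lessThan_Suc prod.distrib prod_constant mult_ac)
qed

section \<open>Identities that extend by continuity\<close>

text \<open>
  Exceptional parameters on a line are roots of nonzero polynomials, hence isolated.
\<close>

lemma eventually_poly_nonzero:
  fixes p :: "complex poly"
  assumes "p \<noteq> 0"
  shows "eventually (\<lambda>s. poly p s \<noteq> 0) (at 0)"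
proof -
  define Z where "Z = {s. poly p s = 0} - {0}"
  have "closed Z"
    unfolding Z_def using poly_roots_finite[OF assms] by (intro finite_imp_closed) simp
  then have "open (- Z)"
    by (rule open_Compl)
  moreover have "0 \<in> - Z" and "\<forall>s\<in>- Z. s \<noteq> 0 \<longrightarrow> poly p s \<noteq> 0"
    by (auto simp: Z_def)
  ultimately show ?thesis
    unfolding eventually_at_topological by blast
qed

lemma isCont_eq_at_0:
  fixes f g :: "complex \<Rightarrow> complex"
  assumes "isCont f 0" "isCont g 0" "eventually (\<lambda>s. f s = g s) (at 0)"
  shows "f 0 = g 0"
proof -
  have "(g \<longlongrightarrow> f 0) (at 0)"
    using assms(1,3) unfolding isCont_def by (simp add: tendsto_cong)
  then show ?thesis
    using assms(2) unfolding isCont_def by (intro tendsto_unique[of "at 0" g]) auto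
qed

lemma isCont_pairprod:
  assumes "\<And>i j. i \<in> I \<Longrightarrow> j \<in> I \<Longrightarrow> i < j \<Longrightarrow> isCont (\<lambda>s. u s i j :: complex) (a :: complex)"
  shows "isCont (\<lambda>s. pairprod (u s) I) a"
  unfolding pairprod_def using assms by (intro continuous_intros) auto

lemma eventually_affine_nonzero:
  fixes a b :: complex
  assumes "b \<noteq> 0"
  shows "eventually (\<lambda>s. a + s * b \<noteq> 0) (at 0)"
  using eventually_poly_nonzero[of "[:a, b:]"] assms by simp

section \<open>Expansion of the product of the Schur kernel\<close>

text \<open>
  The difference of the two sides, multiplied by \<open>\<Prod>(s + t\<^sub>j)\<close>, is a polynomial in \<open>s\<close> of degree at most
  \<open>card J\<close>. Oddness of \<open>card J\<close> makes it vanish at all points \<open>-t\<^sub>a\<close>, so it is a multiple of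
  \<open>\<Prod>(s + t\<^sub>j)\<close>; the values at infinity and at \<open>0\<close> give opposite expressions for the factor, which is thus zero.
\<close>

lemma odd_partial_fractions:
  fixes t :: "nat \<Rightarrow> complex"
  assumes fin: "finite J" and odd: "odd (card J)" and inj: "inj_on t J"
    and nz: "\<And>i. i \<in> J \<Longrightarrow> t i \<noteq> 0" and s: "\<And>i. i \<in> J \<Longrightarrow> s + t i \<noteq> 0"
  shows "(\<Prod>j\<in>J. (s - t j) / (s + t j)) =
    (\<Sum>i\<in>J. (s - t i) / (s + t i) * (\<Prod>j\<in>J - {i}. (t j + t i) / (t j - t i)))"
proof -
  define d where "d i = (\<Prod>j\<in>J - {i}. (t j + t i) / (t j - t i))" for i
  define L where "L = (\<Prod>j\<in>J. [:- t j, 1:])"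
  define Q where "Q = (\<Prod>j\<in>J. [:t j, 1:])"
  define R where "R = (\<Sum>i\<in>J. smult (d i) ([:- t i, 1:] * (\<Prod>j\<in>J - {i}. [:t j, 1:])))"
  define D where "D = (\<Sum>i\<in>J. d i)"
  define p where "p = L - R"
  have "degree L = card J" "degree Q = card J"
    unfolding L_def Q_def by (subst degree_prod_eq_sum_degree; simp)+
  moreover have "lead_coeff L = 1" "lead_coeff Q = 1"
    unfolding L_def Q_def by (simp_all add: lead_coeff_prod)
  ultimately have degL: "degree L \<le> card J" and degQ: "degree Q \<le> card J"
    and cL: "coeff L (card J) = 1" and cQ: "coeff Q (card J) = 1"
    by simp_all
  have term_R: "degree ([:- t i, 1:] * (\<Prod>j\<in>J - {i}. [:t j, 1:])) = card J \<and>
      lead_coeff ([:- t i, 1:] * (\<Prod>j\<in>J - {i}. [:t j, 1:])) = 1" if "i \<in> J" for i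
  proof -
    have "degree (\<Prod>j\<in>J - {i}. [:t j, 1:]) = card J - 1"
      using that fin by (subst degree_prod_eq_sum_degree) auto
    moreover have "(\<Prod>j\<in>J - {i}. [:t j, 1:]) \<noteq> 0"
      using fin by simp
    moreover have "card J > 0"
      using that fin by (auto simp: card_gt_0_iff)
    ultimately have "degree ([:- t i, 1:] * (\<Prod>j\<in>J - {i}. [:t j, 1:])) = card J"
      by (subst degree_mult_eq) auto
    moreover have "lead_coeff ([:- t i, 1:] * (\<Prod>j\<in>J - {i}. [:t j, 1:])) = 1"
      unfolding lead_coeff_mult lead_coeff_prod by simp
    ultimately show ?thesis
      by blast
  qed
  have degR: "degree R \<le> card J"
    unfolding R_def using term_R fin by (intro degree_sum_le) (auto intro: order_trans[OF degree_smult_le])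
  have cR: "coeff R (card J) = D"
    unfolding R_def D_def coeff_sum coeff_smult
  proof (intro sum.cong refl)
    fix i assume "i \<in> J"
    then show "d i * coeff ([:- t i, 1:] * (\<Prod>j\<in>J - {i}. [:t j, 1:])) (card J) = d i"
      using term_R[of i] by (metis mult.right_neutral)
  qed
  have evalR: "poly R z = (\<Sum>i\<in>J. d i * ((z - t i) * (\<Prod>j\<in>J - {i}. z + t j)))" for z
    by (simp add: R_def poly_sum poly_prod algebra_simps)
  have evalL: "poly L z = (\<Prod>j\<in>J. z - t j)" and evalQ: "poly Q z = (\<Prod>j\<in>J. z + t j)" for z
    by (simp_all add: L_def Q_def poly_prod algebra_simps)
  \<comment> \<open>At \<open>z = -t\<^sub>a\<close> both sides agree because \<open>card J\<close> is odd.\<close>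
  have roots: "poly p (- t a) = 0" if a: "a \<in> J" for a
  proof -
    have "poly R (- t a) = d a * ((- t a - t a) * (\<Prod>j\<in>J - {a}. - t a + t j))"
    proof -
      have "(\<Prod>j\<in>J - {i}. - t a + t j) = 0" if "i \<noteq> a" for i
        using that a fin by (auto intro!: prod_zero)
      then show ?thesis
        unfolding evalR using fin a by (subst sum.remove[of _ a]) (auto intro!: sum.neutral)
    qed
    also have "d a * (\<Prod>j\<in>J - {a}. - t a + t j) = (\<Prod>j\<in>J - {a}. t j + t a)"
      unfolding d_def prod.distrib[symmetric]
    proof (intro prod.cong refl)
      fix j assume "j \<in> J - {a}"
      then have "t j - t a \<noteq> 0"
        using inj a by (auto simp: inj_on_def)
      then show "(t j + t a) / (t j - t a) * (- t a + t j) = t j + t a"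
        by simp
    qed
    then have "d a * ((- t a - t a) * (\<Prod>j\<in>J - {a}. - t a + t j)) =
        - (2 * t a * (\<Prod>j\<in>J - {a}. t j + t a))"
      by (simp add: algebra_simps)
    also have "2 * t a * (\<Prod>j\<in>J - {a}. t j + t a) = (\<Prod>j\<in>J. t j + t a)"
      using fin a by (simp add: prod.remove)
    also have "- (\<Prod>j\<in>J. t j + t a) = (\<Prod>j\<in>J. - (t j + t a))"
      using odd by (subst prod_uminus) simp
    also have "\<dots> = poly L (- t a)"
      unfolding evalL by (intro prod.cong) auto
    finally show ?thesis
      by (simp add: p_def)
  qed
  have p_eq: "p = smult (1 - D) Q"
  proof (rule ccontr)
    assume ne: "p \<noteq> smult (1 - D) Q"
    define r where "r = p - smult (1 - D) Q"
    have "degree r \<le> card J"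
      unfolding r_def p_def using degL degR degQ
      by (intro degree_diff_le) (auto intro: order_trans[OF degree_smult_le])
    moreover have "coeff r (card J) = 0"
      by (simp add: r_def p_def cL cR cQ)
    moreover have "r \<noteq> 0"
      using ne by (simp add: r_def)
    ultimately have "degree r < card J"
      by (metis le_neq_implies_less leading_coeff_0_iff)
    have "poly r (- t a) = 0" if "a \<in> J" for a
      using roots[OF that] that fin by (auto simp: r_def evalQ intro!: prod_zero)
    then have "(\<lambda>a. - t a) ` J \<subseteq> {z. poly r z = 0}"
      by auto
    moreover have "card ((\<lambda>a. - t a) ` J) = card J"
      using inj by (intro card_image) (auto simp: inj_on_def)
    ultimately have "card J \<le> degree r"
      using card_poly_roots_bound[OF \<open>r \<noteq> 0\<close>] poly_roots_finite[OF \<open>r \<noteq> 0\<close>]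
      by (metis card_mono le_trans)
    then show False
      using \<open>degree r < card J\<close> by simp
  qed
  \<comment> \<open>Comparison at \<open>0\<close> shows that the multiple of \<open>Q\<close> vanishes.\<close>
  have "poly p 0 = (D - 1) * (\<Prod>j\<in>J. t j)"
  proof -
    have "poly R 0 = (\<Sum>i\<in>J. d i * (- (\<Prod>j\<in>J. t j)))"
      unfolding evalR using fin by (intro sum.cong) (auto simp: prod.remove)
    moreover have "poly L 0 = - (\<Prod>j\<in>J. t j)"
      using odd unfolding evalL by (simp add: prod_uminus)
    ultimately show ?thesis
      by (simp add: p_def D_def sum_distrib_right[symmetric] algebra_simps sum_negf)
  qed
  moreover have "poly p 0 = (1 - D) * (\<Prod>j\<in>J. t j)"
    by (subst p_eq) (simp add: evalQ)
  moreover have "(\<Prod>j\<in>J. t j) \<noteq> 0"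
    using nz fin by simp
  ultimately have "D - 1 = 1 - D"
    by (metis mult_right_cancel)
  then have "D = 1"
    by (simp add: algebra_simps)
  then have "p = 0"
    using p_eq by simp
  then have eq: "poly L s = poly R s"
    by (simp add: p_def)
  have Qs: "poly Q s \<noteq> 0"
    using s fin by (simp add: evalQ)
  have "(\<Prod>j\<in>J. (s - t j) / (s + t j)) = poly L s / poly Q s"
    by (simp add: evalL evalQ prod_dividef)
  also have "\<dots> = (\<Sum>i\<in>J. d i * ((s - t i) * (\<Prod>j\<in>J - {i}. s + t j)) / poly Q s)"
    by (simp add: eq evalR sum_divide_distrib)
  also have "\<dots> = (\<Sum>i\<in>J. (s - t i) / (s + t i) * d i)"
  proof (intro sum.cong refl)
    fix i assume i: "i \<in> J"
    have "poly Q s = (s + t i) * (\<Prod>j\<in>J - {i}. s + t j)"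
      using i fin by (simp add: evalQ prod.remove)
    then show "d i * ((s - t i) * (\<Prod>j\<in>J - {i}. s + t j)) / poly Q s = (s - t i) / (s + t i) * d i"
      using Qs by simp
  qed
  finally show ?thesis
    by (simp add: d_def)
qed

text \<open>
  For pairwise distinct \<open>t\<^sub>i\<close> this is the preceding partial fraction identity with \<open>s = t\<^sub>M\<close>, multiplied by the
  product over the pairs below \<open>M\<close>.
\<close>

lemma schur_kernel_expansion_distinct:
  fixes t :: "nat \<Rightarrow> complex"
  assumes "odd M" and inj: "inj_on t {..<M}"
    and nz: "\<And>i j. i \<le> M \<Longrightarrow> j \<le> M \<Longrightarrow> t i + t j \<noteq> 0"
  shows "pairprod (\<lambda>i j. (t j - t i) / (t j + t i)) {..<Suc M} =
    (\<Sum>i<M. (-1) ^ i * ((t M - t i) / (t M + t i)) *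
       pairprod (\<lambda>i j. (t j - t i) / (t j + t i)) ({..<M} - {i}))"
proof -
  define u where "u = (\<lambda>i j. (t j - t i) / (t j + t i))"
  have asym: "u l i = - u i l" for i l
    unfolding u_def by (metis add.commute minus_diff_eq minus_divide_left)
  have nz1: "t i \<noteq> 0" if "i \<le> M" for i
    using nz[OF that that] by auto
  have "pairprod u {..<Suc M} = pairprod u {..<M} * (\<Prod>l<M. (t M - t l) / (t M + t l))"
    by (simp add: pairprod_lessThan_Suc u_def)
  also have "(\<Prod>l<M. (t M - t l) / (t M + t l)) =
      (\<Sum>i<M. (t M - t i) / (t M + t i) * (\<Prod>j\<in>{..<M} - {i}. (t j + t i) / (t j - t i)))"
    using assms(1) inj nz nz1 by (intro odd_partial_fractions) auto
  also have "pairprod u {..<M} * \<dots> = (\<Sum>i<M. (-1) ^ i * u i M * pairprod u ({..<M} - {i}))"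
    unfolding sum_distrib_left
  proof (intro sum.cong refl)
    fix i assume i: "i \<in> {..<M}"
    have "(\<Prod>l\<in>{..<M} - {i}. u i l) * (\<Prod>j\<in>{..<M} - {i}. (t j + t i) / (t j - t i)) = 1"
      unfolding prod.distrib[symmetric]
    proof (rule prod.neutral, rule ballI)
      fix j assume j: "j \<in> {..<M} - {i}"
      then have "t j - t i \<noteq> 0"
        using inj i by (auto simp: inj_on_def)
      moreover have "t j + t i \<noteq> 0"
        using nz i j by auto
      ultimately show "u i j * ((t j + t i) / (t j - t i)) = 1"
        by (simp add: u_def)
    qed
    moreover have "pairprod u {..<M} = (-1) ^ i * pairprod u ({..<M} - {i}) * (\<Prod>l\<in>{..<M} - {i}. u i l)"
      by (rule pairprod_remove_antisym) (use i asym in blast)+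
    moreover have "e * p * d * (r * d') = e * r * p" if "d * d' = 1" for e p d r d' :: complex
      using that by (simp add: mult_ac)
    ultimately show "pairprod u {..<M} * ((t M - t i) / (t M + t i) * (\<Prod>j\<in>{..<M} - {i}. (t j + t i) / (t j - t i)))
        = (-1) ^ i * u i M * pairprod u ({..<M} - {i})"
      by (simp only: u_def)
  qed
  finally show ?thesis
    by (simp add: u_def)
qed

text \<open>
  Expansion along the last index of Schur's identity
  \<open>\<Prod>\<^sub>i\<^sub><\<^sub>j (t\<^sub>j - t\<^sub>i) / (t\<^sub>j + t\<^sub>i) = Pf ((t\<^sub>j - t\<^sub>i) / (t\<^sub>j + t\<^sub>i))\<close> for an even number of
  variables. Coinciding \<open>t\<^sub>i\<close> are reached by continuity; they do occur, as the values \<open>t\<^sub>i\<close> will be \<open>q\<close>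
  to the power of a summation index.
\<close>

lemma schur_kernel_expansion:
  fixes t :: "nat \<Rightarrow> complex"
  assumes "odd M" and nz: "\<And>i j. i \<le> M \<Longrightarrow> j \<le> M \<Longrightarrow> t i + t j \<noteq> 0"
  shows "pairprod (\<lambda>i j. (t j - t i) / (t j + t i)) {..<Suc M} =
    (\<Sum>i<M. (-1) ^ i * ((t M - t i) / (t M + t i)) *
       pairprod (\<lambda>i j. (t j - t i) / (t j + t i)) ({..<M} - {i}))"
proof -
  define T where "T s i = t i + s * of_nat i" for s :: complex and i
  define f where "f s = pairprod (\<lambda>i j. (T s j - T s i) / (T s j + T s i)) {..<Suc M}" for s
  define g where "g s = (\<Sum>i<M. (-1) ^ i * ((T s M - T s i) / (T s M + T s i)) *
       pairprod (\<lambda>i j. (T s j - T s i) / (T s j + T s i)) ({..<M} - {i}))" for s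
  have contT: "isCont (\<lambda>s. T s i) 0" for i
    unfolding T_def by (intro continuous_intros)
  have T0: "T 0 i = t i" for i
    by (simp add: T_def)
  have contS: "isCont (\<lambda>s. (T s j - T s i) / (T s j + T s i)) 0" if "i \<le> M" "j \<le> M" for i j
    by (intro continuous_intros contT) (use nz[OF that(2,1)] in \<open>simp add: T0\<close>)
  have "isCont f 0"
    unfolding f_def by (rule isCont_pairprod) (auto intro: contS)
  moreover have "isCont g 0"
    unfolding g_def
    by (rule isCont_sum, rule ballI, intro isCont_mult isCont_pairprod contS continuous_const) auto
  moreover have "eventually (\<lambda>s. f s = g s) (at 0)"
  proof -
    have "eventually (\<lambda>s. i \<noteq> j \<longrightarrow> T s i \<noteq> T s j) (at 0)" for i j
    proof (cases "i = j")
      case False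
      then have "eventually (\<lambda>s. t i - t j + s * (of_nat i - of_nat j) \<noteq> 0) (at 0)"
        by (intro eventually_affine_nonzero) simp
      then show ?thesis
        by eventually_elim (auto simp: T_def algebra_simps)
    qed simp
    then have dist: "eventually (\<lambda>s. \<forall>i\<in>{..<M}. \<forall>j\<in>{..<M}. i \<noteq> j \<longrightarrow> T s i \<noteq> T s j) (at 0)"
      by (simp add: eventually_ball_finite_distrib)
    have "eventually (\<lambda>s. T s i + T s j \<noteq> 0) (at 0)" if "i \<le> M" "j \<le> M" for i j
    proof -
      have "isCont (\<lambda>s. T s i + T s j) 0"
        by (intro continuous_intros contT)
      then show ?thesis
        unfolding isCont_def using nz[OF that] by (intro tendsto_imp_eventually_ne) (auto simp: T0)
    qed
    then have "eventually (\<lambda>s. \<forall>i\<in>{..M}. \<forall>j\<in>{..M}. T s i + T s j \<noteq> 0) (at 0)"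
      by (simp add: eventually_ball_finite_distrib)
    with dist show ?thesis
    proof eventually_elim
      case (elim s)
      show ?case
        unfolding f_def g_def
        by (rule schur_kernel_expansion_distinct) (use assms(1) elim in \<open>auto simp: inj_on_def\<close>)
    qed
  qed
  ultimately have "f 0 = g 0"
    by (rule isCont_eq_at_0)
  then show ?thesis
    by (simp add: f_def g_def T0)
qed

section \<open>Sums of the Schur kernel against product weights\<close>

definition schur_sum ::
    "('b \<Rightarrow> 'b \<Rightarrow> complex) \<Rightarrow> 'b set \<Rightarrow> (nat \<Rightarrow> 'b \<Rightarrow> complex) \<Rightarrow> nat set \<Rightarrow> complex" where
  "schur_sum S A W I =
    (\<Sum>k\<in>I \<rightarrow>\<^sub>E A. pairprod (\<lambda>i j. S (k i) (k j)) I * (\<Prod>i\<in>I. W i (k i)))"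

lemma sum_PiE_insert:
  assumes "i \<notin> I"
  shows "(\<Sum>k\<in>insert i I \<rightarrow>\<^sub>E A. g k) = (\<Sum>x\<in>A. \<Sum>k\<in>I \<rightarrow>\<^sub>E A. g (k(i := x)))"
proof -
  have "(\<Sum>k\<in>insert i I \<rightarrow>\<^sub>E A. g k) = (\<Sum>(x, k)\<in>A \<times> (I \<rightarrow>\<^sub>E A). g (k(i := x)))"
    unfolding PiE_insert_eq using inj_combinator[OF assms, of "\<lambda>_. A"]
    by (simp add: sum.reindex case_prod_unfold)
  then show ?thesis
    by (simp add: sum.cartesian_product)
qed

lemma schur_sum_reindex:
  assumes "strict_mono_on I \<pi>"
  shows "schur_sum S A W (\<pi> ` I) = schur_sum S A (\<lambda>i. W (\<pi> i)) I"
proof -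
  have inj: "inj_on \<pi> I"
    using assms by (rule strict_mono_on_imp_inj_on)
  show ?thesis
    unfolding schur_sum_def
  proof (rule sum.reindex_bij_witness[where i = "\<lambda>k. \<lambda>y\<in>\<pi> ` I. k (the_inv_into I \<pi> y)"
        and j = "\<lambda>k. \<lambda>i\<in>I. k (\<pi> i)"])
    fix k assume k: "k \<in> \<pi> ` I \<rightarrow>\<^sub>E A"
    show "(\<lambda>y\<in>\<pi> ` I. (\<lambda>i\<in>I. k (\<pi> i)) (the_inv_into I \<pi> y)) = k"
      using k inj by (auto simp: fun_eq_iff the_inv_into_f_f PiE_def extensional_def)
    show "(\<lambda>i\<in>I. k (\<pi> i)) \<in> I \<rightarrow>\<^sub>E A"
      using k by auto
    have "pairprod (\<lambda>i j. S ((\<lambda>i\<in>I. k (\<pi> i)) i) ((\<lambda>i\<in>I. k (\<pi> i)) j)) I =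
        pairprod (\<lambda>i j. S (k i) (k j)) (\<pi> ` I)"
      unfolding pairprod_reindex[OF assms] by (intro pairprod_cong) auto
    moreover have "(\<Prod>i\<in>I. W (\<pi> i) ((\<lambda>i\<in>I. k (\<pi> i)) i)) = (\<Prod>i\<in>\<pi> ` I. W i (k i))"
      using inj by (simp add: prod.reindex)
    ultimately show "pairprod (\<lambda>i j. S ((\<lambda>i\<in>I. k (\<pi> i)) i) ((\<lambda>i\<in>I. k (\<pi> i)) j)) I *
        (\<Prod>i\<in>I. W (\<pi> i) ((\<lambda>i\<in>I. k (\<pi> i)) i)) =
        pairprod (\<lambda>i j. S (k i) (k j)) (\<pi> ` I) * (\<Prod>i\<in>\<pi> ` I. W i (k i))"
      by simp
  next
    fix k assume k: "k \<in> I \<rightarrow>\<^sub>E A"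
    show "(\<lambda>i\<in>I. (\<lambda>y\<in>\<pi> ` I. k (the_inv_into I \<pi> y)) (\<pi> i)) = k"
      using k inj by (auto simp: fun_eq_iff the_inv_into_f_f PiE_def extensional_def)
    show "(\<lambda>y\<in>\<pi> ` I. k (the_inv_into I \<pi> y)) \<in> \<pi> ` I \<rightarrow>\<^sub>E A"
      using k inj by (auto simp: the_inv_into_f_f)
  qed
qed

lemma schur_sum_split2:
  assumes fin: "finite I" and ij: "i \<notin> I" "j \<notin> I" "i \<noteq> j"
  shows "(\<Sum>k\<in>insert j (insert i I) \<rightarrow>\<^sub>E A.
            S (k i) (k j) * pairprod (\<lambda>i j. S (k i) (k j)) I * (\<Prod>l\<in>insert j (insert i I). W l (k l))) =
         (\<Sum>a\<in>A. \<Sum>b\<in>A. S a b * W i a * W j b) * schur_sum S A W I"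
proof -
  have *: "pairprod (\<lambda>i' j'. S ((k(i := a, j := b)) i') ((k(i := a, j := b)) j')) I =
      pairprod (\<lambda>i j. S (k i) (k j)) I" for k a b
    using ij by (intro pairprod_cong) (metis fun_upd_other)
  have **: "(\<Prod>l\<in>I. W l ((k(i := a, j := b)) l)) = (\<Prod>l\<in>I. W l (k l))" for k a b
    using ij by (intro prod.cong) auto
  have "(\<Sum>k\<in>insert j (insert i I) \<rightarrow>\<^sub>E A.
            S (k i) (k j) * pairprod (\<lambda>i j. S (k i) (k j)) I * (\<Prod>l\<in>insert j (insert i I). W l (k l))) =
      (\<Sum>b\<in>A. \<Sum>a\<in>A. \<Sum>k\<in>I \<rightarrow>\<^sub>E A. S a b * pairprod (\<lambda>i j. S (k i) (k j)) I *
         (W j b * (W i a * (\<Prod>l\<in>I. W l (k l)))))"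
    using fin ij by (simp add: sum_PiE_insert * ** del: fun_upd_apply) (simp add: fun_upd_apply)
  also have "\<dots> = (\<Sum>b\<in>A. \<Sum>a\<in>A. S a b * W i a * W j b * schur_sum S A W I)"
    by (simp add: schur_sum_def sum_distrib_left mult_ac)
  also have "\<dots> = (\<Sum>a\<in>A. \<Sum>b\<in>A. S a b * W i a * W j b) * schur_sum S A W I"
    by (subst sum.swap) (simp add: sum_distrib_right)
  finally show ?thesis .
qed

text \<open>
  In every term of the kernel expansion the indices \<open>i\<close> and \<open>M\<close> are separated from the others, so that the
  sum over all index tuples factors.
\<close>

lemma schur_sum_expansion:
  fixes t :: "'b \<Rightarrow> complex"
  assumes "odd M" and nz: "\<And>a b. a \<in> A \<Longrightarrow> b \<in> A \<Longrightarrow> t a + t b \<noteq> 0"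
    and S: "S = (\<lambda>a b. (t b - t a) / (t b + t a))"
  shows "schur_sum S A W {..<Suc M} =
    (\<Sum>i<M. (-1) ^ i * (\<Sum>a\<in>A. \<Sum>b\<in>A. S a b * W i a * W M b) * schur_sum S A W ({..<M} - {i}))"
proof -
  have "schur_sum S A W {..<Suc M} = (\<Sum>k\<in>{..<Suc M} \<rightarrow>\<^sub>E A. \<Sum>i<M. (-1) ^ i *
      (S (k i) (k M) * pairprod (\<lambda>i j. S (k i) (k j)) ({..<M} - {i}) * (\<Prod>l<Suc M. W l (k l))))"
    unfolding schur_sum_def
  proof (intro sum.cong refl)
    fix k assume k: "k \<in> {..<Suc M} \<rightarrow>\<^sub>E A"
    have "t (k i) + t (k j) \<noteq> 0" if "i \<le> M" "j \<le> M" for i j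
      using k that by (intro nz) (auto simp: PiE_def Pi_def)
    then have "pairprod (\<lambda>i j. S (k i) (k j)) {..<Suc M} =
        (\<Sum>i<M. (-1) ^ i * S (k i) (k M) * pairprod (\<lambda>i j. S (k i) (k j)) ({..<M} - {i}))"
      unfolding S using schur_kernel_expansion[OF assms(1), of "\<lambda>i. t (k i)"] by blast
    then show "pairprod (\<lambda>i j. S (k i) (k j)) {..<Suc M} * (\<Prod>l<Suc M. W l (k l)) = (\<Sum>i<M. (-1) ^ i *
      (S (k i) (k M) * pairprod (\<lambda>i j. S (k i) (k j)) ({..<M} - {i}) * (\<Prod>l<Suc M. W l (k l))))"
      by (simp only: sum_distrib_right mult.assoc)
  qed
  also have "\<dots> = (\<Sum>i<M. (-1) ^ i * (\<Sum>k\<in>{..<Suc M} \<rightarrow>\<^sub>E A.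
      S (k i) (k M) * pairprod (\<lambda>i j. S (k i) (k j)) ({..<M} - {i}) * (\<Prod>l<Suc M. W l (k l))))"
    unfolding sum_distrib_left by (rule sum.swap)
  also have "\<dots> = (\<Sum>i<M. (-1) ^ i * ((\<Sum>a\<in>A. \<Sum>b\<in>A. S a b * W i a * W M b) *
      schur_sum S A W ({..<M} - {i})))"
  proof (intro sum.cong refl arg_cong2[of _ _ _ _ "(*)"])
    fix i assume "i \<in> {..<M}"
    then have *: "{..<Suc M} = insert M (insert i ({..<M} - {i}))"
      by auto
    show "(\<Sum>k\<in>{..<Suc M} \<rightarrow>\<^sub>E A.
        S (k i) (k M) * pairprod (\<lambda>i j. S (k i) (k j)) ({..<M} - {i}) * (\<Prod>l<Suc M. W l (k l))) =
        (\<Sum>a\<in>A. \<Sum>b\<in>A. S a b * W i a * W M b) * schur_sum S A W ({..<M} - {i})"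
      unfolding * by (rule schur_sum_split2) (use \<open>i \<in> {..<M}\<close> in auto)
  qed
  finally show ?thesis
    by (simp only: mult.assoc)
qed

section \<open>The one- and two-variable cases\<close>

locale generic_base =
  fixes q :: complex
  assumes q_nonzero: "q \<noteq> 0" and not_root_of_unity: "k > 0 \<Longrightarrow> q ^ k \<noteq> 1"
begin

lemma one_plus_power_nonzero: "1 + q ^ k \<noteq> 0"
proof
  assume "1 + q ^ k = 0"
  then have neg: "q ^ k = -1"
    by (simp add: add_eq_0_iff)
  then have "k > 0"
    by (cases k) auto
  moreover have "q ^ (2 * k) = 1"
    using neg by (simp add: power_mult mult.commute[of 2 k])
  ultimately show False
    using not_root_of_unity[of "2 * k"] by simp
qed

lemma power_plus_power_nonzero: "q ^ k + q ^ l \<noteq> 0"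
proof -
  have "q ^ k + q ^ (k + d) \<noteq> 0" for k d
  proof -
    have "q ^ k + q ^ (k + d) = q ^ k * (1 + q ^ d)"
      by (simp add: power_add algebra_simps)
    then show ?thesis
      using one_plus_power_nonzero[of d] q_nonzero by simp
  qed
  from this[of k "l - k"] this[of l "k - l"] show ?thesis
    by (cases "k \<le> l") (simp_all add: add.commute)
qed

text \<open>
  With \<open>q = exp (-2 u)\<close> this is \<open>tanh (k u)\<close>; the identities below are forms of the addition theorem of the
  hyperbolic tangent.
\<close>

definition nu :: "nat \<Rightarrow> complex" where "nu k = (1 - q ^ k) / (1 + q ^ k)"

definition alpha :: "nat \<Rightarrow> complex" where "alpha k = qpoch (-q) q k / qpoch q q k"

text \<open>
  The same parametrisation turns this into \<open>tanh ((k - l) u)\<close>.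
\<close>

definition kern :: "nat \<Rightarrow> nat \<Rightarrow> complex" where "kern k l = (q ^ l - q ^ k) / (q ^ l + q ^ k)"

lemma nu_0 [simp]: "nu 0 = 0"
  by (simp add: nu_def)

lemma nu_nonzero: "k > 0 \<Longrightarrow> nu k \<noteq> 0"
  using not_root_of_unity[of k] one_plus_power_nonzero[of k] by (simp add: nu_def)

lemma qpoch_neg_nonzero: "qpoch (-q) q k \<noteq> 0"
  using one_plus_power_nonzero[of "Suc _"] by (auto simp: qpoch_def)

lemma qpoch_pos_nonzero: "qpoch q q k \<noteq> 0"
  using not_root_of_unity[of "Suc _"] by (auto simp: qpoch_def)

lemma alpha_nonzero [simp]: "alpha k \<noteq> 0"
  by (simp add: alpha_def qpoch_neg_nonzero qpoch_pos_nonzero)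

lemma alpha_0 [simp]: "alpha 0 = 1"
  by (simp add: alpha_def qpoch_def)

lemma alpha_down: "alpha k = nu (Suc k) * alpha (Suc k)"
  using one_plus_power_nonzero[of "Suc k"] not_root_of_unity[of "Suc k"]
  by (simp add: nu_def alpha_def qpoch_def)

lemma nu_add: "nu k + nu l = nu (k + l) * (1 + nu k * nu l)"
  using one_plus_power_nonzero[of k] one_plus_power_nonzero[of l] one_plus_power_nonzero[of "k + l"]
  by (simp add: nu_def power_add divide_simps) (simp add: algebra_simps)

lemma kern_Suc_Suc: "kern (Suc k) (Suc l) = kern k l"
proof -
  have "q ^ Suc l - q ^ Suc k = q * (q ^ l - q ^ k)" "q ^ Suc l + q ^ Suc k = q * (q ^ l + q ^ k)"
    by (simp_all add: algebra_simps)
  then show ?thesis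
    unfolding kern_def using q_nonzero by (simp del: power_Suc)
qed

text \<open>
  For \<open>K = q\<^sup>k, L = q\<^sup>l, M = q\<^sup>m\<close> the fraction \<open>(K - M) / (K + M)\<close> is \<open>\<nu>\<^sub>m\<^sub>-\<^sub>k\<close>, and likewise for \<open>L\<close>.
\<close>

lemma kern_nu_rational_identity:
  fixes K L M :: complex
  assumes "1 + K \<noteq> 0" "1 + L \<noteq> 0" "1 + M \<noteq> 0" "L + K \<noteq> 0" "K + M \<noteq> 0" "L + M \<noteq> 0"
  shows "(L - K) / (L + K) * ((K - M) / (K + M) * ((L - M) / (L + M)) - (1 - K) / (1 + K) * ((1 - L) / (1 + L))) =
    (1 - M) / (1 + M) * ((1 - K) / (1 + K) * ((K - M) / (K + M)) - (1 - L) / (1 + L) * ((L - M) / (L + M)))"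
proof -
  have "(L - K) * ((K - M) * (L - M) * ((1 + K) * (1 + L)) - (1 - K) * (1 - L) * ((K + M) * (L + M))) * (1 + M) =
      (1 - M) * ((1 - K) * (K - M) * ((1 + L) * (L + M)) - (1 - L) * (L - M) * ((1 + K) * (K + M))) * (L + K)"
    by (simp add: algebra_simps)
  then show ?thesis
    using assms by (simp add: divide_simps) (simp only: mult_ac)
qed

lemma kern_nu_identity:
  assumes "k \<le> m" "l \<le> m"
  shows "kern k l * (nu (m - k) * nu (m - l) - nu k * nu l) =
    nu m * (nu k * nu (m - k) - nu l * nu (m - l))"
proof -
  have nu_compl: "nu (m - j) = (q ^ j - q ^ m) / (q ^ j + q ^ m)" if "j \<le> m" for j
  proof -
    have "q ^ m = q ^ j * q ^ (m - j)"
      using that by (simp flip: power_add)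
    then have "q ^ j - q ^ m = q ^ j * (1 - q ^ (m - j))" "q ^ j + q ^ m = q ^ j * (1 + q ^ (m - j))"
      by (simp_all add: algebra_simps)
    then show ?thesis
      using q_nonzero by (simp add: nu_def)
  qed
  have "1 + q ^ k \<noteq> 0" "1 + q ^ l \<noteq> 0" "1 + q ^ m \<noteq> 0" "q ^ l + q ^ k \<noteq> 0"
    "q ^ k + q ^ m \<noteq> 0" "q ^ l + q ^ m \<noteq> 0"
    using one_plus_power_nonzero power_plus_power_nonzero by blast+
  then show ?thesis
    unfolding kern_def nu_def[of k] nu_def[of l] nu_def[of m] nu_compl[OF assms(1)] nu_compl[OF assms(2)]
    by (rule kern_nu_rational_identity)
qed

text \<open>
  \<open>cy r (s\<^sup>2) = s\<^sup>r c\<^sub>r(s + 1/s)\<close>, see \<open>poly_cpoly_joukowski\<close> and \<open>c_eq_cpoly\<close> below.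
\<close>

definition cy :: "nat \<Rightarrow> complex \<Rightarrow> complex" where
  "cy r y = (\<Sum>k\<le>r. alpha k * alpha (r - k) * y ^ k) / alpha r"

lemma alpha_cy: "alpha r * cy r y = (\<Sum>k\<le>r. alpha k * alpha (r - k) * y ^ k)"
  by (simp add: cy_def)

lemma cy_at_0: "cy r 0 = 1"
  by (simp add: cy_def sum.atMost_shift)

lemma cy_0: "cy 0 y = 1"
  by (simp add: cy_def)

lemma cy_1: "cy 1 y = 1 + y"
proof -
  have "cy 1 y = (alpha 1 + alpha 1 * y) / alpha 1"
    by (simp add: cy_def)
  then show ?thesis
    by (simp add: add_divide_distrib)
qed

text \<open>
  Since \<open>\<alpha>\<^sub>k\<^sub>-\<^sub>1 = \<nu>\<^sub>k \<alpha>\<^sub>k\<close> and \<open>\<nu>\<^sub>0 = 0\<close>, sums with the weights \<open>\<alpha>\<^sub>k \<alpha>\<^sub>n\<^sub>-\<^sub>k\<close>, shifted or not, can be written with the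
  weights \<open>\<alpha>\<^sub>k \<alpha>\<^sub>n\<^sub>+\<^sub>1\<^sub>-\<^sub>k\<close> over the longer range without boundary terms. The next two lemmas are the variants with a shift of
  the exponent, where the second one raises the index twice.
\<close>

lemma sum_raise:
  "(\<Sum>k\<le>n. alpha k * alpha (n - k) * f k) =
   (\<Sum>k\<le>Suc n. nu (Suc n - k) * (alpha k * alpha (Suc n - k)) * f k)"
proof -
  have "alpha k * alpha (n - k) = nu (Suc n - k) * (alpha k * alpha (Suc n - k))" if "k \<le> n" for k
    using alpha_down[of "n - k"] that by (simp add: Suc_diff_le)
  then have "(\<Sum>k\<le>n. alpha k * alpha (n - k) * f k) =
      (\<Sum>k\<le>n. nu (Suc n - k) * (alpha k * alpha (Suc n - k)) * f k)"
    by (intro sum.cong) auto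
  then show ?thesis
    by simp
qed

lemma sum_raise_shift:
  "(\<Sum>k\<le>n. alpha k * alpha (n - k) * f (Suc k)) =
   (\<Sum>k\<le>Suc n. nu k * (alpha k * alpha (Suc n - k)) * f k)"
proof -
  have "alpha k * alpha (n - k) * f (Suc k) =
      nu (Suc k) * (alpha (Suc k) * alpha (Suc n - Suc k)) * f (Suc k)" for k
    using alpha_down[of k] by simp
  then have "(\<Sum>k\<le>n. alpha k * alpha (n - k) * f (Suc k)) =
      (\<Sum>k\<le>n. nu (Suc k) * (alpha (Suc k) * alpha (Suc n - Suc k)) * f (Suc k))"
    by (intro sum.cong) auto
  then show ?thesis
    by (subst sum.atMost_Suc_shift) simp
qed

lemma sum_raise_shift2:
  "(\<Sum>k\<le>n. alpha k * alpha (n - k) * f (Suc k)) =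
   (\<Sum>k\<le>n + 2. nu k * nu (n + 2 - k) * (alpha k * alpha (n + 2 - k)) * f k)"
proof -
  have "(\<Sum>k\<le>n. alpha k * alpha (n - k) * f (Suc k)) =
      (\<Sum>k\<le>Suc n. nu k * f k * (alpha k * alpha (Suc n - k)))"
    unfolding sum_raise_shift by (simp add: mult_ac)
  also have "\<dots> = (\<Sum>k\<le>Suc n. alpha k * alpha (Suc n - k) * (nu k * f k))"
    by (simp add: mult_ac)
  also have "\<dots> = (\<Sum>k\<le>n + 2. nu k * nu (n + 2 - k) * (alpha k * alpha (n + 2 - k)) * f k)"
    unfolding sum_raise by (simp add: mult_ac)
  finally show ?thesis .
qed

text \<open>
  The three-term recurrence of the orthogonal polynomials \<open>c\<^sub>r\<close>; coefficientwise it is \<open>nu_add\<close>.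
\<close>

lemma cy_recurrence:
  "cy (r + 2) y = (1 + y) * cy (r + 1) y - nu (r + 1) * nu (r + 2) * y * cy r y"
proof -
  have r1: "alpha (r + 1) = nu (r + 2) * alpha (r + 2)"
    using alpha_down[of "r + 1"] by simp
  have r0: "alpha r = nu (r + 1) * (nu (r + 2) * alpha (r + 2))"
    using alpha_down[of r] r1 by simp
  have nz: "nu (r + 2) \<noteq> 0"
    by (rule nu_nonzero) simp
  have y1: "(1 + y) * (alpha (r + 1) * cy (r + 1) y) =
      (\<Sum>k\<le>r + 2. (nu k + nu (r + 2 - k)) * (alpha k * alpha (r + 2 - k) * y ^ k))"
  proof -
    have "alpha (r + 1) * cy (r + 1) y = (\<Sum>k\<le>r + 2. nu (r + 2 - k) * (alpha k * alpha (r + 2 - k)) * y ^ k)"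
      unfolding alpha_cy sum_raise by simp
    moreover have "y * (alpha (r + 1) * cy (r + 1) y) =
        (\<Sum>k\<le>r + 2. nu k * (alpha k * alpha (r + 2 - k)) * y ^ k)"
      unfolding alpha_cy using sum_raise_shift[of "r + 1" "\<lambda>k. y ^ k"]
      by (simp add: sum_distrib_left mult_ac del: sum.atMost_Suc)
    ultimately show ?thesis
      by (simp add: distrib_right sum.distrib mult.assoc)
  qed
  have y2: "y * (alpha r * cy r y) =
      (\<Sum>k\<le>r + 2. nu k * nu (r + 2 - k) * (alpha k * alpha (r + 2 - k) * y ^ k))"
    unfolding alpha_cy using sum_raise_shift2[of r "\<lambda>k. y ^ k"]
    by (simp add: sum_distrib_left mult_ac del: sum.atMost_Suc)
  have "nu (r + 2) * (alpha (r + 2) * cy (r + 2) y) =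
      (1 + y) * (alpha (r + 1) * cy (r + 1) y) - nu (r + 2) * (y * (alpha r * cy r y))"
    unfolding y1 y2 unfolding alpha_cy sum_distrib_left sum_subtractf[symmetric]
  proof (intro sum.cong refl)
    fix k assume "k \<in> {..r + 2}"
    then have "nu k + nu (r + 2 - k) = nu (r + 2) * (1 + nu k * nu (r + 2 - k))"
      using nu_add[of k "r + 2 - k"] by simp
    then show "nu (r + 2) * (alpha k * alpha (r + 2 - k) * y ^ k) =
        (nu k + nu (r + 2 - k)) * (alpha k * alpha (r + 2 - k) * y ^ k) -
        nu (r + 2) * (nu k * nu (r + 2 - k) * (alpha k * alpha (r + 2 - k) * y ^ k))"
      by (simp add: algebra_simps)
  qed
  then have "(nu (r + 2) * alpha (r + 2)) * cy (r + 2) y = (nu (r + 2) * alpha (r + 2)) *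
      ((1 + y) * cy (r + 1) y - nu (r + 1) * nu (r + 2) * y * cy r y)"
    unfolding r0 r1 by (simp add: algebra_simps)
  then show ?thesis
    using nz by simp
qed

lemma cy_recurrence_double:
  "\<exists>\<gamma> \<delta>. \<forall>y. (1 + y\<^sup>2) * cy (r + 2) y = cy (r + 4) y + \<gamma> * (y * cy (r + 2) y) + \<delta> * (y\<^sup>2 * cy r y)"
proof (intro exI allI)
  fix y
  define \<beta> where "\<beta> i = nu i * nu (i + 1)" for i
  have 1: "cy (r + 2) y = (1 + y) * cy (r + 1) y - \<beta> (r + 1) * y * cy r y"
    using cy_recurrence[of r y] by (simp add: \<beta>_def)
  have 2: "cy (r + 3) y = (1 + y) * cy (r + 2) y - \<beta> (r + 2) * y * cy (r + 1) y"
    using cy_recurrence[of "r + 1" y] by (simp add: \<beta>_def eval_nat_numeral)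
  have 3: "cy (r + 4) y = (1 + y) * cy (r + 3) y - \<beta> (r + 3) * y * cy (r + 2) y"
    using cy_recurrence[of "r + 2" y] by (simp add: \<beta>_def eval_nat_numeral)
  have "(1 + y) * cy (r + 3) y =
      (1 + y) * (1 + y) * cy (r + 2) y - \<beta> (r + 2) * y * ((1 + y) * cy (r + 1) y)"
    unfolding 2 by (simp only: algebra_simps)
  also have "(1 + y) * cy (r + 1) y = cy (r + 2) y + \<beta> (r + 1) * y * cy r y"
    using 1 by simp
  finally show "(1 + y\<^sup>2) * cy (r + 2) y = cy (r + 4) y +
      (\<beta> (r + 2) + \<beta> (r + 3) - 2) * (y * cy (r + 2) y) +
      (\<beta> (r + 1) * \<beta> (r + 2)) * (y\<^sup>2 * cy r y)"
    unfolding 3 by (simp add: algebra_simps power2_eq_square)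
qed

definition pair_sum :: "nat \<Rightarrow> complex \<Rightarrow> complex \<Rightarrow> complex" where
  "pair_sum n y z = (\<Sum>k\<le>n. \<Sum>l\<le>n.
     kern k l * (alpha k * alpha (n - k) * y ^ k) * (alpha l * alpha (n - l) * z ^ l))"

text \<open>
  Both sides become double sums with the weights \<open>\<alpha>\<^sub>k \<alpha>\<^sub>r\<^sub>+\<^sub>2\<^sub>-\<^sub>k \<alpha>\<^sub>l \<alpha>\<^sub>r\<^sub>+\<^sub>2\<^sub>-\<^sub>l\<close>, and multiplication by \<open>y z\<close> leaves the
  kernel unchanged because it depends on \<open>k - l\<close> only. The coefficients then agree by
  \<open>kern_nu_identity\<close>. The right-hand side is the Christoffel-Darboux kernel in the variables \<open>y, z\<close>.
\<close>

lemma pair_sum_eq: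
  "(1 - y * z) * pair_sum (r + 1) y z =
   alpha r * alpha (r + 1) * (y * cy r y * cy (r + 2) z - cy (r + 2) y * (z * cy r z))"
proof -
  define A where "A k = alpha k * alpha (r + 2 - k)" for k
  have r1: "alpha (r + 1) = nu (r + 2) * alpha (r + 2)"
    using alpha_down[of "r + 1"] by simp
  have 1: "pair_sum (r + 1) y z =
      (\<Sum>k\<le>r + 2. \<Sum>l\<le>r + 2. kern k l * (nu (r + 2 - k) * nu (r + 2 - l)) * (A k * y ^ k * (A l * z ^ l)))"
  proof -
    have "pair_sum (r + 1) y z = (\<Sum>k\<le>r + 1. alpha k * alpha (r + 1 - k) *
        (\<Sum>l\<le>r + 1. alpha l * alpha (r + 1 - l) * (kern k l * y ^ k * z ^ l)))"
      by (simp add: pair_sum_def sum_distrib_left mult_ac del: sum.atMost_Suc)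
    also have "\<dots> = (\<Sum>k\<le>r + 2. \<Sum>l\<le>r + 2. kern k l * (nu (r + 2 - k) * nu (r + 2 - l)) * (A k * y ^ k * (A l * z ^ l)))"
      unfolding sum_raise by (simp add: sum_distrib_left A_def mult_ac del: sum.atMost_Suc)
    finally show ?thesis .
  qed
  have 2: "y * z * pair_sum (r + 1) y z =
      (\<Sum>k\<le>r + 2. \<Sum>l\<le>r + 2. kern k l * (nu k * nu l) * (A k * y ^ k * (A l * z ^ l)))"
  proof -
    have "y * z * pair_sum (r + 1) y z = (\<Sum>k\<le>r + 1. alpha k * alpha (r + 1 - k) *
        (\<Sum>l\<le>r + 1. alpha l * alpha (r + 1 - l) * (kern (Suc k) (Suc l) * y ^ Suc k * z ^ Suc l)))"
      by (simp add: pair_sum_def sum_distrib_left mult_ac kern_Suc_Suc del: sum.atMost_Suc)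
    also have "\<dots> = (\<Sum>k\<le>r + 1. alpha k * alpha (r + 1 - k) *
        (\<Sum>l\<le>Suc (r + 1). nu l * (alpha l * alpha (Suc (r + 1) - l)) * (kern (Suc k) l * y ^ Suc k * z ^ l)))"
      by (subst sum_raise_shift) (rule refl)
    also have "\<dots> = (\<Sum>k\<le>Suc (r + 1). nu k * (alpha k * alpha (Suc (r + 1) - k)) *
        (\<Sum>l\<le>Suc (r + 1). nu l * (alpha l * alpha (Suc (r + 1) - l)) * (kern k l * y ^ k * z ^ l)))"
      by (subst sum_raise_shift[of "r + 1" "\<lambda>k. \<Sum>l\<le>Suc (r + 1). nu l * (alpha l * alpha (Suc (r + 1) - l)) * (kern k l * y ^ k * z ^ l)"]) (rule refl)
    also have "\<dots> = (\<Sum>k\<le>r + 2. \<Sum>l\<le>r + 2. kern k l * (nu k * nu l) * (A k * y ^ k * (A l * z ^ l)))"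
      by (simp add: sum_distrib_left A_def mult_ac del: sum.atMost_Suc)
    finally show ?thesis .
  qed
  have b2: "alpha (r + 2) * cy (r + 2) x = (\<Sum>k\<le>r + 2. A k * x ^ k)" for x
    unfolding alpha_cy A_def ..
  have b0: "alpha r * (x * cy r x) = (\<Sum>k\<le>r + 2. nu k * nu (r + 2 - k) * (A k * x ^ k))" for x
  proof -
    have "alpha r * (x * cy r x) = x * (alpha r * cy r x)"
      by simp
    then show ?thesis
      unfolding alpha_cy using sum_raise_shift2[of r "\<lambda>k. x ^ k"]
      by (simp add: sum_distrib_left mult_ac A_def del: sum.atMost_Suc)
  qed
  have "(1 - y * z) * pair_sum (r + 1) y z = pair_sum (r + 1) y z - y * z * pair_sum (r + 1) y z"
    by (simp add: algebra_simps)
  also have "\<dots> = (\<Sum>k\<le>r + 2. \<Sum>l\<le>r + 2.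
      nu (r + 2) * (nu k * nu (r + 2 - k) - nu l * nu (r + 2 - l)) * (A k * y ^ k * (A l * z ^ l)))"
    unfolding 2 unfolding 1 sum_subtractf[symmetric]
  proof (intro sum.cong refl)
    fix k l assume "k \<in> {..r + 2}" "l \<in> {..r + 2}"
    then have "kern k l * (nu (r + 2 - k) * nu (r + 2 - l) - nu k * nu l) =
        nu (r + 2) * (nu k * nu (r + 2 - k) - nu l * nu (r + 2 - l))"
      by (intro kern_nu_identity) auto
    then show "kern k l * (nu (r + 2 - k) * nu (r + 2 - l)) * (A k * y ^ k * (A l * z ^ l)) -
        kern k l * (nu k * nu l) * (A k * y ^ k * (A l * z ^ l)) =
        nu (r + 2) * (nu k * nu (r + 2 - k) - nu l * nu (r + 2 - l)) * (A k * y ^ k * (A l * z ^ l))"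
      unfolding left_diff_distrib[symmetric] right_diff_distrib[symmetric] by (simp only:)
  qed
  also have "\<dots> = nu (r + 2) * ((alpha r * (y * cy r y)) * (alpha (r + 2) * cy (r + 2) z) -
      (alpha (r + 2) * cy (r + 2) y) * (alpha r * (z * cy r z)))"
  proof -
    have s1: "(alpha r * (y * cy r y)) * (alpha (r + 2) * cy (r + 2) z) =
        (\<Sum>k\<le>r + 2. \<Sum>l\<le>r + 2. nu k * nu (r + 2 - k) * (A k * y ^ k) * (A l * z ^ l))"
      unfolding b0 b2 by (rule sum_product)
    have s2: "(alpha (r + 2) * cy (r + 2) y) * (alpha r * (z * cy r z)) =
        (\<Sum>k\<le>r + 2. \<Sum>l\<le>r + 2. (A k * y ^ k) * (nu l * nu (r + 2 - l) * (A l * z ^ l)))"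
      unfolding b0 b2 by (rule sum_product)
    show ?thesis
      unfolding s1 s2 sum_subtractf[symmetric] sum_distrib_left
      by (intro sum.cong refl) (simp add: algebra_simps)
  qed
  also have "\<dots> = alpha r * alpha (r + 1) * (y * cy r y * cy (r + 2) z - cy (r + 2) y * (z * cy r z))"
    unfolding r1 by (simp add: algebra_simps)
  finally show ?thesis .
qed

end

section \<open>Determinants with two interleaved blocks of powers\<close>

lemma det_mat_cong:
  assumes "\<And>i j. i < n \<Longrightarrow> j < n \<Longrightarrow> f i j = g i j"
  shows "det (mat n n (\<lambda>(i, j). f i j)) = det (mat n n (\<lambda>(i, j). g i j))"
  using assms by (intro arg_cong[where f = det] eq_matI) auto

lemma det_mat_leibniz:
  "det (mat n n (\<lambda>(i, j). A i j)) = (\<Sum>\<pi> | \<pi> permutes {0..<n}. signof \<pi> * (\<Prod>i<n. A i (\<pi> i)))"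
proof -
  have "\<pi> i < n" if "\<pi> permutes {0..<n}" "i < n" for \<pi> i
    using permutes_in_image[OF that(1), of i] that(2) by simp
  then show ?thesis
    by (subst det_def'[of _ n]) (auto intro!: sum.cong prod.cong simp: lessThan_atLeast0)
qed

lemma det_scale_rows:
  "det (mat n n (\<lambda>(i, j). r i * A i j)) = (\<Prod>i<n. r i) * det (mat n n (\<lambda>(i, j). A i j))"
  unfolding det_mat_leibniz by (simp add: prod.distrib sum_distrib_left mult_ac)

lemma det_row_single_entry:
  assumes A: "A \<in> carrier_mat n n" and i: "i < n" and k: "k < n"
    and zero: "\<And>j. j < n \<Longrightarrow> j \<noteq> k \<Longrightarrow> A $$ (i, j) = 0"
  shows "det A = A $$ (i, k) * cofactor A i k"
proof -
  have "det A = (\<Sum>j<n. A $$ (i, j) * cofactor A i j)"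
    using A i by (rule laplace_expansion_row)
  also have "\<dots> = (\<Sum>j\<in>{k}. A $$ (i, j) * cofactor A i j)"
    using k zero by (intro sum.mono_neutral_right) auto
  finally show ?thesis
    by simp
qed

text \<open>
  The columns are \<open>f, g, X f, X g, X\<^sup>2 f, X\<^sup>2 g, \<dots>\<close>. This interleaved order makes the column operations in
  \<open>det_two_block_collision\<close> triangular and keeps all signs independent of \<open>h\<close>.
\<close>

definition two_block :: "nat \<Rightarrow> (nat \<Rightarrow> complex) \<Rightarrow> (nat \<Rightarrow> complex) \<Rightarrow> (nat \<Rightarrow> complex) \<Rightarrow> complex mat" where
  "two_block h f g X = mat (2 * h) (2 * h) (\<lambda>(i, j). (if even j then f i else g i) * X i ^ (j div 2))"

text \<open>
  The determinant is linear in the last row, whose entries have degree at most \<open>h\<close> in \<open>X = z + 1/z\<close>;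
  the factor \<open>z\<^sup>h\<close> clears the negative powers of \<open>z\<close>.
\<close>

lemma det_two_block_last_row:
  "\<exists>T. degree T \<le> 2 * h \<and> (\<forall>z. z \<noteq> 0 \<longrightarrow>
     poly T z = z ^ h * det (two_block (Suc h) f g (X(2 * h + 1 := z + inverse z))))"
proof -
  let ?M = "2 * h + 1"
  let ?A = "\<lambda>x. two_block (Suc h) f g (X(?M := x))"
  define \<gamma> where "\<gamma> j = (if even j then f ?M else g ?M) * cofactor (?A 0) ?M j" for j
  define T where "T = (\<Sum>j<2 * Suc h. smult (\<gamma> j) (monom 1 (h - j div 2) * [:1, 0, 1:] ^ (j div 2)))"
  have "mat_delete (?A x) ?M j = mat_delete (?A 0) ?M j" for x j
    by (rule eq_matI) (auto simp: mat_delete_def two_block_def)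
  then have cof: "cofactor (?A x) ?M j = cofactor (?A 0) ?M j" for x j
    by (metis cofactor_def)
  have det: "det (?A x) = (\<Sum>j<2 * Suc h. \<gamma> j * x ^ (j div 2))" for x
  proof -
    have "det (?A x) = (\<Sum>j<2 * Suc h. ?A x $$ (?M, j) * cofactor (?A x) ?M j)"
      by (rule laplace_expansion_row) (auto simp: two_block_def)
    also have "\<dots> = (\<Sum>j<2 * Suc h. \<gamma> j * x ^ (j div 2))"
    proof (intro sum.cong refl)
      fix j assume "j \<in> {..<2 * Suc h}"
      then have "?A x $$ (?M, j) = (if even j then f ?M else g ?M) * x ^ (j div 2)"
        by (simp add: two_block_def)
      then show "?A x $$ (?M, j) * cofactor (?A x) ?M j = \<gamma> j * x ^ (j div 2)"
        unfolding cof[of x j] \<gamma>_def by (simp only: mult_ac)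
    qed
    finally show ?thesis .
  qed
  have "degree T \<le> 2 * h"
    unfolding T_def
  proof (rule degree_sum_le)
    fix j assume "j \<in> {..<2 * Suc h}"
    then have j: "j div 2 \<le> h"
      by auto
    have "degree (monom (1::complex) (h - j div 2) * [:1, 0, 1:] ^ (j div 2)) \<le> (h - j div 2) + 2 * (j div 2)"
      by (rule order_trans[OF degree_mult_le]) (simp add: degree_monom_eq degree_power_eq)
    then show "degree (smult (\<gamma> j) (monom 1 (h - j div 2) * [:1, 0, 1:] ^ (j div 2))) \<le> 2 * h"
      using j by (intro order_trans[OF degree_smult_le]) simp
  qed simp
  moreover have "poly T z = z ^ h * det (?A (z + inverse z))" if z: "z \<noteq> 0" for z
  proof -
    have "z ^ (h - l) * (1 + z\<^sup>2) ^ l = z ^ h * (z + inverse z) ^ l" if "l \<le> h" for l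
    proof -
      have "1 + z\<^sup>2 = z * (z + inverse z)"
        using z by (simp add: algebra_simps power2_eq_square)
      then show ?thesis
        using that by (simp add: power_mult_distrib flip: power_add mult.assoc)
    qed
    then have "\<gamma> j * (z ^ (h - j div 2) * (1 + z\<^sup>2) ^ (j div 2)) = z ^ h * (\<gamma> j * (z + inverse z) ^ (j div 2))"
      if "j < 2 * Suc h" for j
      using that by simp
    then have "(\<Sum>j<2 * Suc h. \<gamma> j * (z ^ (h - j div 2) * (1 + z\<^sup>2) ^ (j div 2))) =
        (\<Sum>j<2 * Suc h. z ^ h * (\<gamma> j * (z + inverse z) ^ (j div 2)))"
      by (intro sum.cong) auto
    moreover have "poly T z = (\<Sum>j<2 * Suc h. \<gamma> j * (z ^ (h - j div 2) * (1 + z\<^sup>2) ^ (j div 2)))"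
      by (simp add: T_def poly_sum poly_monom power2_eq_square del: sum.lessThan_Suc mult_Suc_right)
    ultimately show ?thesis
      unfolding det sum_distrib_left by simp
  qed
  ultimately show ?thesis
    by blast
qed

text \<open>
  Subtracting \<open>X\<^sub>i\<close> times column \<open>c - 2\<close> from column \<open>c\<close> empties row \<open>i\<close> and the last row beyond the first
  two columns, and produces a factor \<open>X\<^sub>l - X\<^sub>i\<close> in each other row \<open>l\<close>. What remains is a \<open>2 \<times> 2\<close> minor
  and the determinant with \<open>h\<close> blocks.
\<close>

lemma det_two_block_collision:
  assumes i: "i < 2 * h + 1" and eq: "X (2 * h + 1) = X i"
  shows "det (two_block (Suc h) f g X) =
    (-1) ^ i * (f i * g (2 * h + 1) - f (2 * h + 1) * g i) * (\<Prod>l\<in>{..<2 * h + 1} - {i}. X l - X i) *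
    det (two_block h (\<lambda>l. f (insert_index i l)) (\<lambda>l. g (insert_index i l)) (\<lambda>l. X (insert_index i l)))"
proof -
  let ?n = "2 * Suc h" and ?M = "2 * h + 1"
  define T where "T = mat ?n ?n (\<lambda>(k, c). if k = c then 1 else if k + 2 = c then - X i else 0)"
  define W where "W = mat ?n ?n (\<lambda>(r, c). (if even c then f r else g r) *
    (if c < 2 then 1 else X r ^ (c div 2 - 1) * (X r - X i)))"
  define D where "D = mat (2 * h) (2 * h) (\<lambda>(r, c). (X (insert_index i r) - X i) *
    ((if even c then f (insert_index i r) else g (insert_index i r)) * X (insert_index i r) ^ (c div 2)))"
  have T: "T \<in> carrier_mat ?n ?n" and W: "W \<in> carrier_mat ?n ?n"
    by (simp_all add: T_def W_def)
  have V: "two_block (Suc h) f g X \<in> carrier_mat ?n ?n"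
    by (simp add: two_block_def)
  have "det T = 1"
  proof -
    have "det T = prod_list (diag_mat T)"
      using T by (intro det_upper_triangular) (auto simp: T_def upper_triangular_def)
    also have "diag_mat T = map (\<lambda>_. 1) [0..<?n]"
      unfolding diag_mat_def by (rule map_cong) (auto simp: T_def)
    finally show ?thesis
      by (simp add: prod_list_replicate map_replicate_const)
  qed
  have "two_block (Suc h) f g X * T = W"
  proof (rule eq_matI)
    fix r c assume rc: "r < dim_row W" "c < dim_col W"
    then have r: "r < ?n" and c: "c < ?n"
      by (auto simp: W_def)
    let ?v = "\<lambda>k. (if even k then f r else g r) * X r ^ (k div 2)"
    have "(two_block (Suc h) f g X * T) $$ (r, c) =
        (\<Sum>k<?n. ?v k * (if k = c then 1 else if k + 2 = c then - X i else 0))"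
      using r c by (simp add: two_block_def T_def scalar_prod_def lessThan_atLeast0)
    also have "\<dots> = (\<Sum>k<?n. (if k = c then ?v k else 0) + (if k = c - 2 \<and> 2 \<le> c then ?v k * (- X i) else 0))"
      by (intro sum.cong refl) auto
    also have "\<dots> = ?v c + (if 2 \<le> c then ?v (c - 2) * (- X i) else 0)"
      using c by (auto simp: sum.distrib sum.delta)
    also have "\<dots> = W $$ (r, c)"
    proof (cases "2 \<le> c")
      case True
      then obtain d where "c = d + 2"
        using le_Suc_ex by (metis add.commute)
      then show ?thesis
        using r c by (simp add: W_def algebra_simps)
    next
      case False
      then have "c = 0 \<or> c = 1"
        by auto
      then show ?thesis
        using r c by (auto simp: W_def)
    qed
    finally show "(two_block (Suc h) f g X * T) $$ (r, c) = W $$ (r, c)" .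
  qed (simp_all add: two_block_def T_def W_def)
  then have detV: "det (two_block (Suc h) f g X) = det W"
    using det_mult[OF V T] \<open>det T = 1\<close> by simp
  have minor: "det (mat_delete W ?M c) = (if c = 1 then f i else g i) * ((-1) ^ i * det D)" if c: "c = 0 \<or> c = 1" for c
  proof -
    let ?N = "mat_delete W ?M c"
    have N: "?N \<in> carrier_mat (2 * h + 1) (2 * h + 1)"
      by (rule carrier_matI) (simp_all add: mat_delete_def W_def)
    have entry: "?N $$ (r, k) = W $$ (r, if k < c then k else Suc k)" if "r < 2 * h + 1" "k < 2 * h + 1" for r k
      using that by (simp add: mat_delete_def W_def)
    have "det ?N = ?N $$ (i, 0) * cofactor ?N i 0"
    proof (rule det_row_single_entry[OF N i])
      fix j assume "j < 2 * h + 1" "j \<noteq> 0"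
      then show "?N $$ (i, j) = 0"
        using i c by (subst entry) (auto simp: W_def)
    qed simp
    moreover have "?N $$ (i, 0) = (if c = 1 then f i else g i)"
      using i c by (subst entry) (auto simp: W_def)
    moreover have "mat_delete ?N i 0 = D"
    proof (rule eq_matI)
      fix r k assume "r < dim_row D" "k < dim_col D"
      then have rk: "r < 2 * h" "k < 2 * h"
        by (auto simp: D_def)
      then have "mat_delete ?N i 0 $$ (r, k) = ?N $$ (insert_index i r, Suc k)"
        using carrier_matD[OF N] by (subst mat_delete_def) (simp add: insert_index_def)
      also have "\<dots> = W $$ (insert_index i r, Suc (Suc k))"
        using rk c by (subst entry) (auto simp: insert_index_def)
      also have "\<dots> = D $$ (r, k)"
        using rk by (auto simp: W_def D_def insert_index_def)
      finally show "mat_delete ?N i 0 $$ (r, k) = D $$ (r, k)" .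
    qed (use N in \<open>simp_all add: mat_delete_def D_def W_def\<close>)
    ultimately show ?thesis
      by (simp add: cofactor_def)
  qed
  have "det W = (\<Sum>j<?n. W $$ (?M, j) * cofactor W ?M j)"
    using W by (rule laplace_expansion_row) simp
  also have "\<dots> = (\<Sum>j\<in>{0, 1}. W $$ (?M, j) * cofactor W ?M j)"
    using eq by (intro sum.mono_neutral_right) (auto simp: W_def)
  also have "\<dots> = (-1) ^ i * (f i * g ?M - f ?M * g i) * det D"
    using minor[of 0] minor[of 1] by (simp add: cofactor_def W_def algebra_simps)
  also have "det D = (\<Prod>l<2 * h. X (insert_index i l) - X i) *
      det (two_block h (\<lambda>l. f (insert_index i l)) (\<lambda>l. g (insert_index i l)) (\<lambda>l. X (insert_index i l)))"
    unfolding D_def two_block_def by (rule det_scale_rows)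
  also have "(\<Prod>l<2 * h. X (insert_index i l) - X i) = (\<Prod>l\<in>{..<2 * h + 1} - {i}. X l - X i)"
    using i prod_insert_index[of i "2 * h" "\<lambda>l. X l - X i"] by simp
  finally show ?thesis
    unfolding detV by (simp add: mult_ac)
qed

text \<open>
  Lagrange interpolation in \<open>y\<^sub>M\<close>: multiplied by \<open>y\<^sub>M\<^sup>h\<close>, the determinant is a polynomial of degree at most \<open>2 h\<close> in
  \<open>y\<^sub>M\<close> once the entries \<open>f\<^sub>M, g\<^sub>M\<close> are held fixed. At the \<open>2 h + 1\<close> points \<open>1/y\<^sub>i\<close> the last \<open>X\<close> coincides with
  \<open>X\<^sub>i\<close>, so that the value is given by \<open>det_two_block_collision\<close>.
\<close>

lemma det_two_block_expansion:
  fixes y :: "nat \<Rightarrow> complex"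
  defines "X \<equiv> \<lambda>l. y l + inverse (y l)"
  assumes M: "M = 2 * h + 1" and nz: "\<And>l. l \<le> M \<Longrightarrow> y l \<noteq> 0" and inj: "inj_on y {..<M}"
  shows "y M ^ h * det (two_block (Suc h) f g X) =
    (\<Sum>i<M. (-1) ^ i * (f i * g M - f M * g i) * inverse (y i) ^ h *
       (\<Prod>l\<in>{..<M} - {i}. (1 - y l * y M) * (1 - y i * y l) / y l) *
       det (two_block h (\<lambda>l. f (insert_index i l)) (\<lambda>l. g (insert_index i l)) (\<lambda>l. X (insert_index i l))))"
proof -
  define D where "D i = det (two_block h (\<lambda>l. f (insert_index i l)) (\<lambda>l. g (insert_index i l)) (\<lambda>l. X (insert_index i l)))" for i
  \<comment> \<open>\<open>R\<close> is the Lagrange interpolation polynomial with nodes \<open>1/y\<^sub>i\<close>.\<close>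
  define e where "e i = (-1) ^ i * (f i * g M - f M * g i) * inverse (y i) ^ h *
    (\<Prod>l\<in>{..<M} - {i}. (1 - y i * y l) / y l) * D i" for i
  define R where "R = (\<Sum>i<M. smult (e i) (\<Prod>l\<in>{..<M} - {i}. [:1, - y l:]))"
  obtain T where degT: "degree T \<le> 2 * h"
    and T: "\<And>z. z \<noteq> 0 \<Longrightarrow> poly T z = z ^ h * det (two_block (Suc h) f g (X(M := z + inverse z)))"
    using det_two_block_last_row[of h f g X] unfolding M by metis
  have degR: "degree R \<le> 2 * h"
    unfolding R_def
  proof (rule degree_sum_le)
    fix i assume "i \<in> {..<M}"
    have "degree (\<Prod>l\<in>{..<M} - {i}. [:1, - y l:]) \<le> (\<Sum>l\<in>{..<M} - {i}. 1)"
    proof (rule order_trans[OF degree_prod_sum_le], simp, rule sum_mono)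
      fix l
      show "(degree \<circ> (\<lambda>l. [:1, - y l:])) l \<le> 1"
        using degree_pCons_le[of 1 "[:- y l:]"] by simp
    qed
    also have "\<dots> = 2 * h"
      using \<open>i \<in> {..<M}\<close> by (simp add: M)
    finally show "degree (smult (e i) (\<Prod>l\<in>{..<M} - {i}. [:1, - y l:])) \<le> 2 * h"
      using degree_smult_le order_trans by blast
  qed simp
  have evalR: "poly R z = (\<Sum>i<M. e i * (\<Prod>l\<in>{..<M} - {i}. 1 - y l * z))" for z
    by (simp add: R_def poly_sum poly_prod mult.commute)
  have node: "poly T (inverse (y a)) = poly R (inverse (y a))" if a: "a < M" for a
  proof -
    have ya: "y a \<noteq> 0"
      using nz a by simp
    have "poly R (inverse (y a)) = e a * (\<Prod>l\<in>{..<M} - {a}. 1 - y l * inverse (y a))"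
    proof -
      have zero: "(\<Prod>l\<in>{..<M} - {i}. 1 - y l * inverse (y a)) = 0" if "i \<noteq> a" for i
        using that a ya by (auto intro!: prod_zero bexI[of _ a])
      have "(\<Sum>i\<in>{..<M} - {a}. e i * (\<Prod>l\<in>{..<M} - {i}. 1 - y l * inverse (y a))) = 0"
      proof (rule sum.neutral, rule ballI)
        fix i assume "i \<in> {..<M} - {a}"
        then have "i \<noteq> a" by simp
        then show "e i * (\<Prod>l\<in>{..<M} - {i}. 1 - y l * inverse (y a)) = 0"
          by (subst zero) simp_all
      qed
      then show ?thesis
        unfolding evalR using a by (subst sum.remove[of _ a]) simp_all
    qed
    also have "\<dots> = (-1) ^ a * (f a * g M - f M * g a) * inverse (y a) ^ h *
        ((\<Prod>l\<in>{..<M} - {a}. (1 - y a * y l) / y l) * (\<Prod>l\<in>{..<M} - {a}. 1 - y l * inverse (y a))) * D a"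
      by (simp only: e_def mult_ac)
    also have "(\<Prod>l\<in>{..<M} - {a}. (1 - y a * y l) / y l) * (\<Prod>l\<in>{..<M} - {a}. 1 - y l * inverse (y a)) =
        (\<Prod>l\<in>{..<M} - {a}. X l - X a)"
      unfolding prod.distrib[symmetric]
    proof (intro prod.cong refl)
      fix l assume "l \<in> {..<M} - {a}"
      then have "y l \<noteq> 0"
        using nz by auto
      then show "(1 - y a * y l) / y l * (1 - y l * inverse (y a)) = X l - X a"
        using ya by (simp add: X_def field_simps)
    qed
    finally have R: "poly R (inverse (y a)) = inverse (y a) ^ h *
        ((-1) ^ a * (f a * g M - f M * g a) * (\<Prod>l\<in>{..<M} - {a}. X l - X a) * D a)"
      by (simp only: mult_ac)
    have "inverse (y a) + inverse (inverse (y a)) = X a"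
      by (simp add: X_def add.commute)
    then have "poly T (inverse (y a)) = inverse (y a) ^ h * det (two_block (Suc h) f g (X(M := X a)))"
      using T[of "inverse (y a)"] ya by simp
    also have "det (two_block (Suc h) f g (X(M := X a))) =
        (-1) ^ a * (f a * g M - f M * g a) * (\<Prod>l\<in>{..<M} - {a}. X l - X a) * D a"
    proof -
      have 1: "(\<Prod>l\<in>{..<M} - {a}. (X(M := X a)) l - (X(M := X a)) a) = (\<Prod>l\<in>{..<M} - {a}. X l - X a)"
        using a by (intro prod.cong) auto
      have 2: "det (two_block h (\<lambda>l. f (insert_index a l)) (\<lambda>l. g (insert_index a l))
          (\<lambda>l. (X(M := X a)) (insert_index a l))) = D a"
        unfolding D_def two_block_def using M
        by (intro det_mat_cong) (auto simp: insert_index_def)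
      show ?thesis
        using det_two_block_collision[of a h "X(M := X a)" f g] a unfolding M[symmetric] 1 2 by simp
    qed
    finally show ?thesis
      unfolding R .
  qed
  \<comment> \<open>Two polynomials of degree at most \<open>2 h\<close> that agree at \<open>2 h + 1\<close> points.\<close>
  have "T = R"
  proof (rule poly_eqI_degree[where A = "(\<lambda>a. inverse (y a)) ` {..<M}"])
    have "card ((\<lambda>a. inverse (y a)) ` {..<M}) = M"
      using inj by (subst card_image) (auto simp: inj_on_def)
    then show "card ((\<lambda>a. inverse (y a)) ` {..<M}) > degree T" "card ((\<lambda>a. inverse (y a)) ` {..<M}) > degree R"
      using degT degR M by auto
  qed (use node in auto)
  then have "poly T (y M) = (\<Sum>i<M. e i * (\<Prod>l\<in>{..<M} - {i}. 1 - y l * y M))"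
    by (simp add: evalR)
  also have "\<dots> = (\<Sum>i<M. (-1) ^ i * (f i * g M - f M * g i) * inverse (y i) ^ h *
       (\<Prod>l\<in>{..<M} - {i}. (1 - y l * y M) * (1 - y i * y l) / y l) * D i)"
  proof (intro sum.cong refl)
    fix i
    have "(\<Prod>l\<in>{..<M} - {i}. (1 - y i * y l) / y l) * (\<Prod>l\<in>{..<M} - {i}. 1 - y l * y M) =
        (\<Prod>l\<in>{..<M} - {i}. (1 - y l * y M) * (1 - y i * y l) / y l)"
      unfolding prod.distrib[symmetric] by (simp add: mult_ac)
    then show "e i * (\<Prod>l\<in>{..<M} - {i}. 1 - y l * y M) = (-1) ^ i * (f i * g M - f M * g i) * inverse (y i) ^ h *
       (\<Prod>l\<in>{..<M} - {i}. (1 - y l * y M) * (1 - y i * y l) / y l) * D i"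
      unfolding e_def by (simp add: mult_ac)
  qed
  also have "poly T (y M) = y M ^ h * det (two_block (Suc h) f g X)"
    using T[of "y M"] nz[of M] by (simp add: X_def fun_upd_idem)
  finally show ?thesis
    by (simp add: D_def)
qed

section \<open>An even number of variables\<close>

context generic_base
begin

text \<open>
  The determinant of the statement in the variables \<open>y\<^sub>i = s\<^sub>i\<^sup>2\<close>, with row \<open>i\<close> multiplied by
  \<open>s\<^sub>i\<close> to the power \<open>N + 2 (m - 1)\<close>; see \<open>det_cy_joukowski\<close>.
\<close>

definition det_cy :: "nat \<Rightarrow> nat \<Rightarrow> (nat \<Rightarrow> complex) \<Rightarrow> complex" where
  "det_cy N m y = det (mat m m (\<lambda>(i, j). y i ^ (m - 1 - j) * cy (N + 2 * j) (y i)))"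

definition Phi :: "nat \<Rightarrow> nat \<Rightarrow> (nat \<Rightarrow> complex) \<Rightarrow> complex" where
  "Phi n m y = schur_sum kern {..n} (\<lambda>i k. alpha k * alpha (n - k) * y i ^ k) {..<m}"

lemma Phi_expansion:
  assumes "odd M"
  shows "Phi n (Suc M) y =
    (\<Sum>i<M. (-1) ^ i * pair_sum n (y i) (y M) * Phi n (M - 1) (\<lambda>l. y (insert_index i l)))"
proof -
  let ?W = "\<lambda>i k. alpha k * alpha (n - k) * y i ^ k"
  have "Phi n (Suc M) y = (\<Sum>i<M. (-1) ^ i * (\<Sum>a\<le>n. \<Sum>b\<le>n. kern a b * ?W i a * ?W M b) *
      schur_sum kern {..n} ?W ({..<M} - {i}))"
    unfolding Phi_def using assms power_plus_power_nonzero
    by (intro schur_sum_expansion[where t = "\<lambda>k. q ^ k"]) (auto simp: kern_def fun_eq_iff)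
  moreover have "schur_sum kern {..n} ?W ({..<M} - {i}) = Phi n (M - 1) (\<lambda>l. y (insert_index i l))"
    if "i < M" for i
  proof -
    have "{..<M} - {i} = insert_index i ` {..<M - 1}"
      using insert_index_image_lessThan[of i "M - 1"] that by simp
    then show ?thesis
      unfolding Phi_def using schur_sum_reindex[OF strict_mono_insert_index, of kern "{..n}" ?W i "{..<M - 1}"]
      by simp
  qed
  ultimately show ?thesis
    by (simp add: pair_sum_def)
qed

text \<open>
  Both sides satisfy the same recursion in the number of variables: the left-hand side by \<open>Phi_expansion\<close> and
  \<open>pair_sum_eq\<close>, the right-hand side by \<open>det_two_block_expansion\<close>. For \<open>h = 0\<close> the truncated
  exponent \<open>h - 1\<close> occurs in an empty product only.
\<close>

lemma Phi_even_two_block: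
  assumes "\<And>l. l < 2 * h \<Longrightarrow> y l \<noteq> 0" and "inj_on y {..<2 * h}"
  shows "pairprod (\<lambda>i j. 1 - y i * y j) {..<2 * h} * Phi (r + 1) (2 * h) y =
    (alpha r * alpha (r + 1)) ^ h * (\<Prod>i<2 * h. y i ^ (h - 1)) *
    det (two_block h (\<lambda>i. y i * cy r (y i)) (\<lambda>i. cy (r + 2) (y i)) (\<lambda>i. y i + inverse (y i)))"
  using assms
proof (induction h arbitrary: y)
  case 0
  then show ?case
    by (simp add: Phi_def schur_sum_def two_block_def)
next
  case (Suc h)
  define M where "M = 2 * h + 1"
  define \<kappa> where "\<kappa> = alpha r * alpha (r + 1)"
  define f where "f = (\<lambda>x. x * cy r x)"
  define g where "g = (\<lambda>x. cy (r + 2) x)"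
  define u where "u = (\<lambda>i j. 1 - y i * y j)"
  define D where "D i = det (two_block h (\<lambda>l. f (y (insert_index i l))) (\<lambda>l. g (y (insert_index i l)))
    (\<lambda>l. y (insert_index i l) + inverse (y (insert_index i l))))" for i
  have Suc_M: "2 * Suc h = Suc M" "M - 1 = 2 * h" and "odd M"
    by (simp_all add: M_def)
  have nz: "y l \<noteq> 0" if "l \<le> M" for l
    using Suc.prems(1)[of l] that by (simp add: M_def)
  have inj: "inj_on y {..<M}"
    using Suc.prems(2) by (rule inj_on_subset) (auto simp: M_def)
  have IH: "pairprod u ({..<M} - {i}) * Phi (r + 1) (2 * h) (\<lambda>l. y (insert_index i l)) =
      \<kappa> ^ h * (\<Prod>l\<in>{..<M} - {i}. y l ^ (h - 1)) * D i" if i: "i < M" for i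
  proof -
    have image: "{..<M} - {i} = insert_index i ` {..<2 * h}"
      using i insert_index_image_lessThan[of i "2 * h"] by (simp add: M_def)
    have "inj_on (\<lambda>l. y (insert_index i l)) {..<2 * h}"
      using comp_inj_on[OF insert_index_inj_on[of i "{..<2 * h}"], of y] inj image
      by (auto simp: o_def intro: inj_on_subset)
    moreover have "y (insert_index i l) \<noteq> 0" if "l < 2 * h" for l
      using that by (intro nz) (auto simp: insert_index_def M_def)
    ultimately have "pairprod (\<lambda>i' j. 1 - y (insert_index i i') * y (insert_index i j)) {..<2 * h} *
        Phi (r + 1) (2 * h) (\<lambda>l. y (insert_index i l)) =
        \<kappa> ^ h * (\<Prod>l<2 * h. y (insert_index i l) ^ (h - 1)) * D i"
      unfolding \<kappa>_def D_def f_def g_def by (rule Suc.IH[rotated])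
    moreover have "pairprod u ({..<M} - {i}) =
        pairprod (\<lambda>i' j. 1 - y (insert_index i i') * y (insert_index i j)) {..<2 * h}"
      unfolding image by (subst pairprod_reindex[OF strict_mono_insert_index]) (simp add: u_def)
    moreover have "(\<Prod>l\<in>{..<M} - {i}. y l ^ (h - 1)) = (\<Prod>l<2 * h. y (insert_index i l) ^ (h - 1))"
      using i prod_insert_index[of i "2 * h" "\<lambda>l. y l ^ (h - 1)"] by (simp add: M_def)
    ultimately show ?thesis
      by simp
  qed
  have "pairprod u {..<Suc M} * Phi (r + 1) (Suc M) y =
      (\<Sum>i<M. pairprod u {..<Suc M} * ((-1) ^ i * pair_sum (r + 1) (y i) (y M) *
        Phi (r + 1) (2 * h) (\<lambda>l. y (insert_index i l))))"
    unfolding Phi_expansion[OF \<open>odd M\<close>] Suc_M(2) by (simp only: sum_distrib_left)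
  also have "\<dots> = (\<Sum>i<M. \<kappa> ^ Suc h * (\<Prod>l<M. y l ^ h) * ((-1) ^ i * (f (y i) * g (y M) - f (y M) * g (y i)) *
      inverse (y i) ^ h * (\<Prod>l\<in>{..<M} - {i}. (1 - y l * y M) * (1 - y i * y l) / y l) * D i))"
  proof (intro sum.cong refl)
    fix i assume "i \<in> {..<M}"
    then have i: "i < M" by simp
    define Q where "Q = (\<Prod>l\<in>{..<M} - {i}. (1 - y l * y M) * (1 - y i * y l))"
    have pp: "pairprod u {..<Suc M} = pairprod u ({..<M} - {i}) * Q * (1 - y i * y M)"
    proof -
      have "pairprod u {..<M} = pairprod u ({..<M} - {i}) * (\<Prod>l\<in>{..<M} - {i}. u i l)"
        using i by (intro pairprod_remove_sym) (auto simp: u_def mult.commute)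
      moreover have "(\<Prod>l<M. u l M) = u i M * (\<Prod>l\<in>{..<M} - {i}. u l M)"
        using i by (simp add: prod.remove)
      ultimately show ?thesis
        by (simp add: pairprod_lessThan_Suc Q_def u_def prod.distrib mult_ac)
    qed
    have cancel: "(\<Prod>l<M. y l ^ h) * inverse (y i) ^ h * (\<Prod>l\<in>{..<M} - {i}. (1 - y l * y M) * (1 - y i * y l) / y l) =
        Q * (\<Prod>l\<in>{..<M} - {i}. y l ^ (h - 1))"
    proof -
      have "(\<Prod>l<M. y l ^ h) * inverse (y i) ^ h = (\<Prod>l\<in>{..<M} - {i}. y l ^ h)"
        using i nz[of i] by (simp add: prod.remove[of _ i] power_inverse)
      moreover have "y l ^ h * ((1 - y l * y M) * (1 - y i * y l) / y l) =
          (1 - y l * y M) * (1 - y i * y l) * y l ^ (h - 1)" if "l \<in> {..<M} - {i}" for l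
      proof -
        have "h = Suc (h - 1)"
          using that i by (auto simp: M_def)
        then have "y l ^ h = y l * y l ^ (h - 1)"
          by (metis power_Suc)
        then show ?thesis
          using nz[of l] that by simp
      qed
      ultimately show ?thesis
        unfolding Q_def by (simp add: prod.distrib[symmetric] cong: prod.cong_simp)
    qed
    have "pairprod u {..<Suc M} * ((-1) ^ i * pair_sum (r + 1) (y i) (y M) *
          Phi (r + 1) (2 * h) (\<lambda>l. y (insert_index i l))) =
        (-1) ^ i * ((1 - y i * y M) * pair_sum (r + 1) (y i) (y M)) * Q *
          (pairprod u ({..<M} - {i}) * Phi (r + 1) (2 * h) (\<lambda>l. y (insert_index i l)))"
      unfolding pp by (simp only: mult_ac)
    also have "\<dots> = (-1) ^ i * (\<kappa> * (f (y i) * g (y M) - f (y M) * g (y i))) * Q *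
        (\<kappa> ^ h * (\<Prod>l\<in>{..<M} - {i}. y l ^ (h - 1)) * D i)"
      unfolding IH[OF i] pair_sum_eq by (simp add: \<kappa>_def f_def g_def mult.commute)
    also have "\<dots> = \<kappa> ^ Suc h * ((-1) ^ i * (f (y i) * g (y M) - f (y M) * g (y i)) *
        (Q * (\<Prod>l\<in>{..<M} - {i}. y l ^ (h - 1))) * D i)"
      by (simp only: mult_ac power_Suc)
    finally show "pairprod u {..<Suc M} * ((-1) ^ i * pair_sum (r + 1) (y i) (y M) *
          Phi (r + 1) (2 * h) (\<lambda>l. y (insert_index i l))) =
        \<kappa> ^ Suc h * (\<Prod>l<M. y l ^ h) * ((-1) ^ i * (f (y i) * g (y M) - f (y M) * g (y i)) *
        inverse (y i) ^ h * (\<Prod>l\<in>{..<M} - {i}. (1 - y l * y M) * (1 - y i * y l) / y l) * D i)"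
      unfolding cancel[symmetric] by (simp only: mult_ac)
  qed
  also have "\<dots> = \<kappa> ^ Suc h * (\<Prod>l<M. y l ^ h) * (y M ^ h *
      det (two_block (Suc h) (\<lambda>i. f (y i)) (\<lambda>i. g (y i)) (\<lambda>i. y i + inverse (y i))))"
    unfolding sum_distrib_left[symmetric] D_def
    by (subst det_two_block_expansion[where M = M]) (use nz inj in \<open>auto simp: M_def\<close>)
  finally show ?case
    unfolding Suc_M by (simp add: u_def \<kappa>_def f_def g_def mult_ac)
qed
text \<open>
  The span of the functions that form the columns of \<open>det_cy N (2 * h)\<close>. In terms of \<open>\<xi> = s + 1/s\<close> it is,
  up to the factor \<open>s\<^sup>N\<^sup>+\<^sup>4\<^sup>h\<^sup>-\<^sup>2\<close>, the span of \<open>c\<^sub>N, c\<^sub>N\<^sub>+\<^sub>2, \<dots>, c\<^sub>N\<^sub>+\<^sub>4\<^sub>h\<^sub>-\<^sub>2\<close>.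
\<close>

definition in_span :: "nat \<Rightarrow> nat \<Rightarrow> (complex \<Rightarrow> complex) \<Rightarrow> bool" where
  "in_span N h u \<longleftrightarrow> (\<exists>\<gamma>. \<forall>y. u y = (\<Sum>j<2 * h. \<gamma> j * (y ^ (2 * h - 1 - j) * cy (N + 2 * j) y)))"

lemma in_span_base: "j < 2 * h \<Longrightarrow> in_span N h (\<lambda>y. y ^ (2 * h - 1 - j) * cy (N + 2 * j) y)"
  unfolding in_span_def by (rule exI[of _ "\<lambda>i. if i = j then 1 else 0"]) (simp add: if_distrib[of "\<lambda>x. x * _"] cong: if_cong)

lemma in_span_add: "in_span N h u \<Longrightarrow> in_span N h v \<Longrightarrow> in_span N h (\<lambda>y. u y + v y)"
proof -
  assume "in_span N h u" "in_span N h v"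
  then obtain \<gamma> \<delta> where "\<And>y. u y = (\<Sum>j<2 * h. \<gamma> j * (y ^ (2 * h - 1 - j) * cy (N + 2 * j) y))"
    "\<And>y. v y = (\<Sum>j<2 * h. \<delta> j * (y ^ (2 * h - 1 - j) * cy (N + 2 * j) y))"
    unfolding in_span_def by blast
  then show ?thesis
    unfolding in_span_def
    by (intro exI[of _ "\<lambda>j. \<gamma> j + \<delta> j"]) (simp add: distrib_right sum.distrib)
qed

lemma in_span_scale: "in_span N h u \<Longrightarrow> in_span N h (\<lambda>y. x * u y)"
proof -
  assume "in_span N h u"
  then obtain \<gamma> where "\<And>y. u y = (\<Sum>j<2 * h. \<gamma> j * (y ^ (2 * h - 1 - j) * cy (N + 2 * j) y))"
    unfolding in_span_def by blast
  then show ?thesis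
    unfolding in_span_def
    by (intro exI[of _ "\<lambda>j. x * \<gamma> j"]) (simp add: sum_distrib_left mult.assoc)
qed

lemma in_span_sum:
  assumes "finite A" "\<And>j. j \<in> A \<Longrightarrow> in_span N h (v j)"
  shows "in_span N h (\<lambda>y. \<Sum>j\<in>A. v j y)"
  using assms
proof (induction A rule: finite_induct)
  case empty
  then show ?case
    unfolding in_span_def by (auto intro: exI[of _ "\<lambda>_. 0"])
qed (simp add: in_span_add)

lemma in_span_times_y:
  assumes "in_span (N + 2) h u"
  shows "in_span N (Suc h) (\<lambda>y. y * u y)"
proof -
  obtain \<gamma> where u: "\<And>y. u y = (\<Sum>j<2 * h. \<gamma> j * (y ^ (2 * h - 1 - j) * cy (N + 2 + 2 * j) y))"
    using assms unfolding in_span_def by blast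
  have "in_span N (Suc h) (\<lambda>y. \<gamma> j * (y * (y ^ (2 * h - 1 - j) * cy (N + 2 + 2 * j) y)))" if "j < 2 * h" for j
  proof -
    have "2 * Suc h - 1 - Suc j = Suc (2 * h - 1 - j)"
      using that by simp
    then show ?thesis
      using in_span_scale[OF in_span_base[of "Suc j" "Suc h" N]] that by (simp add: mult.assoc)
  qed
  then have "in_span N (Suc h) (\<lambda>y. \<Sum>j<2 * h. \<gamma> j * (y * (y ^ (2 * h - 1 - j) * cy (N + 2 + 2 * j) y)))"
    by (intro in_span_sum) auto
  then show ?thesis
    by (simp add: u sum_distrib_left mult.left_commute)
qed

text \<open>
  Up to a factor \<open>y\<close>, multiplication by \<open>1 + y\<^sup>2\<close> is multiplication by \<open>\<xi>\<^sup>2 - 2\<close>. By the recurrence applied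
  twice it extends the range of the indices by one step of length two in both directions.
\<close>

lemma in_span_times_quadratic:
  assumes "in_span (N + 2) h u"
  shows "in_span N (Suc h) (\<lambda>y. (1 + y\<^sup>2) * u y)"
proof -
  obtain \<gamma> where u: "\<And>y. u y = (\<Sum>j<2 * h. \<gamma> j * (y ^ (2 * h - 1 - j) * cy (N + 2 + 2 * j) y))"
    using assms unfolding in_span_def by blast
  have "in_span N (Suc h) (\<lambda>y. \<gamma> j * ((1 + y\<^sup>2) * (y ^ (2 * h - 1 - j) * cy (N + 2 + 2 * j) y)))" if j: "j < 2 * h" for j
  proof -
    obtain \<delta> \<epsilon> where rec: "\<And>y. (1 + y\<^sup>2) * cy (N + 2 * j + 2) y = cy (N + 2 * j + 4) y +
        \<delta> * (y * cy (N + 2 * j + 2) y) + \<epsilon> * (y\<^sup>2 * cy (N + 2 * j) y)"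
      using cy_recurrence_double[of "N + 2 * j"] by blast
    define e where "e = 2 * h - 1 - j"
    have e: "2 * Suc h - 1 - (j + 2) = e" "2 * Suc h - 1 - (j + 1) = e + 1" "2 * Suc h - 1 - j = e + 2"
      using j by (simp_all add: e_def)
    have b: "in_span N (Suc h) (\<lambda>y. y ^ e * cy (N + 2 * j + 4) y)"
      "in_span N (Suc h) (\<lambda>y. y ^ (e + 1) * cy (N + 2 * j + 2) y)"
      "in_span N (Suc h) (\<lambda>y. y ^ (e + 2) * cy (N + 2 * j) y)"
      using in_span_base[of "j + 2" "Suc h" N] in_span_base[of "j + 1" "Suc h" N] in_span_base[of "j" "Suc h" N] j
      unfolding e by (simp_all add: add.assoc add.commute[of _ "2 * j"] numeral_eq_Suc)
    have "(1 + y\<^sup>2) * (y ^ e * cy (N + 2 + 2 * j) y) = y ^ e * cy (N + 2 * j + 4) y +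
        \<delta> * (y ^ (e + 1) * cy (N + 2 * j + 2) y) + \<epsilon> * (y ^ (e + 2) * cy (N + 2 * j) y)" for y
    proof -
      have "(1 + y\<^sup>2) * (y ^ e * cy (N + 2 + 2 * j) y) = y ^ e * ((1 + y\<^sup>2) * cy (N + 2 * j + 2) y)"
        by (simp add: mult_ac add_ac)
      then show ?thesis
        unfolding rec by (simp add: algebra_simps power_add power2_eq_square)
    qed
    then show ?thesis
      unfolding e_def[symmetric] using b by (auto intro!: in_span_scale in_span_add)
  qed
  then have "in_span N (Suc h) (\<lambda>y. \<Sum>j<2 * h. \<gamma> j * ((1 + y\<^sup>2) * (y ^ (2 * h - 1 - j) * cy (N + 2 + 2 * j) y)))"
    by (intro in_span_sum) auto
  then show ?thesis
    by (simp add: u sum_distrib_left mult.left_commute)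
qed

lemma in_span_two_block_column:
  assumes "in_span (N + 2 * h) 1 u" "l \<le> h"
  shows "in_span N (Suc h) (\<lambda>y. y ^ (h - l) * (1 + y\<^sup>2) ^ l * u y)"
  using assms
proof (induction h arbitrary: N l)
  case 0
  then show ?case by simp
next
  case (Suc h)
  have base: "in_span (N + 2 + 2 * h) 1 u"
    using Suc.prems(1) by (simp add: add_ac)
  show ?case
  proof (cases l)
    case 0
    then show ?thesis
      using in_span_times_y[OF Suc.IH[OF base, of 0]] by (simp add: mult.assoc)
  next
    case (Suc k)
    then show ?thesis
      using in_span_times_quadratic[OF Suc.IH[OF base, of k]] Suc.prems(2) by (simp add: mult_ac)
  qed
qed

text \<open>
  The matrix of \<open>two_block\<close>, with rows scaled, is the matrix of \<open>det_cy\<close> times the matrix of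
  the coefficients of its columns; \<open>\<kappa>\<close> is the determinant of the latter.
\<close>

lemma two_block_proportional:
  "\<exists>\<kappa>. \<forall>y. (\<forall>i<2 * Suc h. y i \<noteq> 0) \<longrightarrow>
    (\<Prod>i<2 * Suc h. y i ^ h) * det (two_block (Suc h) (\<lambda>i. y i * cy (N + 2 * h) (y i))
       (\<lambda>i. cy (N + 2 * h + 2) (y i)) (\<lambda>i. y i + inverse (y i))) = \<kappa> * det_cy N (2 * Suc h) y"
proof -
  let ?m = "2 * Suc h"
  define w where "w c y = y ^ (h - c div 2) * (1 + y\<^sup>2) ^ (c div 2) *
    (if even c then y * cy (N + 2 * h) y else cy (N + 2 * h + 2) y)" for c y
  have "in_span (N + 2 * h) 1 (\<lambda>y. if even c then y * cy (N + 2 * h) y else cy (N + 2 * h + 2) y)" for c :: nat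
    using in_span_base[of 0 1 "N + 2 * h"] in_span_base[of 1 1 "N + 2 * h"] by (cases "even c") simp_all
  then have "in_span N (Suc h) (w c)" if "c < ?m" for c
    unfolding w_def using that by (intro in_span_two_block_column) auto
  then have "\<forall>c<?m. \<exists>\<gamma>. \<forall>y. w c y = (\<Sum>j<?m. \<gamma> j * (y ^ (?m - 1 - j) * cy (N + 2 * j) y))"
    unfolding in_span_def by blast
  then obtain \<gamma> where \<gamma>: "\<And>c y. c < ?m \<Longrightarrow> w c y = (\<Sum>j<?m. \<gamma> c j * (y ^ (?m - 1 - j) * cy (N + 2 * j) y))"
    unfolding choice_iff' by blast
  define G where "G = mat ?m ?m (\<lambda>(j, c). \<gamma> c j)"
  have "(\<Prod>i<?m. y i ^ h) * det (two_block (Suc h) (\<lambda>i. y i * cy (N + 2 * h) (y i))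
       (\<lambda>i. cy (N + 2 * h + 2) (y i)) (\<lambda>i. y i + inverse (y i))) = det G * det_cy N ?m y"
    if nz: "\<forall>i<?m. y i \<noteq> 0" for y
  proof -
    let ?L = "mat ?m ?m (\<lambda>(i, j). y i ^ (?m - 1 - j) * cy (N + 2 * j) (y i))"
    have "(\<Prod>i<?m. y i ^ h) * det (two_block (Suc h) (\<lambda>i. y i * cy (N + 2 * h) (y i))
       (\<lambda>i. cy (N + 2 * h + 2) (y i)) (\<lambda>i. y i + inverse (y i))) = det (mat ?m ?m (\<lambda>(i, c). w c (y i)))"
      unfolding two_block_def det_scale_rows[symmetric]
    proof (rule det_mat_cong)
      fix i c assume i: "i < ?m" and c: "c < ?m"
      have "1 + (y i)\<^sup>2 = y i * (y i + inverse (y i))"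
        using nz i by (simp add: algebra_simps power2_eq_square)
      moreover have "y i ^ h = y i ^ (h - c div 2) * y i ^ (c div 2)"
        using c by (simp flip: power_add)
      ultimately show "y i ^ h * ((if even c then y i * cy (N + 2 * h) (y i) else cy (N + 2 * h + 2) (y i)) *
          (y i + inverse (y i)) ^ (c div 2)) = w c (y i)"
        by (simp add: w_def power_mult_distrib mult_ac)
    qed
    also have "mat ?m ?m (\<lambda>(i, c). w c (y i)) = ?L * G"
      by (rule eq_matI) (auto simp: G_def \<gamma> scalar_prod_def lessThan_atLeast0 mult_ac intro!: sum.cong)
    also have "det (?L * G) = det ?L * det G"
      by (rule det_mult) (auto simp: G_def)
    finally show ?thesis
      by (simp add: det_cy_def)
  qed
  then show ?thesis
    by blast
qed

end

section \<open>Letting the last variable vanish\<close>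

lemma isCont_det:
  assumes "\<And>i j. i < n \<Longrightarrow> j < n \<Longrightarrow> isCont (\<lambda>s. A s i j :: complex) (x :: complex)"
  shows "isCont (\<lambda>s. det (mat n n (\<lambda>(i, j). A s i j))) x"
proof -
  have "isCont (\<lambda>s. A s i (\<pi> i)) x" if "\<pi> permutes {0..<n}" "i < n" for \<pi> i
    using permutes_in_image[OF that(1), of i] that(2) by (intro assms) auto
  then show ?thesis
    unfolding det_mat_leibniz by (intro continuous_intros) auto
qed

context generic_base
begin

lemma isCont_cy: "isCont f x \<Longrightarrow> isCont (\<lambda>s. cy r (f s)) (x :: complex)"
  unfolding cy_def by (intro continuous_intros) auto

lemma isCont_Phi:
  assumes "\<And>i. i < m \<Longrightarrow> isCont (\<lambda>s. Y s i) (x :: complex)"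
  shows "isCont (\<lambda>s. Phi n m (Y s)) x"
  unfolding Phi_def schur_sum_def using assms by (intro continuous_intros) auto

lemma isCont_det_cy:
  assumes "\<And>i. i < m \<Longrightarrow> isCont (\<lambda>s. Y s i) (x :: complex)"
  shows "isCont (\<lambda>s. det_cy N m (Y s)) x"
  unfolding det_cy_def using assms by (intro isCont_det continuous_intros isCont_cy) auto

lemma Phi_cong: "(\<And>i. i < m \<Longrightarrow> y i = z i) \<Longrightarrow> Phi n m y = Phi n m z"
  unfolding Phi_def schur_sum_def by (intro sum.cong arg_cong2[of _ _ _ _ "(*)"] prod.cong) auto

lemma det_cy_cong: "(\<And>i. i < m \<Longrightarrow> y i = z i) \<Longrightarrow> det_cy N m y = det_cy N m z"
  unfolding det_cy_def by (intro det_mat_cong) auto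

lemma eventually_generic_line:
  fixes y :: "nat \<Rightarrow> complex"
  shows "eventually (\<lambda>s. (\<forall>i<m. y i + s * of_nat (Suc i) \<noteq> 0) \<and>
    inj_on (\<lambda>i. y i + s * of_nat (Suc i)) {..<m}) (at 0)"
proof -
  have "eventually (\<lambda>s. \<forall>i\<in>{..<m}. y i + s * of_nat (Suc i) \<noteq> 0) (at 0)"
    by (intro eventually_ball_finite ballI eventually_affine_nonzero) (simp_all del: of_nat_Suc)
  moreover have "eventually (\<lambda>s. \<forall>i\<in>{..<m}. \<forall>j\<in>{..<m}. i \<noteq> j \<longrightarrow>
      y i + s * of_nat (Suc i) \<noteq> y j + s * of_nat (Suc j)) (at 0)"
  proof (intro eventually_ball_finite ballI)
    fix i j
    show "eventually (\<lambda>s. i \<noteq> j \<longrightarrow> y i + s * of_nat (Suc i) \<noteq> y j + s * of_nat (Suc j)) (at 0)"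
    proof (cases "i = j")
      case False
      then have "eventually (\<lambda>s. y i - y j + s * (of_nat (Suc i) - of_nat (Suc j)) \<noteq> 0) (at 0)"
        by (intro eventually_affine_nonzero) simp
      then show ?thesis
        by eventually_elim (auto simp: algebra_simps)
    qed simp
  qed simp_all
  ultimately show ?thesis
    by eventually_elim (auto simp: inj_on_def)
qed

text \<open>
  Both sides are polynomials in \<open>y\<close>, and every \<open>y\<close> is the limit of points with distinct nonzero coordinates on a line.
\<close>

lemma identity_by_continuity:
  assumes "\<And>y. (\<And>i. i < m \<Longrightarrow> y i \<noteq> 0) \<Longrightarrow> inj_on y {..<m} \<Longrightarrow>
    pairprod (\<lambda>i j. 1 - y i * y j) {..<m} * Phi n m y = \<kappa> * det_cy N m y"
  shows "pairprod (\<lambda>i j. 1 - y i * y j) {..<m} * Phi n m y = \<kappa> * det_cy N m y"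
proof -
  define Y where "Y s i = y i + s * of_nat (Suc i)" for s i
  have Y0: "Y 0 = y"
    by (simp add: Y_def fun_eq_iff)
  have contY: "isCont (\<lambda>s. Y s i) 0" for i
    unfolding Y_def by (intro continuous_intros)
  have "isCont (\<lambda>s. pairprod (\<lambda>i j. 1 - Y s i * Y s j) {..<m} * Phi n m (Y s)) 0"
    by (intro continuous_intros isCont_pairprod isCont_Phi contY)
  moreover have "isCont (\<lambda>s. \<kappa> * det_cy N m (Y s)) 0"
    by (intro continuous_intros isCont_det_cy contY)
  moreover have "eventually (\<lambda>s. pairprod (\<lambda>i j. 1 - Y s i * Y s j) {..<m} * Phi n m (Y s) =
      \<kappa> * det_cy N m (Y s)) (at 0)"
    using eventually_generic_line[of m y]
    by eventually_elim (rule assms, auto simp: Y_def[abs_def])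
  ultimately show ?thesis
    using isCont_eq_at_0[of "\<lambda>s. pairprod (\<lambda>i j. 1 - Y s i * Y s j) {..<m} * Phi n m (Y s)"
        "\<lambda>s. \<kappa> * det_cy N m (Y s)"] by (simp add: Y0)
qed

lemma identity_even_up_to_constant:
  "\<exists>\<kappa>. \<forall>y. pairprod (\<lambda>i j. 1 - y i * y j) {..<2 * Suc h} * Phi (N + 2 * h + 1) (2 * Suc h) y =
    \<kappa> * det_cy N (2 * Suc h) y"
proof -
  obtain \<kappa> where \<kappa>: "\<And>y. (\<forall>i<2 * Suc h. y i \<noteq> 0) \<Longrightarrow>
    (\<Prod>i<2 * Suc h. y i ^ h) * det (two_block (Suc h) (\<lambda>i. y i * cy (N + 2 * h) (y i))
       (\<lambda>i. cy (N + 2 * h + 2) (y i)) (\<lambda>i. y i + inverse (y i))) = \<kappa> * det_cy N (2 * Suc h) y"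
    using two_block_proportional by blast
  let ?\<alpha> = "(alpha (N + 2 * h) * alpha (N + 2 * h + 1)) ^ Suc h"
  have "pairprod (\<lambda>i j. 1 - y i * y j) {..<2 * Suc h} * Phi (N + 2 * h + 1) (2 * Suc h) y =
    (?\<alpha> * \<kappa>) * det_cy N (2 * Suc h) y" for y
  proof (rule identity_by_continuity)
    fix y :: "nat \<Rightarrow> complex"
    assume nz: "\<And>i. i < 2 * Suc h \<Longrightarrow> y i \<noteq> 0" and inj: "inj_on y {..<2 * Suc h}"
    show "pairprod (\<lambda>i j. 1 - y i * y j) {..<2 * Suc h} * Phi (N + 2 * h + 1) (2 * Suc h) y =
        (?\<alpha> * \<kappa>) * det_cy N (2 * Suc h) y"
    proof -
      have "(\<Prod>i<2 * Suc h. y i ^ h) * det (two_block (Suc h) (\<lambda>i. y i * cy (N + 2 * h) (y i))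
          (\<lambda>i. cy (N + 2 * h + 2) (y i)) (\<lambda>i. y i + inverse (y i))) = \<kappa> * det_cy N (2 * Suc h) y"
        using nz by (intro \<kappa>) auto
      then show ?thesis
        using Phi_even_two_block[OF nz inj, of "N + 2 * h"] unfolding diff_Suc_1
        by (simp only: mult.assoc)
    qed
  qed
  then show ?thesis
    by blast
qed

lemma sum_PiE_shift:
  assumes "\<And>k i. k \<in> I \<rightarrow>\<^sub>E {..Suc n} \<Longrightarrow> i \<in> I \<Longrightarrow> k i = 0 \<Longrightarrow> g k = 0" "finite I"
  shows "(\<Sum>k\<in>I \<rightarrow>\<^sub>E {..Suc n}. g k) = (\<Sum>k\<in>I \<rightarrow>\<^sub>E {..n}. g (\<lambda>i\<in>I. Suc (k i)))"
proof -
  have "(\<Sum>k\<in>I \<rightarrow>\<^sub>E {..Suc n}. g k) = (\<Sum>k\<in>I \<rightarrow>\<^sub>E {1..Suc n}. g k)"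
  proof (rule sum.mono_neutral_right)
    show "\<forall>k\<in>(I \<rightarrow>\<^sub>E {..Suc n}) - (I \<rightarrow>\<^sub>E {1..Suc n}). g k = 0"
    proof
      fix k assume k: "k \<in> (I \<rightarrow>\<^sub>E {..Suc n}) - (I \<rightarrow>\<^sub>E {1..Suc n})"
      then obtain i where "i \<in> I" "k i = 0"
        by (force simp: PiE_def Pi_def)
      then show "g k = 0"
        using assms(1) k by blast
    qed
    show "finite (I \<rightarrow>\<^sub>E {..Suc n})"
      using assms(2) by (intro finite_PiE) auto
    show "I \<rightarrow>\<^sub>E {1..Suc n} \<subseteq> I \<rightarrow>\<^sub>E {..Suc n}"
      by (intro PiE_mono) auto
  qed
  also have "\<dots> = (\<Sum>k\<in>I \<rightarrow>\<^sub>E {..n}. g (\<lambda>i\<in>I. Suc (k i)))"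
  proof (rule sum.reindex_bij_witness[where i = "\<lambda>k. \<lambda>i\<in>I. Suc (k i)" and j = "\<lambda>k. \<lambda>i\<in>I. k i - 1"])
    fix k assume k: "k \<in> I \<rightarrow>\<^sub>E {1..Suc n}"
    show *: "(\<lambda>i\<in>I. Suc ((\<lambda>i\<in>I. k i - 1) i)) = k"
    proof
      fix i
      show "(\<lambda>i\<in>I. Suc ((\<lambda>i\<in>I. k i - 1) i)) i = k i"
        using PiE_mem[OF k, of i] PiE_arb[OF k, of i] by (cases "i \<in> I") auto
    qed
    show "(\<lambda>i\<in>I. k i - 1) \<in> I \<rightarrow>\<^sub>E {..n}"
      using PiE_mem[OF k] by fastforce
    show "g (\<lambda>i\<in>I. Suc ((\<lambda>i\<in>I. k i - 1) i)) = g k"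
      unfolding * ..
  next
    fix k assume k: "k \<in> I \<rightarrow>\<^sub>E {..n}"
    show "(\<lambda>i\<in>I. (\<lambda>i\<in>I. Suc (k i)) i - 1) = k"
    proof
      fix i
      show "(\<lambda>i\<in>I. (\<lambda>i\<in>I. Suc (k i)) i - 1) i = k i"
        using PiE_arb[OF k, of i] by (cases "i \<in> I") auto
    qed
    show "(\<lambda>i\<in>I. Suc (k i)) \<in> I \<rightarrow>\<^sub>E {1..Suc n}"
      using PiE_mem[OF k] by fastforce
  qed
  finally show ?thesis .
qed

lemma kern_0_right: "kern k 0 = nu k"
  by (simp add: kern_def nu_def add.commute)

text \<open>
  Only \<open>k\<^sub>m = 0\<close> contributes. It turns the kernel factors with \<open>k\<^sub>m\<close> into \<open>\<nu>\<^bsub>k\<^sub>i\<^esub>\<close>, which lower \<open>\<alpha>\<^bsub>k\<^sub>i\<^esub>\<close> to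
  \<open>\<alpha>\<^bsub>k\<^sub>i - 1\<^esub>\<close>; the shift of the remaining indices by one does not change the kernel.
\<close>

lemma Phi_last_zero:
  assumes "y m = 0"
  shows "Phi (Suc n) (Suc m) y = alpha (Suc n) * (\<Prod>i<m. y i) * Phi n m y"
proof -
  let ?W = "\<lambda>n i k. alpha k * alpha (n - k) * y i ^ k"
  have "Phi (Suc n) (Suc m) y = (\<Sum>x\<le>Suc n. \<Sum>k\<in>{..<m} \<rightarrow>\<^sub>E {..Suc n}.
      pairprod (\<lambda>i j. kern ((k(m := x)) i) ((k(m := x)) j)) {..<Suc m} *
      (\<Prod>i<Suc m. ?W (Suc n) i ((k(m := x)) i)))"
    unfolding Phi_def schur_sum_def lessThan_Suc by (rule sum_PiE_insert) simp
  also have "\<dots> = (\<Sum>x\<in>{0}. \<Sum>k\<in>{..<m} \<rightarrow>\<^sub>E {..Suc n}.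
      pairprod (\<lambda>i j. kern ((k(m := x)) i) ((k(m := x)) j)) {..<Suc m} *
      (\<Prod>i<Suc m. ?W (Suc n) i ((k(m := x)) i)))"
  proof (intro sum.mono_neutral_right ballI)
    fix x assume "x \<in> {..Suc n} - {0}"
    then have "y m ^ x = 0"
      using assms by simp
    then show "(\<Sum>k\<in>{..<m} \<rightarrow>\<^sub>E {..Suc n}.
        pairprod (\<lambda>i j. kern ((k(m := x)) i) ((k(m := x)) j)) {..<Suc m} *
        (\<Prod>i<Suc m. ?W (Suc n) i ((k(m := x)) i))) = 0"
      by (intro sum.neutral) simp
  qed auto
  also have "\<dots> = (\<Sum>k\<in>{..<m} \<rightarrow>\<^sub>E {..Suc n}. alpha (Suc n) *
      (pairprod (\<lambda>i j. kern (k i) (k j)) {..<m} * (\<Prod>i<m. nu (k i) * ?W (Suc n) i (k i))))"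
  proof -
    have summand: "pairprod (\<lambda>i j. kern ((k(m := 0)) i) ((k(m := 0)) j)) {..<Suc m} *
        (\<Prod>i<Suc m. ?W (Suc n) i ((k(m := 0)) i)) = alpha (Suc n) *
        (pairprod (\<lambda>i j. kern (k i) (k j)) {..<m} * (\<Prod>i<m. nu (k i) * ?W (Suc n) i (k i)))" for k
    proof -
      have "pairprod (\<lambda>i j. kern ((k(m := 0)) i) ((k(m := 0)) j)) {..<m} =
          pairprod (\<lambda>i j. kern (k i) (k j)) {..<m}"
        by (intro pairprod_cong) simp
      moreover have "(\<Prod>i<m. kern ((k(m := 0)) i) ((k(m := 0)) m)) = (\<Prod>i<m. nu (k i))"
        by (intro prod.cong) (auto simp: kern_0_right)
      moreover have "(\<Prod>i<m. ?W (Suc n) i ((k(m := 0)) i)) = (\<Prod>i<m. ?W (Suc n) i (k i))"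
        by (intro prod.cong) auto
      ultimately show ?thesis
        unfolding pairprod_lessThan_Suc prod.lessThan_Suc prod.distrib[of nu]
        by (simp add: prod.distrib mult_ac)
    qed
    show ?thesis
      by (simp only: sum.insert
          sum.empty finite.emptyI empty_iff not_False_eq_True add_0_right summand)
  qed
  also have "\<dots> = alpha (Suc n) * (\<Sum>k\<in>{..<m} \<rightarrow>\<^sub>E {..Suc n}.
      pairprod (\<lambda>i j. kern (k i) (k j)) {..<m} * (\<Prod>i<m. nu (k i) * ?W (Suc n) i (k i)))"
    by (simp add: sum_distrib_left)
  also have "(\<Sum>k\<in>{..<m} \<rightarrow>\<^sub>E {..Suc n}.
      pairprod (\<lambda>i j. kern (k i) (k j)) {..<m} * (\<Prod>i<m. nu (k i) * ?W (Suc n) i (k i))) =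
      (\<Sum>k\<in>{..<m} \<rightarrow>\<^sub>E {..n}. pairprod (\<lambda>i j. kern ((\<lambda>i\<in>{..<m}. Suc (k i)) i) ((\<lambda>i\<in>{..<m}. Suc (k i)) j)) {..<m} *
        (\<Prod>i<m. nu ((\<lambda>i\<in>{..<m}. Suc (k i)) i) * ?W (Suc n) i ((\<lambda>i\<in>{..<m}. Suc (k i)) i)))"
  proof (rule sum_PiE_shift)
    fix k :: "nat \<Rightarrow> nat" and i
    assume "i \<in> {..<m}" "k i = 0"
    then have "(\<Prod>i<m. nu (k i) * ?W (Suc n) i (k i)) = 0"
      by (intro prod_zero bexI[of _ i]) auto
    then show "pairprod (\<lambda>i j. kern (k i) (k j)) {..<m} * (\<Prod>i<m. nu (k i) * ?W (Suc n) i (k i)) = 0"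
      by (simp only: mult_zero_right)
  qed simp
  also have "\<dots> = (\<Sum>k\<in>{..<m} \<rightarrow>\<^sub>E {..n}. (\<Prod>i<m. y i) *
      (pairprod (\<lambda>i j. kern (k i) (k j)) {..<m} * (\<Prod>i<m. ?W n i (k i))))"
  proof (intro sum.cong refl)
    fix k
    have "pairprod (\<lambda>i j. kern ((\<lambda>i\<in>{..<m}. Suc (k i)) i) ((\<lambda>i\<in>{..<m}. Suc (k i)) j)) {..<m} =
        pairprod (\<lambda>i j. kern (k i) (k j)) {..<m}"
      by (intro pairprod_cong) (simp add: kern_Suc_Suc)
    moreover have "(\<Prod>i<m. nu ((\<lambda>i\<in>{..<m}. Suc (k i)) i) * ?W (Suc n) i ((\<lambda>i\<in>{..<m}. Suc (k i)) i)) =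
        (\<Prod>i<m. y i) * (\<Prod>i<m. ?W n i (k i))"
      unfolding prod.distrib[symmetric]
    proof (intro prod.cong refl)
      fix i assume "i \<in> {..<m}"
      then show "nu ((\<lambda>i\<in>{..<m}. Suc (k i)) i) * ?W (Suc n) i ((\<lambda>i\<in>{..<m}. Suc (k i)) i) = y i * ?W n i (k i)"
        using alpha_down[of "k i"] by simp
    qed
    ultimately show "pairprod (\<lambda>i j. kern ((\<lambda>i\<in>{..<m}. Suc (k i)) i) ((\<lambda>i\<in>{..<m}. Suc (k i)) j)) {..<m} *
        (\<Prod>i<m. nu ((\<lambda>i\<in>{..<m}. Suc (k i)) i) * ?W (Suc n) i ((\<lambda>i\<in>{..<m}. Suc (k i)) i)) =
        (\<Prod>i<m. y i) * (pairprod (\<lambda>i j. kern (k i) (k j)) {..<m} * (\<Prod>i<m. ?W n i (k i)))"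
      by (simp only: mult_ac)
  qed
  finally show ?thesis
    by (simp add: Phi_def schur_sum_def sum_distrib_left mult.assoc)
qed

text \<open>
  The last row of the matrix becomes \<open>(0, \<dots>, 0, 1)\<close>.
\<close>

lemma det_cy_last_zero:
  assumes "y m = 0"
  shows "det_cy N (Suc m) y = (\<Prod>i<m. y i) * det_cy N m y"
proof -
  define A where "A = mat (Suc m) (Suc m) (\<lambda>(i, j). y i ^ (m - j) * cy (N + 2 * j) (y i))"
  have A: "A \<in> carrier_mat (Suc m) (Suc m)"
    by (simp add: A_def)
  have "det A = A $$ (m, m) * cofactor A m m"
    using A by (rule det_row_single_entry) (use assms in \<open>auto simp: A_def\<close>)
  moreover have "A $$ (m, m) = 1"
    by (simp add: A_def assms cy_at_0)
  moreover have "mat_delete A m m = mat m m (\<lambda>(i, j). y i * (y i ^ (m - 1 - j) * cy (N + 2 * j) (y i)))"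
  proof (rule eq_matI)
    fix i j assume "i < dim_row (mat m m (\<lambda>(i, j). y i * (y i ^ (m - 1 - j) * cy (N + 2 * j) (y i))))"
      "j < dim_col (mat m m (\<lambda>(i, j). y i * (y i ^ (m - 1 - j) * cy (N + 2 * j) (y i))))"
    then have ij: "i < m" "j < m"
      by auto
    then have "m - j = Suc (m - 1 - j)"
      by simp
    then show "mat_delete A m m $$ (i, j) =
        mat m m (\<lambda>(i, j). y i * (y i ^ (m - 1 - j) * cy (N + 2 * j) (y i))) $$ (i, j)"
      using ij by (simp add: A_def mat_delete_def)
  qed (simp_all add: A_def)
  ultimately have "det A = (\<Prod>i<m. y i) * det_cy N m y"
    by (simp add: cofactor_def det_cy_def det_scale_rows)
  then show ?thesis
    by (simp add: det_cy_def A_def)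
qed

text \<open>
  Needed to read off constants of proportionality. A point with \<open>y\<^sub>m = 0\<close> comes from the previous case, and a
  small perturbation makes the last coordinate nonzero.
\<close>

lemma det_cy_not_identically_zero:
  "\<exists>y. (\<forall>i<m. y i \<noteq> 0) \<and> det_cy N m y \<noteq> 0"
proof (induction m)
  case 0
  then show ?case
    by (simp add: det_cy_def)
next
  case (Suc m)
  then obtain y where y: "\<forall>i<m. y i \<noteq> 0" "det_cy N m y \<noteq> 0"
    by blast
  let ?Y = "\<lambda>s. y(m := s)"
  have "isCont (\<lambda>s. ?Y s i) 0" for i
    by (cases "i = m") auto
  then have "isCont (\<lambda>s. det_cy N (Suc m) (?Y s)) 0"
    by (intro isCont_det_cy)
  moreover have "det_cy N (Suc m) (?Y 0) \<noteq> 0"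
  proof -
    have "det_cy N m (?Y 0) = det_cy N m y"
      by (rule det_cy_cong) simp
    then show ?thesis
      using y by (simp add: det_cy_last_zero)
  qed
  ultimately have "eventually (\<lambda>s. det_cy N (Suc m) (?Y s) \<noteq> 0) (at 0)"
    unfolding isCont_def by (rule tendsto_imp_eventually_ne)
  moreover have "eventually (\<lambda>s. s \<noteq> (0 :: complex)) (at 0)"
    by (rule eventually_neq_at_within)
  ultimately have "eventually (\<lambda>s. det_cy N (Suc m) (?Y s) \<noteq> 0 \<and> s \<noteq> 0) (at 0)"
    by (rule eventually_conj)
  then obtain s where "det_cy N (Suc m) (?Y s) \<noteq> 0" "s \<noteq> 0"
    using eventually_happens[of _ "at (0 :: complex)"] by auto
  moreover from this(2) have "\<forall>i<Suc m. ?Y s i \<noteq> 0"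
    using y(1) by (auto simp: less_Suc_eq)
  ultimately show ?case
    by blast
qed

lemma identity_descend:
  assumes "\<And>y. pairprod (\<lambda>i j. 1 - y i * y j) {..<Suc m} * Phi (Suc n) (Suc m) y = \<kappa> * det_cy N (Suc m) y"
  shows "pairprod (\<lambda>i j. 1 - y i * y j) {..<m} * Phi n m y = \<kappa> / alpha (Suc n) * det_cy N m y"
proof (rule identity_by_continuity)
  fix y :: "nat \<Rightarrow> complex"
  assume "\<And>i. i < m \<Longrightarrow> y i \<noteq> 0"
  then have nz: "(\<Prod>i<m. y i) \<noteq> 0"
    by simp
  let ?z = "y(m := 0)"
  have pp: "pairprod (\<lambda>i j. 1 - ?z i * ?z j) {..<Suc m} = pairprod (\<lambda>i j. 1 - y i * y j) {..<m}"
    unfolding pairprod_lessThan_Suc by simp (intro pairprod_cong, simp)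
  have prod: "(\<Prod>i<m. ?z i) = (\<Prod>i<m. y i)"
    by (intro prod.cong) auto
  have "Phi (Suc n) (Suc m) ?z = alpha (Suc n) * (\<Prod>i<m. y i) * Phi n m y"
    using Phi_last_zero[of ?z m n] Phi_cong[of m ?z y n] unfolding prod by simp
  moreover have "det_cy N (Suc m) ?z = (\<Prod>i<m. y i) * det_cy N m y"
    using det_cy_last_zero[of ?z m N] det_cy_cong[of m ?z y N] unfolding prod by simp
  ultimately have "(\<Prod>i<m. y i) * (alpha (Suc n) * (pairprod (\<lambda>i j. 1 - y i * y j) {..<m} * Phi n m y)) =
      (\<Prod>i<m. y i) * (\<kappa> * det_cy N m y)"
    using assms[of ?z] unfolding pp by (simp add: mult_ac)
  then have "alpha (Suc n) * (pairprod (\<lambda>i j. 1 - y i * y j) {..<m} * Phi n m y) = \<kappa> * det_cy N m y"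
    using nz by simp
  then show "pairprod (\<lambda>i j. 1 - y i * y j) {..<m} * Phi n m y = \<kappa> / alpha (Suc n) * det_cy N m y"
    by (simp add: eq_divide_eq mult.commute)
qed

text \<open>
  For an odd number of variables the identity is the value at \<open>y\<^sub>m = 0\<close> of the one with an additional variable.
\<close>

lemma identity_up_to_constant:
  "\<exists>\<kappa>. \<forall>y. pairprod (\<lambda>i j. 1 - y i * y j) {..<Suc k} * Phi (N + k) (Suc k) y = \<kappa> * det_cy N (Suc k) y"
proof (cases "even k")
  case True
  then obtain h where k: "k = 2 * h"
    by (elim evenE)
  obtain \<kappa> where "\<And>y. pairprod (\<lambda>i j. 1 - y i * y j) {..<Suc (Suc k)} * Phi (Suc (N + k)) (Suc (Suc k)) y =
      \<kappa> * det_cy N (Suc (Suc k)) y"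
    using identity_even_up_to_constant[of h N] unfolding k by auto
  then show ?thesis
    using identity_descend[of "Suc k" "N + k"] by blast
next
  case False
  then obtain h where "k = 2 * h + 1"
    by (elim oddE)
  then show ?thesis
    using identity_even_up_to_constant[of h N] by simp
qed

text \<open>
  Induction on the number of variables: the constant for \<open>k + 2\<close> variables is determined by setting the last variable
  to \<open>0\<close>, where the case of \<open>k + 1\<close> variables appears.
\<close>

theorem Phi_eq_det_cy:
  "pairprod (\<lambda>i j. 1 - y i * y j) {..<Suc k} * Phi (N + k) (Suc k) y =
    (\<Prod>i<Suc k. alpha (N + i)) * det_cy N (Suc k) y"
proof (induction k arbitrary: y)
  case 0
  have 1: "{..<Suc 0} = insert 0 {}"
    by auto
  have "Phi N (Suc 0) y = (\<Sum>x\<le>N. alpha x * alpha (N - x) * y 0 ^ x)"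
    unfolding Phi_def schur_sum_def 1 by (subst sum_PiE_insert) (simp_all add: pairprod_def)
  also have "\<dots> = alpha N * cy N (y 0)"
    by (simp add: alpha_cy)
  also have "cy N (y 0) = det_cy N (Suc 0) y"
    by (simp add: det_cy_def det_mat_leibniz)
  finally show ?case
    by (simp add: pairprod_def)
next
  case (Suc k)
  obtain \<kappa> where \<kappa>: "\<And>y. pairprod (\<lambda>i j. 1 - y i * y j) {..<Suc (Suc k)} *
      Phi (N + Suc k) (Suc (Suc k)) y = \<kappa> * det_cy N (Suc (Suc k)) y"
    using identity_up_to_constant[of "Suc k" N] by blast
  \<comment> \<open>Any point with nonvanishing determinant identifies the constant.\<close>
  obtain z where z: "det_cy N (Suc k) z \<noteq> 0"
    using det_cy_not_identically_zero by blast
  have "\<kappa> / alpha (Suc (N + k)) * det_cy N (Suc k) z = (\<Prod>i<Suc k. alpha (N + i)) * det_cy N (Suc k) z"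
    using identity_descend[of "Suc k" "N + k" \<kappa> N z] \<kappa> Suc.IH[of z] by simp
  then have "\<kappa> / alpha (Suc (N + k)) = (\<Prod>i<Suc k. alpha (N + i))"
    using z by (metis mult_right_cancel)
  then have "\<kappa> = (\<Prod>i<Suc k. alpha (N + i)) * alpha (Suc (N + k))"
    by (simp add: divide_eq_eq)
  then have "\<kappa> = (\<Prod>i<Suc (Suc k). alpha (N + i))"
    by simp
  then show ?case
    using \<kappa> by simp
qed

end

section \<open>Quotients by the Vandermonde determinant of the squares\<close>

lemma polynomial_fun_monomial: "polynomial_fun m (\<lambda>x. b * (\<Prod>i=1..m. x i ^ e i))"
proof -
  define d where "d = (\<Sum>i=1..m. e i)"
  define e' where "e' = (\<lambda>i\<in>{1..m}. e i)"
  have "e i \<le> d" if "i \<in> {1..m}" for i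
    unfolding d_def using that by (intro member_le_sum) auto
  then have mem: "e' \<in> {1..m} \<rightarrow>\<^sub>E {0..d}"
    by (auto simp: e'_def)
  have "b * (\<Prod>i=1..m. x i ^ e i) =
      (\<Sum>k \<in> {1..m} \<rightarrow>\<^sub>E {0..d}. (if k = e' then b else 0) * (\<Prod>i=1..m. x i ^ k i))" for x
  proof -
    have "(\<Sum>k \<in> {1..m} \<rightarrow>\<^sub>E {0..d}. (if k = e' then b else 0) * (\<Prod>i=1..m. x i ^ k i)) =
        (\<Sum>k \<in> {1..m} \<rightarrow>\<^sub>E {0..d}. if k = e' then b * (\<Prod>i=1..m. x i ^ e' i) else 0)"
      by (intro sum.cong) auto
    also have "\<dots> = b * (\<Prod>i=1..m. x i ^ e' i)"
      using mem by (simp add: sum.delta finite_PiE)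
    also have "(\<Prod>i=1..m. x i ^ e' i) = (\<Prod>i=1..m. x i ^ e i)"
      by (intro prod.cong) (auto simp: e'_def)
    finally show ?thesis ..
  qed
  then show ?thesis
    unfolding polynomial_fun_def
    by (intro exI[of _ d] exI[of _ "\<lambda>k. if k = e' then b else 0"] allI)
qed

lemma polynomial_fun_const: "polynomial_fun m (\<lambda>_. x)"
  using polynomial_fun_monomial[of m x "\<lambda>_. 0"] by simp

lemma polynomial_fun_bound:
  fixes m d e :: nat and f :: "(nat \<Rightarrow> complex) \<Rightarrow> complex"
  assumes "\<And>x. f x = (\<Sum>k \<in> {1..m} \<rightarrow>\<^sub>E {0..d}. a k * (\<Prod>i=1..m. x i ^ k i))" "d \<le> e"
  shows "\<exists>b. \<forall>x. f x = (\<Sum>k \<in> {1..m} \<rightarrow>\<^sub>E {0..e}. b k * (\<Prod>i=1..m. x i ^ k i))"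
proof (intro exI allI)
  fix x
  let ?D = "{1..m} \<rightarrow>\<^sub>E {0..d}" and ?E = "{1..m} \<rightarrow>\<^sub>E {0..e}"
  have "(\<Sum>k\<in>?E. (if k \<in> ?D then a k else 0) * (\<Prod>i=1..m. x i ^ k i)) =
      (\<Sum>k\<in>?D. (if k \<in> ?D then a k else 0) * (\<Prod>i=1..m. x i ^ k i))"
  proof (rule sum.mono_neutral_right)
    show "?D \<subseteq> ?E"
      using assms(2) by (intro PiE_mono) auto
    show "finite ?E"
      by (intro finite_PiE) auto
    show "\<forall>k\<in>?E - ?D. (if k \<in> ?D then a k else 0) * (\<Prod>i=1..m. x i ^ k i) = 0"
      by (intro ballI) (simp only: Diff_iff if_False mult_zero_left)
  qed
  also have "\<dots> = f x"
    unfolding assms(1) by (intro sum.cong) auto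
  finally show "f x = (\<Sum>k\<in>?E. (if k \<in> ?D then a k else 0) * (\<Prod>i=1..m. x i ^ k i))" ..
qed

lemma polynomial_fun_add:
  assumes "polynomial_fun m f" "polynomial_fun m g"
  shows "polynomial_fun m (\<lambda>x. f x + g x)"
proof -
  obtain d a where f: "\<And>x. f x = (\<Sum>k \<in> {1..m} \<rightarrow>\<^sub>E {0..d}. a k * (\<Prod>i=1..m. x i ^ k i))"
    using assms(1) unfolding polynomial_fun_def by blast
  obtain e b where g: "\<And>x. g x = (\<Sum>k \<in> {1..m} \<rightarrow>\<^sub>E {0..e}. b k * (\<Prod>i=1..m. x i ^ k i))"
    using assms(2) unfolding polynomial_fun_def by blast
  obtain a' where f': "\<And>x. f x = (\<Sum>k \<in> {1..m} \<rightarrow>\<^sub>E {0..max d e}. a' k * (\<Prod>i=1..m. x i ^ k i))"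
    using polynomial_fun_bound[OF f max.cobounded1] by blast
  obtain b' where g': "\<And>x. g x = (\<Sum>k \<in> {1..m} \<rightarrow>\<^sub>E {0..max d e}. b' k * (\<Prod>i=1..m. x i ^ k i))"
    using polynomial_fun_bound[OF g max.cobounded2] by blast
  show ?thesis
    unfolding polynomial_fun_def
    by (rule exI[of _ "max d e"], rule exI[of _ "\<lambda>k. a' k + b' k"])
      (simp add: f' g' distrib_right sum.distrib)
qed

lemma polynomial_fun_sum:
  assumes "\<And>j. j \<in> A \<Longrightarrow> polynomial_fun m (f j)"
  shows "polynomial_fun m (\<lambda>x. \<Sum>j\<in>A. f j x)"
proof (cases "finite A")
  case True
  then show ?thesis
    using assms by (induction A rule: finite_induct) (auto intro: polynomial_fun_const polynomial_fun_add)
qed (simp add: polynomial_fun_const)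

lemma polynomial_fun_mult:
  assumes "polynomial_fun m f" "polynomial_fun m g"
  shows "polynomial_fun m (\<lambda>x. f x * g x)"
proof -
  obtain d a where f: "\<And>x. f x = (\<Sum>k \<in> {1..m} \<rightarrow>\<^sub>E {0..d}. a k * (\<Prod>i=1..m. x i ^ k i))"
    using assms(1) unfolding polynomial_fun_def by blast
  obtain e b where g: "\<And>x. g x = (\<Sum>k \<in> {1..m} \<rightarrow>\<^sub>E {0..e}. b k * (\<Prod>i=1..m. x i ^ k i))"
    using assms(2) unfolding polynomial_fun_def by blast
  have "f x * g x = (\<Sum>k \<in> {1..m} \<rightarrow>\<^sub>E {0..d}. \<Sum>l \<in> {1..m} \<rightarrow>\<^sub>E {0..e}.
      a k * b l * (\<Prod>i=1..m. x i ^ (k i + l i)))" for x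
    unfolding f g sum_product by (intro sum.cong refl) (simp add: power_add prod.distrib mult_ac)
  then show ?thesis
    by (simp only:) (intro polynomial_fun_sum polynomial_fun_monomial)
qed

lemma polynomial_fun_prod:
  assumes "\<And>j. j \<in> A \<Longrightarrow> polynomial_fun m (f j)"
  shows "polynomial_fun m (\<lambda>x. \<Prod>j\<in>A. f j x)"
proof (cases "finite A")
  case True
  then show ?thesis
    using assms by (induction A rule: finite_induct) (auto intro: polynomial_fun_const polynomial_fun_mult)
qed (simp add: polynomial_fun_const)

lemma polynomial_fun_power: "polynomial_fun m f \<Longrightarrow> polynomial_fun m (\<lambda>x. f x ^ n)"
  by (induction n) (simp_all add: polynomial_fun_const polynomial_fun_mult)

lemma polynomial_fun_variable:
  assumes "i \<in> {1..m}"
  shows "polynomial_fun m (\<lambda>x. x i)"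
proof -
  have "(\<Prod>l=1..m. x l ^ (if l = i then 1 else 0)) = x i" for x :: "nat \<Rightarrow> complex"
    using assms by (subst prod.remove[of _ i]) (auto intro!: prod.neutral)
  then show ?thesis
    using polynomial_fun_monomial[of m 1 "\<lambda>l. if l = i then 1 else 0"] by simp
qed

lemma polynomial_fun_det:
  assumes "\<And>i j. i < n \<Longrightarrow> j < n \<Longrightarrow> polynomial_fun m (\<lambda>x. A x i j)"
  shows "polynomial_fun m (\<lambda>x. det (mat n n (\<lambda>(i, j). A x i j)))"
proof -
  have "polynomial_fun m (\<lambda>x. A x i (\<pi> i))" if "\<pi> permutes {0..<n}" "i < n" for \<pi> i
    using permutes_in_image[OF that(1), of i] that(2) by (intro assms) auto
  then show ?thesis
    unfolding det_mat_leibniz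
    by (auto intro!: polynomial_fun_sum polynomial_fun_mult polynomial_fun_const polynomial_fun_prod)
qed

lemma polynomial_fun_isCont:
  assumes "polynomial_fun m f" "\<And>i. i \<in> {1..m} \<Longrightarrow> isCont (\<lambda>s. Y s i) (z :: complex)"
  shows "isCont (\<lambda>s. f (Y s)) z"
proof -
  obtain d a where f: "\<And>x. f x = (\<Sum>k \<in> {1..m} \<rightarrow>\<^sub>E {0..d}. a k * (\<Prod>i=1..m. x i ^ k i))"
    using assms(1) unfolding polynomial_fun_def by blast
  show ?thesis
    unfolding f using assms(2) by (intro continuous_intros) auto
qed

text \<open>
  \<open>divided_difference r z i\<close> evaluated at \<open>z\<^sub>i\<close> is the classical divided difference
  \<open>r[z\<^sub>0, \<dots>, z\<^sub>i]\<close>, but repeated nodes are allowed.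
\<close>

fun divided_difference :: "complex poly \<Rightarrow> (nat \<Rightarrow> complex) \<Rightarrow> nat \<Rightarrow> complex poly" where
  "divided_difference r z 0 = r"
| "divided_difference r z (Suc i) = synthetic_div (divided_difference r z i) (z i)"

lemma poly_synthetic_div:
  fixes r :: "'a :: comm_ring_1 poly"
  shows "poly r x = poly r a + (x - a) * poly (synthetic_div r a) x"
proof -
  have "poly r x = poly ([:- a, 1:] * synthetic_div r a + [:poly r a:]) x"
    by (simp only: synthetic_div_correct')
  then show ?thesis
    by (simp add: algebra_simps)
qed

lemma newton_interpolation:
  "poly r x = (\<Sum>l<i. poly (divided_difference r z l) (z l) * (\<Prod>l'<l. x - z l')) +
    poly (divided_difference r z i) x * (\<Prod>l'<i. x - z l')"
proof (induction i)
  case 0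
  then show ?case by simp
next
  case (Suc i)
  have step: "poly (divided_difference r z i) x = poly (divided_difference r z i) (z i) +
      (x - z i) * poly (divided_difference r z (Suc i)) x"
    using poly_synthetic_div[of "divided_difference r z i" x "z i"] by simp
  show ?case
    by (subst Suc, subst step) (simp add: algebra_simps del: divided_difference.simps)
qed

text \<open>
  Newton interpolation factors the matrix into a lower triangular one, whose diagonal multiplies up to the Vandermonde
  product, and the matrix of divided differences. The latter has polynomial entries, which is why the quotient is
  a polynomial.
\<close>

lemma det_eq_vandermonde_times_divided_differences:
  "det (mat m m (\<lambda>(i, j). poly (r j) (z i))) =
    pairprod (\<lambda>i j. z j - z i) {..<m} * det (mat m m (\<lambda>(i, j). poly (divided_difference (r j) z i) (z i)))"
proof -
  let ?L = "mat m m (\<lambda>(i, l). \<Prod>l'<l. z i - z l')"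
  let ?R = "mat m m (\<lambda>(i, j). poly (divided_difference (r j) z i) (z i))"
  have "mat m m (\<lambda>(i, j). poly (r j) (z i)) = ?L * ?R"
  proof (rule eq_matI)
    fix i j assume "i < dim_row (?L * ?R)" "j < dim_col (?L * ?R)"
    then have ij: "i < m" "j < m"
      by auto
    have "(?L * ?R) $$ (i, j) = (\<Sum>l<m. (\<Prod>l'<l. z i - z l') * poly (divided_difference (r j) z l) (z l))"
      using ij by (simp add: scalar_prod_def lessThan_atLeast0)
    also have "\<dots> = (\<Sum>l<Suc i. (\<Prod>l'<l. z i - z l') * poly (divided_difference (r j) z l) (z l))"
      using ij by (intro sum.mono_neutral_right) auto
    also have "\<dots> = poly (r j) (z i)"
      unfolding newton_interpolation[of "r j" "z i" z i] by (simp add: mult.commute)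
    finally show "mat m m (\<lambda>(i, j). poly (r j) (z i)) $$ (i, j) = (?L * ?R) $$ (i, j)"
      using ij by simp
  qed simp_all
  then have "det (mat m m (\<lambda>(i, j). poly (r j) (z i))) = det ?L * det ?R"
    using det_mult[of ?L m ?R] by simp
  also have "det ?L = prod_list (diag_mat ?L)"
    by (rule det_lower_triangular[of m]) auto
  also have "\<dots> = pairprod (\<lambda>i j. z j - z i) {..<m}"
  proof -
    have "prod_list (diag_mat ?L) = (\<Prod>i<m. \<Prod>l<i. z i - z l)"
      by (simp add: prod_list_diag_prod lessThan_atLeast0)
    also have "\<dots> = (\<Prod>i<m. \<Prod>l\<in>{l\<in>{..<m}. l < i}. z i - z l)"
      by (intro prod.cong refl) auto
    finally show ?thesis
      by (simp add: pairprod_def)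
  qed
  finally show ?thesis .
qed

lemma coeff_synthetic_div:
  fixes s :: "'a :: comm_ring_1 poly"
  shows "degree s \<le> n \<Longrightarrow> coeff (synthetic_div s a) k = (\<Sum>l\<in>{Suc k..n}. coeff s l * a ^ (l - Suc k))"
proof (induction s arbitrary: k n)
  case 0
  then show ?case by simp
next
  case (pCons b s)
  show ?case
  proof (cases "s = 0")
    case True
    then show ?thesis
      by (auto simp: coeff_pCons intro!: sum.neutral split: nat.split)
  next
    case False
    then obtain n' where n: "n = Suc n'" "degree s \<le> n'"
      using pCons.prems by (cases n) auto
    show ?thesis
    proof (cases k)
      case 0
      have "poly s a = (\<Sum>l\<le>n'. coeff s l * a ^ l)"
        unfolding poly_altdef using n by (intro sum.mono_neutral_left) (auto simp: coeff_eq_0)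
      then show ?thesis
        unfolding n 0 synthetic_div_pCons sum.shift_bounds_cl_Suc_ivl by (simp add: atMost_atLeast0)
    next
      case (Suc k')
      then show ?thesis
        unfolding n synthetic_div_pCons sum.shift_bounds_cl_Suc_ivl using pCons.IH[OF n(2)] by simp
    qed
  qed
qed

lemma degree_divided_difference: "degree (divided_difference r z i) \<le> degree r"
  by (induction i) (auto simp: degree_synthetic_div)

lemma polynomial_fun_coeff_divided_difference:
  assumes "\<And>l. l < i \<Longrightarrow> polynomial_fun m (\<lambda>x. Z x l)"
  shows "polynomial_fun m (\<lambda>x. coeff (divided_difference r (Z x) i) k)"
  using assms
proof (induction i arbitrary: k)
  case 0
  then show ?case
    by (simp add: polynomial_fun_const)
next
  case (Suc i)
  have "coeff (divided_difference r (Z x) (Suc i)) k =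
      (\<Sum>l\<in>{Suc k..degree r}. coeff (divided_difference r (Z x) i) l * Z x i ^ (l - Suc k))" for x
    unfolding divided_difference.simps by (rule coeff_synthetic_div[OF degree_divided_difference])
  then show ?case
    using Suc by (auto intro!: polynomial_fun_sum polynomial_fun_mult polynomial_fun_power)
qed

lemma polynomial_fun_poly_divided_difference:
  assumes "\<And>l. l \<le> i \<Longrightarrow> polynomial_fun m (\<lambda>x. Z x l)"
  shows "polynomial_fun m (\<lambda>x. poly (divided_difference r (Z x) i) (Z x i))"
proof -
  have "poly (divided_difference r (Z x) i) (Z x i) =
      (\<Sum>k\<le>degree r. coeff (divided_difference r (Z x) i) k * Z x i ^ k)" for x
    unfolding poly_altdef using degree_divided_difference[of r "Z x" i]
    by (intro sum.mono_neutral_left) (auto simp: coeff_eq_0)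
  then show ?thesis
    using assms
    by (auto intro!: polynomial_fun_sum polynomial_fun_mult polynomial_fun_power
        polynomial_fun_coeff_divided_difference)
qed

lemma prod_pairs_eq_pairprod: "(\<Prod>j=1..m. \<Prod>i=1..<j. u i j) = pairprod u {1..m}"
  unfolding pairprod_def by (intro prod.cong refl) auto

lemma pairprod_shift: "pairprod u {1..m} = pairprod (\<lambda>i j. u (Suc i) (Suc j)) {..<m}"
  using pairprod_reindex[of "{..<m}" Suc u] by (simp add: image_Suc_lessThan strict_mono_on_def)

text \<open>
  Through every point there is a line on which the product of the \<open>x\<^sub>j\<^sup>2 - x\<^sub>i\<^sup>2\<close> vanishes at finitely many points only.
\<close>

lemma polynomial_fun_eqI:
  assumes "polynomial_fun m f" "polynomial_fun m g"
    and eq: "\<And>x. (\<Prod>j=1..m. \<Prod>i=1..<j. (x j)\<^sup>2 - (x i)\<^sup>2) \<noteq> 0 \<Longrightarrow> f x = g x"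
  shows "f = g"
proof
  fix x
  define Y where "Y s i = x i + s * of_nat i" for s :: complex and i
  have Y0: "Y 0 = x"
    by (simp add: Y_def fun_eq_iff)
  have contY: "isCont (\<lambda>s. Y s i) 0" for i
    unfolding Y_def by (intro continuous_intros)
  have "isCont (\<lambda>s. f (Y s)) 0" "isCont (\<lambda>s. g (Y s)) 0"
    using assms(1,2) contY by (auto intro: polynomial_fun_isCont)
  moreover have "eventually (\<lambda>s. f (Y s) = g (Y s)) (at 0)"
  proof -
    have "eventually (\<lambda>s. (Y s j)\<^sup>2 - (Y s i)\<^sup>2 \<noteq> 0) (at 0)" if "i < j" for i j
    proof -
      have "eventually (\<lambda>s. (x j - x i) + s * (of_nat j - of_nat i) \<noteq> 0) (at 0)"
        "eventually (\<lambda>s. (x j + x i) + s * of_nat (i + j) \<noteq> 0) (at 0)"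
        using that by (intro eventually_affine_nonzero; simp del: of_nat_add)+
      then show ?thesis
      proof eventually_elim
        case (elim s)
        have "(Y s j)\<^sup>2 - (Y s i)\<^sup>2 =
            ((x j - x i) + s * (of_nat j - of_nat i)) * ((x j + x i) + s * of_nat (i + j))"
          by (simp add: Y_def power2_eq_square algebra_simps)
        then show ?case
          using elim by simp
      qed
    qed
    then have "eventually (\<lambda>s. \<forall>j\<in>{1..m}. \<forall>i\<in>{1..<j}. (Y s j)\<^sup>2 - (Y s i)\<^sup>2 \<noteq> 0) (at 0)"
      by (intro eventually_ball_finite ballI) auto
    then show ?thesis
      by eventually_elim (rule eq, simp)
  qed
  ultimately have "f (Y 0) = g (Y 0)"
    by (rule isCont_eq_at_0)
  then show "f x = g x"
    by (simp add: Y0)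
qed

lemma det_quotient_correct:
  assumes parity: "\<And>j. j \<in> {1..m} \<Longrightarrow> \<exists>e. \<forall>x. poly (p j) x = x ^ \<epsilon> * poly e (x\<^sup>2)"
  shows "polynomial_fun m (det_quotient m p)"
    and "(\<Prod>j=1..m. \<Prod>i=1..<j. (x j)\<^sup>2 - (x i)\<^sup>2) \<noteq> 0 \<Longrightarrow>
      det_quotient m p x = det (mat m m (\<lambda>(i, j). poly (p (j + 1)) (x (i + 1)))) /
        (\<Prod>j=1..m. \<Prod>i=1..<j. (x j)\<^sup>2 - (x i)\<^sup>2)"
proof -
  let ?V = "\<lambda>x :: nat \<Rightarrow> complex. \<Prod>j=1..m. \<Prod>i=1..<j. (x j)\<^sup>2 - (x i)\<^sup>2"
  let ?D = "\<lambda>x. det (mat m m (\<lambda>(i, j). poly (p (j + 1)) (x (i + 1))))"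
  obtain e where e: "\<And>j x. j \<in> {1..m} \<Longrightarrow> poly (p j) x = x ^ \<epsilon> * poly (e j) (x\<^sup>2)"
    using parity by metis
  define Z :: "(nat \<Rightarrow> complex) \<Rightarrow> nat \<Rightarrow> complex" where "Z x i = (x (Suc i))\<^sup>2" for x i
  define f where "f x = (\<Prod>i<m. x (Suc i) ^ \<epsilon>) *
    det (mat m m (\<lambda>(i, j). poly (divided_difference (e (Suc j)) (Z x) i) (Z x i)))" for x
  have pf: "polynomial_fun m f"
    unfolding f_def
  proof (intro polynomial_fun_mult polynomial_fun_prod polynomial_fun_power polynomial_fun_variable
      polynomial_fun_det polynomial_fun_poly_divided_difference)
    fix i j l assume "i < m" "l \<le> i"
    then show "polynomial_fun m (\<lambda>x. Z x l)"
      unfolding Z_def by (intro polynomial_fun_power polynomial_fun_variable) auto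
  qed auto
  have fV: "?D x = f x * ?V x" for x
  proof -
    have "?D x = det (mat m m (\<lambda>(i, j). x (Suc i) ^ \<epsilon> * poly (e (Suc j)) (Z x i)))"
      by (intro det_mat_cong) (simp add: e Z_def)
    also have "\<dots> = (\<Prod>i<m. x (Suc i) ^ \<epsilon>) * (pairprod (\<lambda>i j. Z x j - Z x i) {..<m} *
        det (mat m m (\<lambda>(i, j). poly (divided_difference (e (Suc j)) (Z x) i) (Z x i))))"
      by (simp only: det_scale_rows det_eq_vandermonde_times_divided_differences)
    also have "pairprod (\<lambda>i j. Z x j - Z x i) {..<m} = ?V x"
      by (simp only: prod_pairs_eq_pairprod pairprod_shift Z_def)
    finally show ?thesis
      by (simp only: f_def mult_ac)
  qed
  have "det_quotient m p = f"
    unfolding det_quotient_def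
  proof (rule the_equality)
    show "polynomial_fun m f \<and> (\<forall>x. ?V x \<noteq> 0 \<longrightarrow> f x = ?D x / ?V x)"
      using pf by (simp add: fV del: One_nat_def)
  next
    fix g assume g: "polynomial_fun m g \<and> (\<forall>x. ?V x \<noteq> 0 \<longrightarrow> g x = ?D x / ?V x)"
    show "g = f"
    proof (rule polynomial_fun_eqI[of m])
      fix x assume "?V x \<noteq> 0"
      then show "g x = f x"
        using g fV[of x] by (simp only: nonzero_divide_eq_eq not_False_eq_True)
    qed (use g pf in auto)
  qed
  then show "polynomial_fun m (det_quotient m p)"
    using pf by simp
  assume "?V x \<noteq> 0"
  then show "det_quotient m p x = ?D x / ?V x"
    unfolding \<open>det_quotient m p = f\<close> fV by (rule nonzero_mult_div_cancel_right[symmetric])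
qed

section \<open>The polynomials of the statement\<close>

context generic_base
begin

fun cpoly :: "nat \<Rightarrow> complex poly" where
  "cpoly 0 = 1"
| "cpoly (Suc 0) = [:0, 1:]"
| "cpoly (Suc (Suc r)) = [:0, 1:] * cpoly (Suc r) - smult (nu (r + 1) * nu (r + 2)) (cpoly r)"

lemma poly_cpoly_joukowski:
  assumes "z \<noteq> 0"
  shows "z ^ n * poly (cpoly n) (z + inverse z) = cy n (z\<^sup>2)"
proof (induction n rule: cpoly.induct)
  case 1
  then show ?case
    by (simp add: cy_0)
next
  case 2
  then show ?case
    using assms cy_1[of "z\<^sup>2"] by (simp add: algebra_simps power2_eq_square)
next
  case (3 r)
  have "z ^ Suc (Suc r) * poly (cpoly (Suc (Suc r))) (z + inverse z) =
      (z * (z + inverse z)) * (z ^ Suc r * poly (cpoly (Suc r)) (z + inverse z)) -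
      nu (r + 1) * nu (r + 2) * z\<^sup>2 * (z ^ r * poly (cpoly r) (z + inverse z))"
    by (simp add: algebra_simps power2_eq_square)
  also have "z * (z + inverse z) = 1 + z\<^sup>2"
    using assms by (simp add: algebra_simps power2_eq_square)
  finally show ?case
    unfolding 3 using cy_recurrence[of r "z\<^sup>2"] by simp
qed

text \<open>
  Hence the values at all \<open>z + 1/z\<close> determine a polynomial.
\<close>

lemma joukowski_surj: "\<exists>z. z \<noteq> 0 \<and> z + inverse z = (x :: complex)"
proof -
  define w where "w = csqrt (x\<^sup>2 - 4)"
  have w2: "w * w = x * x - 4"
    using power2_csqrt[of "x\<^sup>2 - 4"] by (simp add: w_def power2_eq_square)
  define z where "z = (x + w) / 2"
  have zw: "z * ((x - w) / 2) = 1"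
    using w2 by (simp add: z_def algebra_simps)
  then have "z \<noteq> 0" and iz: "inverse z = (x - w) / 2"
    using inverse_unique[OF zw] by (auto simp del: times_divide_eq_right)
  moreover have "z + inverse z = x"
    unfolding iz by (simp add: z_def field_simps)
  ultimately show ?thesis
    by blast
qed

lemma c_eq_cpoly: "c q n = cpoly n"
proof -
  define F where "F z = qpoch q q n / qpoch (-q) q n *
       (\<Sum>k=0..n. (qpoch (-q) q k * qpoch (-q) q (n - k)) / (qpoch q q k * qpoch q q (n - k)) *
          z powi (int n - 2 * int k))" for z
  have F: "F z = poly (cpoly n) (z + inverse z)" if z: "z \<noteq> 0" for z
  proof -
    have "z ^ n * F z = (\<Sum>k=0..n. alpha k * alpha (n - k) * (z ^ n * z powi (int n - 2 * int k))) / alpha n"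
      unfolding F_def sum_distrib_left sum_divide_distrib by (intro sum.cong refl) (simp add: alpha_def divide_inverse mult_ac)
    also have "(\<Sum>k=0..n. alpha k * alpha (n - k) * (z ^ n * z powi (int n - 2 * int k))) =
        (\<Sum>k=0..n. alpha k * alpha (n - k) * (z\<^sup>2) ^ (n - k))"
    proof (intro sum.cong refl)
      fix k assume "k \<in> {0..n}"
      then have "int n + (int n - 2 * int k) = int (2 * (n - k))"
        by auto
      then have "z powi (int n) * z powi (int n - 2 * int k) = z powi (int (2 * (n - k)))"
        using z by (metis power_int_add)
      then have "z ^ n * z powi (int n - 2 * int k) = (z\<^sup>2) ^ (n - k)"
        by (simp only: power_int_of_nat power_mult)
      then show "alpha k * alpha (n - k) * (z ^ n * z powi (int n - 2 * int k)) =
          alpha k * alpha (n - k) * (z\<^sup>2) ^ (n - k)"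
        by simp
    qed
    also have "\<dots> = (\<Sum>k=0..n. alpha (n - k) * alpha k * (z\<^sup>2) ^ k)"
      by (subst sum.atLeastAtMost_rev) simp
    also have "\<dots> / alpha n = cy n (z\<^sup>2)"
      by (simp add: cy_def atMost_atLeast0 mult_ac)
    finally show ?thesis
      using poly_cpoly_joukowski[OF z, of n] z by (metis mult_left_cancel power_not_zero)
  qed
  show ?thesis
    unfolding c_def F_def[symmetric]
  proof (rule the_equality)
    show "\<forall>z. z \<noteq> 0 \<longrightarrow> poly (cpoly n) (z + inverse z) = F z"
      using F by simp
  next
    fix p assume p: "\<forall>z. z \<noteq> 0 \<longrightarrow> poly p (z + inverse z) = F z"
    have "poly p x = poly (cpoly n) x" for x
      using joukowski_surj[of x] p F by metis
    then show "p = cpoly n"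
      by (simp add: poly_eq_poly_eq_iff[symmetric] fun_eq_iff)
  qed
qed

lemma cpoly_parity: "\<exists>e. \<forall>x. poly (cpoly n) x = x ^ (n mod 2) * poly e (x\<^sup>2)"
proof (induction n rule: cpoly.induct)
  case 1
  then show ?case
    by (intro exI[of _ 1]) simp
next
  case 2
  then show ?case
    by (intro exI[of _ 1]) simp
next
  case (3 r)
  then obtain e e' where e: "\<And>x. poly (cpoly (Suc r)) x = x ^ (Suc r mod 2) * poly e (x\<^sup>2)"
    "\<And>x. poly (cpoly r) x = x ^ (r mod 2) * poly e' (x\<^sup>2)"
    by blast
  define d where "d = (if even r then [:0, 1:] * e else e) - smult (nu (r + 1) * nu (r + 2)) e'"
  have "poly (cpoly (Suc (Suc r))) x = x ^ (Suc (Suc r) mod 2) * poly d (x\<^sup>2)" for x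
    by (cases "even r") (simp_all add: e d_def odd_iff_mod_2_eq_one even_iff_mod_2_eq_zero mod_Suc
      power2_eq_square algebra_simps)
  then show ?case
    by blast
qed

text \<open>
  The quotient of consecutive values of the left-hand side is \<open>-\<nu>\<^sub>n\<^sub>-\<^sub>k / \<nu>\<^sub>k\<^sub>+\<^sub>1\<close>.
\<close>

lemma weight_eq:
  assumes "k \<le> n"
  shows "alpha n * ((qpoch (-q) q k * qpoch (q powi (- int n)) q k) /
      (qpoch q q k * qpoch (- (q powi (- int n))) q k)) = (-1) ^ k * (alpha k * alpha (n - k))"
  using assms
proof (induction k)
  case 0
  then show ?case
    by (simp add: qpoch_def)
next
  case (Suc k)
  define t where "t = q powi (- int n)"
  define w where "w k = (qpoch (-q) q k * qpoch t q k) / (qpoch q q k * qpoch (- t) q k)" for k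
  have IH: "alpha n * w k = (-1) ^ k * (alpha k * alpha (n - k))"
    using Suc by (simp add: w_def t_def)
  have f1: "(1 - (-q) * q ^ k) / (1 - q * q ^ k) = 1 / nu (Suc k)"
    by (simp add: nu_def)
  have f2: "(1 - t * q ^ k) / (1 - (- t) * q ^ k) = - nu (n - k)"
  proof -
    define u where "u = t * q ^ k"
    have "t * q ^ n = 1"
      using q_nonzero by (simp add: t_def power_int_minus)
    moreover have "q ^ n = q ^ k * q ^ (n - k)"
      using Suc.prems by (simp flip: power_add)
    ultimately have "u * q ^ (n - k) = 1"
      by (simp add: u_def mult.assoc)
    moreover from this have u: "u \<noteq> 0"
      by auto
    ultimately have "q ^ (n - k) = 1 / u"
      by (simp add: field_simps)
    then have "nu (n - k) = (u - 1) / (u + 1)"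
      using u by (simp add: nu_def diff_divide_eq_iff add_divide_eq_iff)
    then show ?thesis
      by (simp add: u_def minus_divide_left add.commute)
  qed
  have "alpha n * w (Suc k) = (alpha n * w k) *
      ((1 - (-q) * q ^ k) / (1 - q * q ^ k) * ((1 - t * q ^ k) / (1 - (- t) * q ^ k)))"
    by (simp add: w_def qpoch_def mult_ac)
  also have "\<dots> = (-1) ^ k * (alpha k * alpha (n - k)) * (1 / nu (Suc k) * (- nu (n - k)))"
    unfolding IH f1 f2 ..
  also have "\<dots> = (-1) ^ Suc k * ((alpha k / nu (Suc k)) * (nu (n - k) * alpha (n - k)))"
    by simp
  also have "alpha k / nu (Suc k) = alpha (Suc k)"
    using nu_nonzero[of "Suc k"] by (simp add: alpha_down[of k])
  also have "nu (n - k) * alpha (n - k) = alpha (n - Suc k)"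
    using Suc.prems alpha_down[of "n - Suc k"] by (simp add: Suc_diff_Suc)
  finally show ?case
    by (simp add: w_def t_def)
qed

lemma P_eq_Phi: "P q n m x = Phi n m (\<lambda>i. - x (Suc i))"
proof -
  let ?W = "\<lambda>x i k. alpha k * alpha (n - k) * (- x i) ^ k"
  have "P q n m x = (\<Sum>k \<in> {1..m} \<rightarrow>\<^sub>E {0..n}. pairprod (\<lambda>i j. kern (k i) (k j)) {1..m} *
      (\<Prod>i=1..m. ?W x i (k i)))"
    unfolding P_def power_divide[symmetric] alpha_def[symmetric] sum_distrib_left
  proof (intro sum.cong refl)
    fix k assume k: "k \<in> {1..m} \<rightarrow>\<^sub>E {0..n}"
    let ?w = "\<lambda>i. (qpoch (-q) q (k i) * qpoch (q powi (- int n)) q (k i)) /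
      (qpoch q q (k i) * qpoch (- (q powi (- int n))) q (k i))"
    have "alpha n ^ m * (\<Prod>i=1..m. ?w i * x i ^ k i) = (\<Prod>i=1..m. alpha n * (?w i * x i ^ k i))"
      by (simp only: prod.distrib prod_constant card_atLeastAtMost diff_Suc_1)
    also have "\<dots> = (\<Prod>i=1..m. ?W x i (k i))"
    proof (intro prod.cong refl)
      fix i assume "i \<in> {1..m}"
      then have "k i \<le> n"
        using PiE_mem[OF k] by auto
      then have "alpha n * ?w i * x i ^ k i = (-1) ^ k i * (alpha (k i) * alpha (n - k i)) * x i ^ k i"
        by (simp only: weight_eq)
      then show "alpha n * (?w i * x i ^ k i) = ?W x i (k i)"
        by (simp add: power_minus[of "x i"] mult_ac)
    qed
    finally have prod: "alpha n ^ m * (\<Prod>i=1..m. ?w i * x i ^ k i) = (\<Prod>i=1..m. ?W x i (k i))" .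
    have kernel: "(\<Prod>j=1..m. \<Prod>i=1..<j. (q ^ k j - q ^ k i) / (q ^ k j + q ^ k i)) =
        pairprod (\<lambda>i j. kern (k i) (k j)) {1..m}"
      unfolding prod_pairs_eq_pairprod kern_def ..
    show "alpha n ^ m * ((\<Prod>j=1..m. \<Prod>i=1..<j. (q ^ k j - q ^ k i) / (q ^ k j + q ^ k i)) *
        (\<Prod>i=1..m. ?w i * x i ^ k i)) =
        pairprod (\<lambda>i j. kern (k i) (k j)) {1..m} * (\<Prod>i=1..m. ?W x i (k i))"
      unfolding kernel prod[symmetric] by (rule mult.left_commute)
  qed
  also have "\<dots> = schur_sum kern {..n} (?W x) {1..m}"
    by (simp add: schur_sum_def atMost_atLeast0)
  also have "{1..m} = Suc ` {..<m}"
    by (simp add: image_Suc_lessThan)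
  also have "schur_sum kern {..n} (?W x) (Suc ` {..<m}) = Phi n m (\<lambda>i. - x (Suc i))"
    unfolding Phi_def by (rule schur_sum_reindex) (simp add: strict_mono_on_def)
  finally show ?thesis .
qed

end

section \<open>The identity in the original variables\<close>

context generic_base
begin

lemma P_tilde_correct:
  shows "polynomial_fun m (P_tilde q N m)"
    and "(\<Prod>j=1..m. \<Prod>i=1..<j. (x j)\<^sup>2 - (x i)\<^sup>2) \<noteq> 0 \<Longrightarrow>
      P_tilde q N m x = det (mat m m (\<lambda>(i, j). poly (cpoly (N + 2 * j)) (x (i + 1)))) /
        (\<Prod>j=1..m. \<Prod>i=1..<j. (x j)\<^sup>2 - (x i)\<^sup>2)"
proof -
  have parity: "\<exists>e. \<forall>x. poly (c q (N + 2 * j - 2)) x = x ^ (N mod 2) * poly e (x\<^sup>2)" if "j \<in> {1..m}" for j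
  proof -
    have "N + 2 * j - 2 = N + 2 * (j - 1)"
      using that by auto
    then have "(N + 2 * j - 2) mod 2 = N mod 2"
      by simp
    then show ?thesis
      using cpoly_parity[of "N + 2 * j - 2"] by (simp add: c_eq_cpoly)
  qed
  show "polynomial_fun m (P_tilde q N m)"
    unfolding P_tilde_def by (rule det_quotient_correct(1)[OF parity])
  assume "(\<Prod>j=1..m. \<Prod>i=1..<j. (x j)\<^sup>2 - (x i)\<^sup>2) \<noteq> 0"
  then show "P_tilde q N m x = det (mat m m (\<lambda>(i, j). poly (cpoly (N + 2 * j)) (x (i + 1)))) /
        (\<Prod>j=1..m. \<Prod>i=1..<j. (x j)\<^sup>2 - (x i)\<^sup>2)"
    unfolding P_tilde_def by (subst det_quotient_correct(2)[OF parity]) (simp_all add: c_eq_cpoly)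
qed

lemma det_cy_joukowski:
  assumes "\<And>i. i < m \<Longrightarrow> t i \<noteq> 0"
  shows "det_cy N m (\<lambda>i. (t i)\<^sup>2) = (\<Prod>i<m. t i ^ N * (t i)\<^sup>2 ^ (m - 1)) *
    det (mat m m (\<lambda>(i, j). poly (cpoly (N + 2 * j)) (t i + inverse (t i))))"
  unfolding det_cy_def det_scale_rows[symmetric]
proof (rule det_mat_cong)
  fix i j assume i: "i < m" and j: "j < m"
  have "(t i)\<^sup>2 ^ (m - 1) = (t i)\<^sup>2 ^ (m - 1 - j) * t i ^ (2 * j)"
    using j by (simp add: power_mult flip: power_add)
  then have "t i ^ N * (t i)\<^sup>2 ^ (m - 1) = (t i)\<^sup>2 ^ (m - 1 - j) * t i ^ (N + 2 * j)"
    by (simp add: power_add)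
  then show "(t i)\<^sup>2 ^ (m - 1 - j) * cy (N + 2 * j) ((t i)\<^sup>2) =
      t i ^ N * (t i)\<^sup>2 ^ (m - 1) * poly (cpoly (N + 2 * j)) (t i + inverse (t i))"
    using poly_cpoly_joukowski[OF assms[OF i], of "N + 2 * j"] by (simp add: mult.assoc)
qed

lemma prod_alpha_reverse:
  "(\<Prod>i=1..Suc k. alpha (N + k + 1 - i)) = (\<Prod>i<Suc k. alpha (N + i))"
  by (rule prod.reindex_bij_witness[where i = "\<lambda>i. Suc k - i" and j = "\<lambda>i. Suc k - i"]) auto

text \<open>
  \<open>Phi_eq_det_cy\<close> at \<open>y\<^sub>i = s\<^sub>i\<^sup>2\<close>. The products over pairs are related by
  \<open>((s\<^sub>j + 1/s\<^sub>j)\<^sup>2 - (s\<^sub>i + 1/s\<^sub>i)\<^sup>2) s\<^sub>i\<^sup>2 s\<^sub>j\<^sup>2 = (s\<^sub>i\<^sup>2 - s\<^sub>j\<^sup>2) (1 - s\<^sub>i\<^sup>2 s\<^sub>j\<^sup>2)\<close>.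
\<close>

lemma main_identity_distinct:
  assumes m: "m \<ge> 1" "n + 1 \<ge> m" and nz: "\<And>i. i \<in> {1..m} \<Longrightarrow> s i \<noteq> 0"
    and V: "(\<Prod>j=1..m. \<Prod>i=1..<j. (s j + inverse (s j))\<^sup>2 - (s i + inverse (s i))\<^sup>2) \<noteq> 0"
  shows "Phi n m (\<lambda>i. (s (Suc i))\<^sup>2) =
    (\<Prod>i=1..m. alpha (n + 1 - i) * s i ^ (n + 1 - m)) *
    (\<Prod>j=1..m. \<Prod>i=1..<j. (s i)\<^sup>2 - (s j)\<^sup>2) *
    P_tilde q (n + 1 - m) m (\<lambda>i. s i + inverse (s i))"
proof -
  define N where "N = n + 1 - m"
  obtain k where k: "m = Suc k"
    using m by (cases m) auto
  have n: "n = N + k"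
    using m k by (simp add: N_def)
  define t where "t i = s (Suc i)" for i
  define \<xi> where "\<xi> x = x + inverse x" for x :: complex
  have tnz: "t i \<noteq> 0" if "i < m" for i
    using nz[of "Suc i"] that by (simp add: t_def)
  define A where "A = (\<Prod>i<m. alpha (N + i))"
  define B where "B = (\<Prod>i<m. t i ^ N)"
  define C where "C = (\<Prod>i<m. (t i)\<^sup>2 ^ (m - 1))"
  define D where "D = det (mat m m (\<lambda>(i, j). poly (cpoly (N + 2 * j)) (\<xi> (t i))))"
  define U where "U = pairprod (\<lambda>i j. 1 - (t i)\<^sup>2 * (t j)\<^sup>2) {..<m}"
  define W where "W = pairprod (\<lambda>i j. (t i)\<^sup>2 - (t j)\<^sup>2) {..<m}"
  define V' where "V' = pairprod (\<lambda>i j. (\<xi> (t j))\<^sup>2 - (\<xi> (t i))\<^sup>2) {..<m}"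
  have V': "(\<Prod>j=1..m. \<Prod>i=1..<j. (\<xi> (s j))\<^sup>2 - (\<xi> (s i))\<^sup>2) = V'"
    by (simp only: prod_pairs_eq_pairprod pairprod_shift V'_def t_def)
  have W: "(\<Prod>j=1..m. \<Prod>i=1..<j. (s i)\<^sup>2 - (s j)\<^sup>2) = W"
    by (simp only: prod_pairs_eq_pairprod pairprod_shift W_def t_def)
  have "V' \<noteq> 0"
    using V unfolding V'[symmetric] \<xi>_def .
  have "C \<noteq> 0"
    using tnz by (simp add: C_def)
  have AB: "(\<Prod>i=1..m. alpha (n + 1 - i) * s i ^ N) = A * B"
  proof -
    have "(\<Prod>i=1..m. s i ^ N) = B"
      unfolding B_def t_def image_Suc_lessThan[symmetric] by (subst prod.reindex) auto
    then show ?thesis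
      using prod_alpha_reverse[where N = N and k = k] by (simp add: prod.distrib A_def n k)
  qed
  have "U * Phi n m (\<lambda>i. (t i)\<^sup>2) = A * (B * C * D)"
    using Phi_eq_det_cy[of "\<lambda>i. (t i)\<^sup>2" k N] det_cy_joukowski[where m = m and t = t and N = N, OF tnz]
    by (simp add: U_def A_def B_def C_def D_def \<xi>_def n k prod.distrib del: prod.lessThan_Suc)
  moreover have "V' * C = W * U"
  proof -
    have "V' * C = pairprod (\<lambda>i j. ((\<xi> (t j))\<^sup>2 - (\<xi> (t i))\<^sup>2) * ((t i)\<^sup>2 * (t j)\<^sup>2)) {..<m}"
      unfolding V'_def C_def pairprod_geom[of "\<lambda>i. (t i)\<^sup>2", symmetric]
      by (rule pairprod_mult[symmetric])
    also have "\<dots> = pairprod (\<lambda>i j. ((t i)\<^sup>2 - (t j)\<^sup>2) * (1 - (t i)\<^sup>2 * (t j)\<^sup>2)) {..<m}"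
    proof (rule pairprod_cong)
      fix i j assume "i \<in> {..<m}" "j \<in> {..<m}"
      then have "t i \<noteq> 0" "t j \<noteq> 0"
        using tnz by auto
      then show "((\<xi> (t j))\<^sup>2 - (\<xi> (t i))\<^sup>2) * ((t i)\<^sup>2 * (t j)\<^sup>2) =
          ((t i)\<^sup>2 - (t j)\<^sup>2) * (1 - (t i)\<^sup>2 * (t j)\<^sup>2)"
        by (simp add: \<xi>_def field_simps power2_eq_square)
    qed
    also have "\<dots> = W * U"
      by (simp only: pairprod_mult W_def U_def)
    finally show ?thesis .
  qed
  ultimately have "C * (V' * Phi n m (\<lambda>i. (t i)\<^sup>2)) = C * (A * B * W * D)"
    by (metis mult.assoc mult.commute)
  then have "V' * Phi n m (\<lambda>i. (t i)\<^sup>2) = A * B * W * D"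
    using \<open>C \<noteq> 0\<close> by simp
  then have "Phi n m (\<lambda>i. (t i)\<^sup>2) = A * B * W * (D / V')"
    using \<open>V' \<noteq> 0\<close> by (simp add: field_simps)
  also have "D / V' = P_tilde q N m (\<lambda>i. \<xi> (s i))"
    using P_tilde_correct(2)[where m = m and N = N and x = "\<lambda>i. \<xi> (s i)"] \<open>V' \<noteq> 0\<close> unfolding V' by (simp add: D_def t_def)
  finally show ?thesis
    unfolding W AB[unfolded N_def] N_def[symmetric] t_def \<xi>_def using AB by simp
qed

lemma eventually_distinct_joukowski:
  fixes s :: "nat \<Rightarrow> complex"
  assumes nz: "\<And>i. i \<in> {1..m} \<Longrightarrow> s i \<noteq> 0"
  defines "Y \<equiv> \<lambda>\<sigma> i. s i + \<sigma> * of_nat i"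
  shows "eventually (\<lambda>\<sigma>. (\<forall>i\<in>{1..m}. Y \<sigma> i \<noteq> 0) \<and>
    (\<Prod>j=1..m. \<Prod>i=1..<j. (Y \<sigma> j + inverse (Y \<sigma> j))\<^sup>2 - (Y \<sigma> i + inverse (Y \<sigma> i))\<^sup>2) \<noteq> 0) (at 0)"
proof -
  have nonzero: "eventually (\<lambda>\<sigma>. \<forall>i\<in>{1..m}. Y \<sigma> i \<noteq> 0) (at 0)"
    unfolding Y_def by (intro eventually_ball_finite ballI eventually_affine_nonzero) auto
  have "eventually (\<lambda>\<sigma>. \<forall>j\<in>{1..m}. \<forall>i\<in>{1..<j}.
      (Y \<sigma> j - Y \<sigma> i) * (Y \<sigma> j + Y \<sigma> i) * ((Y \<sigma> i * Y \<sigma> j - 1) * (Y \<sigma> i * Y \<sigma> j + 1)) \<noteq> 0) (at 0)"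
  proof (intro eventually_ball_finite ballI)
    fix i j assume ij: "j \<in> {1..m}" "i \<in> {1..<j}"
    have quad: "eventually (\<lambda>\<sigma>. Y \<sigma> i * Y \<sigma> j + x \<noteq> 0) (at 0)" for x
    proof -
      have "eventually (\<lambda>\<sigma>. poly ([:s i, of_nat i:] * [:s j, of_nat j:] + [:x:]) \<sigma> \<noteq> 0) (at 0)"
      proof (rule eventually_poly_nonzero)
        have "coeff ([:s i, of_nat i:] * [:s j, of_nat j:] + [:x:]) 2 = of_nat i * of_nat j"
          by (simp add: numeral_2_eq_2)
        then show "[:s i, of_nat i:] * [:s j, of_nat j:] + [:x:] \<noteq> 0"
          using ij by auto
      qed
      then show ?thesis
        by eventually_elim (simp add: Y_def algebra_simps)
    qed
    have "eventually (\<lambda>\<sigma>. (s j - s i) + \<sigma> * (of_nat j - of_nat i) \<noteq> 0) (at 0)"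
      "eventually (\<lambda>\<sigma>. (s j + s i) + \<sigma> * of_nat (i + j) \<noteq> 0) (at 0)"
      using ij by (intro eventually_affine_nonzero; simp del: of_nat_add)+
    then show "eventually (\<lambda>\<sigma>. (Y \<sigma> j - Y \<sigma> i) * (Y \<sigma> j + Y \<sigma> i) *
        ((Y \<sigma> i * Y \<sigma> j - 1) * (Y \<sigma> i * Y \<sigma> j + 1)) \<noteq> 0) (at 0)"
      using quad[of "-1"] quad[of 1]
    proof eventually_elim
      case (elim \<sigma>)
      have "Y \<sigma> j - Y \<sigma> i = (s j - s i) + \<sigma> * (of_nat j - of_nat i)"
        "Y \<sigma> j + Y \<sigma> i = (s j + s i) + \<sigma> * of_nat (i + j)"
        by (simp_all add: Y_def algebra_simps)
      then show ?case
        using elim by simp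
    qed
  qed auto
  with nonzero show ?thesis
  proof eventually_elim
    case (elim \<sigma>)
    have "(Y \<sigma> j + inverse (Y \<sigma> j))\<^sup>2 - (Y \<sigma> i + inverse (Y \<sigma> i))\<^sup>2 \<noteq> 0"
      if ij: "j \<in> {1..m}" "i \<in> {1..<j}" for i j
    proof -
      have "Y \<sigma> i \<noteq> 0" "Y \<sigma> j \<noteq> 0"
        using elim(1) ij by auto
      then have "((Y \<sigma> j + inverse (Y \<sigma> j))\<^sup>2 - (Y \<sigma> i + inverse (Y \<sigma> i))\<^sup>2) * (Y \<sigma> i * Y \<sigma> j)\<^sup>2 =
          (Y \<sigma> j - Y \<sigma> i) * (Y \<sigma> j + Y \<sigma> i) * ((Y \<sigma> i * Y \<sigma> j - 1) * (Y \<sigma> i * Y \<sigma> j + 1))"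
        by (simp add: field_simps power2_eq_square)
      then show ?thesis
        using elim(2) ij by (metis mult_zero_left)
    qed
    then show ?case
      using elim(1) by simp
  qed
qed

text \<open>
  Both sides are continuous in \<open>s\<close>, the quotient \<open>P_tilde\<close> being a polynomial in \<open>s\<^sub>i + 1/s\<^sub>i\<close>.
\<close>

lemma main_identity:
  assumes m: "m \<ge> 1" "n + 1 \<ge> m" and nz: "\<And>i. i \<in> {1..m} \<Longrightarrow> s i \<noteq> 0"
  shows "Phi n m (\<lambda>i. (s (Suc i))\<^sup>2) =
    (\<Prod>i=1..m. alpha (n + 1 - i) * s i ^ (n + 1 - m)) *
    (\<Prod>j=1..m. \<Prod>i=1..<j. (s i)\<^sup>2 - (s j)\<^sup>2) *
    P_tilde q (n + 1 - m) m (\<lambda>i. s i + inverse (s i))"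
proof -
  define Y where "Y \<sigma> i = s i + \<sigma> * of_nat i" for \<sigma> i
  define L where "L \<sigma> = Phi n m (\<lambda>i. (Y \<sigma> (Suc i))\<^sup>2)" for \<sigma>
  define R where "R \<sigma> = (\<Prod>i=1..m. alpha (n + 1 - i) * Y \<sigma> i ^ (n + 1 - m)) *
    (\<Prod>j=1..m. \<Prod>i=1..<j. (Y \<sigma> i)\<^sup>2 - (Y \<sigma> j)\<^sup>2) *
    P_tilde q (n + 1 - m) m (\<lambda>i. Y \<sigma> i + inverse (Y \<sigma> i))" for \<sigma>
  have Y0: "Y 0 = s"
    by (simp add: Y_def fun_eq_iff)
  have contY: "isCont (\<lambda>\<sigma>. Y \<sigma> i) 0" for i
    unfolding Y_def by (intro continuous_intros)
  have "isCont L 0"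
    unfolding L_def by (intro isCont_Phi continuous_intros contY)
  moreover have "isCont R 0"
  proof -
    have "isCont (\<lambda>\<sigma>. P_tilde q (n + 1 - m) m (\<lambda>i. Y \<sigma> i + inverse (Y \<sigma> i))) 0"
      by (rule polynomial_fun_isCont[OF P_tilde_correct(1)], intro continuous_intros contY)
        (use nz in \<open>auto simp: Y0\<close>)
    then show ?thesis
      unfolding R_def by (intro continuous_intros contY)
  qed
  moreover have "eventually (\<lambda>\<sigma>. L \<sigma> = R \<sigma>) (at 0)"
  proof -
    have "eventually (\<lambda>\<sigma>. (\<forall>i\<in>{1..m}. Y \<sigma> i \<noteq> 0) \<and>
        (\<Prod>j=1..m. \<Prod>i=1..<j. (Y \<sigma> j + inverse (Y \<sigma> j))\<^sup>2 - (Y \<sigma> i + inverse (Y \<sigma> i))\<^sup>2) \<noteq> 0) (at 0)"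
      unfolding Y_def by (rule eventually_distinct_joukowski) (rule nz)
    then show ?thesis
      unfolding L_def R_def by eventually_elim (rule main_identity_distinct[OF m], auto)
  qed
  ultimately have "L 0 = R 0"
    by (rule isCont_eq_at_0)
  then show ?thesis
    by (simp only: L_def R_def Y0)
qed

lemma P_eq_P_tilde:
  assumes "m \<ge> 1" "n + 1 \<ge> m" and x: "\<forall>i\<in>{1..m}. x i \<noteq> 0 \<and> (s i)\<^sup>2 = - x i"
  shows "P q n m x =
    (\<Prod>i=1..m. alpha (n + 1 - i) * s i ^ (n + 1 - m)) *
    (\<Prod>j=1..m. \<Prod>i=1..<j. x j - x i) * P_tilde q (n + 1 - m) m (\<lambda>i. s i + inverse (s i))"
proof -
  have "P q n m x = Phi n m (\<lambda>i. (s (Suc i))\<^sup>2)"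
    unfolding P_eq_Phi using x by (intro Phi_cong) auto
  moreover have "(\<Prod>j=1..m. \<Prod>i=1..<j. x j - x i) = (\<Prod>j=1..m. \<Prod>i=1..<j. (s i)\<^sup>2 - (s j)\<^sup>2)"
    using x by (intro prod.cong) auto
  moreover have "s i \<noteq> 0" if "i \<in> {1..m}" for i
    using x that by fastforce
  ultimately show ?thesis
    using main_identity[where m = m and n = n and s = s] assms(1,2) by simp
qed

text \<open>
  \<open>c_norm_sq q k = 1 / (\<alpha>\<^sub>k \<alpha>\<^sub>k\<^sub>+\<^sub>1)\<close>, so the norms pair up consecutive factors.
\<close>

lemma prod_alpha_eq_norms:
  assumes "2 * m \<le> n + 1"
  shows "(\<Prod>i=1..2 * m. alpha (n + 1 - i)) = 1 / (\<Prod>i=1..m. c_norm_sq q (n + 1 - 2 * i))"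
  using assms
proof (induction m)
  case 0
  then show ?case by simp
next
  case (Suc m)
  have norm: "1 / c_norm_sq q (n + 1 - 2 * Suc m) = alpha (n + 1 - 2 * Suc m) * alpha (n + 1 - (2 * m + 1))"
  proof -
    have "n + 1 - 2 * Suc m + 1 = n + 1 - (2 * m + 1)"
      using Suc.prems by simp
    then show ?thesis
      unfolding c_norm_sq_def alpha_def by simp
  qed
  have "(\<Prod>i=1..2 * Suc m. alpha (n + 1 - i)) =
      (\<Prod>i=1..2 * m. alpha (n + 1 - i)) * alpha (n + 1 - (2 * m + 1)) * alpha (n + 1 - 2 * Suc m)"
    by simp
  also have "\<dots> = (1 / (\<Prod>i=1..m. c_norm_sq q (n + 1 - 2 * i))) * (1 / c_norm_sq q (n + 1 - 2 * Suc m))"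
    using Suc unfolding norm by simp
  also have "\<dots> = 1 / (\<Prod>i=1..Suc m. c_norm_sq q (n + 1 - 2 * i))"
    by simp
  finally show ?case .
qed

lemma P_eq_K_tilde:
  assumes "m \<ge> 1" "n + 1 \<ge> 2 * m" and x: "\<forall>i\<in>{1..2 * m}. x i \<noteq> 0 \<and> (s i)\<^sup>2 = - x i"
  shows "P q n (2 * m) x =
    (\<Prod>i=1..2 * m. s i ^ (n + 1 - 2 * m)) *
    (\<Prod>j=1..2 * m. \<Prod>i=1..<j. x j - x i) * K_tilde q n m (\<lambda>i. s i + inverse (s i))"
proof -
  have "(\<lambda>j. c q (n + 2 * j - 1 - 2 * m)) = (\<lambda>j. c q (n + 1 - 2 * m + 2 * j - 2))"
    using assms(1,2) by (intro ext arg_cong[where f = "c q"]) simp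
  then have "K_tilde q n m z =
      (\<Prod>i=1..2 * m. alpha (n + 1 - i)) * P_tilde q (n + 1 - 2 * m) (2 * m) z" for z
    unfolding K_tilde_def P_tilde_def prod_alpha_eq_norms[OF assms(2)] by simp
  then show ?thesis
    using P_eq_P_tilde[where m = "2 * m" and n = n and x = x and s = s] assms by (simp add: prod.distrib mult_ac)
qed

end

theorem theorem5p4:
  fixes q :: complex
  assumes "q \<noteq> 0" and "\<forall>k::nat. k > 0 \<longrightarrow> q ^ k \<noteq> 1"
  shows
    "(\<forall>(m::nat) (n::nat) (x :: nat \<Rightarrow> complex) (s :: nat \<Rightarrow> complex).
        m \<ge> 1 \<and> n + 1 \<ge> m \<and> (\<forall>i\<in>{1..m}. x i \<noteq> 0 \<and> (s i)\<^sup>2 = - x i) \<longrightarrow>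
        P q n m x =
          (\<Prod>i=1..m. qpoch (-q) q (n + 1 - i) / qpoch q q (n + 1 - i) * s i ^ (n + 1 - m)) *
          (\<Prod>j=1..m. \<Prod>i=1..<j. x j - x i) *
          P_tilde q (n + 1 - m) m (\<lambda>i. s i + inverse (s i)))
     \<and>
     (\<forall>(m::nat) (n::nat) (x :: nat \<Rightarrow> complex) (s :: nat \<Rightarrow> complex).
        m \<ge> 1 \<and> n + 1 \<ge> 2 * m \<and> (\<forall>i\<in>{1..2*m}. x i \<noteq> 0 \<and> (s i)\<^sup>2 = - x i) \<longrightarrow>
        P q n (2 * m) x =
          (\<Prod>i=1..2*m. s i ^ (n + 1 - 2 * m)) *
          (\<Prod>j=1..2*m. \<Prod>i=1..<j. x j - x i) *
          K_tilde q n m (\<lambda>i. s i + inverse (s i)))"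
proof -
  interpret generic_base q
    using assms by unfold_locales auto
  show ?thesis
    using P_eq_P_tilde[unfolded alpha_def] P_eq_K_tilde by blast
qed

end
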